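(* Let $G$ be a symmetry group of a discrete nonholonomic mechanical system $(Q,L_d,\mathcal{D}_d,\mathcal{D}^{nh})$, let $\mathcal{A}_d$ be a discrete connection on the principal $G$-bundle $\pi^{Q,G}:Q\to Q/G$, and let $\mathcal{M}=(\widetilde{G},\check L_d,\check{\mathcal{D}}_d,\check{\mathcal{D}},\check{\mathcal{P}})$ be the associated discrete Lagrange--D'Alembert--Poincaré system over $p^{Q/G}:\widetilde{G}\to Q/G$. Let $(v_\cdot,r_\cdot)=((v_0,r_1),\ldots,(v_{N-1},r_N))$ be a discrete path in $C'(\widetilde{G})=\widetilde{G}\times(Q/G)$. Then $(v_\cdot,r_\cdot)$ is a trajectory of $\mathcal{M}$ if and only if it is a trajectory of the reduced system, i.e. if and only if, writing $(v_k,r_{k+1})=\Upsilon_{\mathcal{A}_d}(q_k,q_{k+1})$ for $k=0,\ldots,N-1$ with $q_\cdot=(q_0,\ldots,q_N)\in Q^{N+1}$, one has $(v_k,r_{k+1})\in\check{\mathcal{D}}_d$ for all $k$ and $$d\check S_d(v_\cdot,r_\cdot)(\delta v_\cdot,\delta r_\cdot)=0$$ for all $(\delta v_\cdot,\delta r_\cdot)$ of the form $(\delta v_k,\delta r_{k+1})=d\Upsilon_{\mathcal{A}_d}(q_k,q_{k+1})(\delta q_k,\delta q_{k+1})$, $k=0,\ldots,N-1$, where $\delta q_k\in\mathcal{D}^{nh}_{q_k}$ for all $k$ and $\delta q_0=0$, $\delta q_N=0$. Here $\check S_d(v_\cdot,r_\cdot)=\sum_{k=0}^{N-1}\check L_d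(v_k,r_{k+1})$.
   Context: All manifolds, maps and actions are smooth; $p_j$ denotes projection onto the $j$-th factor; $D_1,D_2$ are partial differentials. Discrete nonholonomic mechanical systems. $(Q,L_d,\mathcal{D}_d,\mathcal{D}^{nh})$ consists of a manifold $Q$, a smooth $L_d:Q\times Q\to\mathbb{R}$, a regular (embedded) submanifold $\mathcal{D}_d\subset Q\times Q$ and a subbundle $\mathcal{D}^{nh}\subset TQ$. A Lie group $G$ acting on the left on $Q$ is a symmetry group if $\pi^{Q,G}:Q\to Q/G$ is a principal $G$-bundle, $L_d$ and $\mathcal{D}_d$ are invariant under the diagonal action on $Q\times Q$, and $\mathcal{D}^{nh}$ is invariant under the lifted action on $TQ$. Discrete connections. An (affine) discrete connection $\mathcal{A}_d$ on $\pi^{Q,G}$ is given by a submanifold $Hor\subset Q\times Q$, invariant under the diagonal $G$-action and containing $\{(q,\gamma(q)\cdot q):q\in Q\}$ for some smooth $\gamma:Q\to G$ with $\gamma(g\cdot q)=g\gamma(q)g^{-1}$, such that $(id_Q\times\pi^{Q,G})|_{Hor}:Hor\to Q\times(Q/G)$ is an injective local diffeomorphism. Its domain is $\{(q_0,g\cdot q_1):(q_0,q_1)\in Hor,\ g\in G\}$, where $\mathcal{A}_d(q_0,q_1)\in G$ is the unique $g$ with $(q_0,g^{-1}\cdot q_1)\in Hor$. Convention: the domain is all of $Q\times Q$. Reduced data. $\widetilde{G}:=(Q\times G)/G$ for $g\cdot(q,w)=(g\cdot q,gwg^{-1})$, with quotient map $\pi^{Q\times G,G}$, is a fiber bundle over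 $Q/G$ via $p^{Q/G}(\pi^{Q\times G,G}(q,w))=\pi^{Q,G}(q)$. $\Upsilon_{\mathcal{A}_d}:Q\times Q\to\widetilde{G}\times(Q/G)$ is $\Upsilon_{\mathcal{A}_d}(q_0,q_1):=(\pi^{Q\times G,G}(q_0,\mathcal{A}_d(q_0,q_1)),\pi^{Q,G}(q_1))$. $\check L_d$ is determined by $\check L_d\circ\Upsilon_{\mathcal{A}_d}=L_d$; $\check{\mathcal{D}}_d:=\Upsilon_{\mathcal{A}_d}(\mathcal{D}_d)$; $\check{\mathcal{D}}:=d\Upsilon_{\mathcal{A}_d}(p_1^*\mathcal{D}^{nh})$, i.e. $\check{\mathcal{D}}_{\Upsilon_{\mathcal{A}_d}(q_0,q_1)}=\{d\Upsilon_{\mathcal{A}_d}(q_0,q_1)(\delta q_0,0):\delta q_0\in\mathcal{D}^{nh}_{q_0}\}$, which consists of vectors $(\delta v,0)$; and $\check{\mathcal{P}}((v_0,r_1),(v_1,r_2))(\delta v_1,0):=D_2(p_1\circ\Upsilon_{\mathcal{A}_d})(q_0,q_1)(\delta q_1)\in T_{v_0}\widetilde{G}$ whenever $(v_0,r_1)=\Upsilon_{\mathcal{A}_d}(q_0,q_1)$, $(v_1,r_2)=\Upsilon_{\mathcal{A}_d}(q_1,q_2)$ and $\delta q_1\in\mathcal{D}^{nh}_{q_1}$ satisfies $\delta v_1=D_1(p_1\circ\Upsilon_{\mathcal{A}_d})(q_1,q_2)(\delta q_1)$ (all well defined). For every discrete path $(v_\cdot,r_\cdot)$ in $C'(\widetilde{G})$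 and every $q_0\in Q$ with $\pi^{Q,G}(q_0)=p^{Q/G}(v_0)$ there is a unique $(q_0,\ldots,q_N)$ with $\Upsilon_{\mathcal{A}_d}(q_k,q_{k+1})=(v_k,r_{k+1})$ for all $k$. Trajectories of a discrete Lagrange--D'Alembert--Poincaré system (DLDPS). For the DLDPS $\mathcal{M}=(\widetilde{G},\check L_d,\check{\mathcal{D}}_d,\check{\mathcal{D}},\check{\mathcal{P}})$ over the fiber bundle $p^{Q/G}:\widetilde{G}\to Q/G$, a discrete path in $C'(\widetilde{G})=\widetilde{G}\times(Q/G)$ is $((v_0,r_1),\ldots,(v_{N-1},r_N))$ ($N\geq 2$) with $p^{Q/G}(v_k)=r_k$ for $k=1,\ldots,N-1$. A nonholonomic infinitesimal variation with fixed endpoints over it is a tangent vector $((\delta v_0,\delta r_1),\ldots,(\delta v_{N-1},\delta r_N))$ such that $\delta r_k=dp^{Q/G}(v_k)(\delta v_k)$ for $k=1,\ldots,N-1$, $\delta r_N=0$, and for some $(\widetilde{\delta v_k},0)\in\check{\mathcal{D}}_{(v_k,r_{k+1})}$, $k=1,\ldots,N-1$: $\delta v_{N-1}=\widetilde{\delta v_{N-1}}$; $\delta v_k=\widetilde{\delta v_k}+\check{\mathcal{P}}((v_k,r_{k+1}),(v_{k+1},r_{k+2}))(\widetilde{\delta v_{k+1}},0)$ for $k=1,\ldots,N-2$; $\delta v_0=\check{\mathcal{P}}((v_0,r_1),(v_1,r_2))(\widetilde{\delta v_1},0)$. The path is a trajectory of $\mathcal{M}$ if $(v_k,r_{k+1})\in\check{\mathcal{D}}_d$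 for all $k=0,\ldots,N-1$ and $d\check S_d(v_\cdot,r_\cdot)$ vanishes on all such variations, where $\check S_d(v_\cdot,r_\cdot)=\sum_{k=0}^{N-1}\check L_d(v_k,r_{k+1})$. *)

theory Defs
  imports "HOL-Analysis.Analysis" "HOL-Algebra.Group_Action" "HOL-Library.Function_Algebras"
begin

section \<open>Smooth maps between subsets of Euclidean spaces\<close>

text \<open>\<open>Ck k U f\<close>: on the open set \<open>U\<close> the map \<open>f\<close> is \<open>k\<close> times continuously differentiable.\<close>

fun Ck :: "nat \<Rightarrow> 'a::euclidean_space set \<Rightarrow> ('a \<Rightarrow> 'b::euclidean_space) \<Rightarrow> bool" where
  "Ck 0 U f \<longleftrightarrow> continuous_on U f"
| "Ck (Suc k) U f \<longleftrightarrow>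
     (\<exists>f'. (\<forall>x\<in>U. (f has_derivative f' x) (at x)) \<and> (\<forall>h. Ck k U (\<lambda>x. f' x h)))"

text \<open>Smoothness on an arbitrary set means local extendability to a smooth map on an open set.
  Below it is only used on relatively open subsets of linear subspaces, where it is
  ordinary smoothness.\<close>

definition smooth_on :: "'a::euclidean_space set \<Rightarrow> ('a \<Rightarrow> 'b::euclidean_space) \<Rightarrow> bool" where
  "smooth_on A f \<longleftrightarrow>
     (\<forall>x\<in>A. \<exists>U g. open U \<and> x \<in> U \<and> (\<forall>k. Ck k U g) \<and> (\<forall>y\<in>A \<inter> U. g y = f y))"

section \<open>Smooth manifolds\<close>

text \<open>Charts are pairs of a domain and a coordinate map with values in a linear subspace
  \<open>model\<close> of a Euclidean space type. The dimension of the manifold is that of \<open>model\<close>; the type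
  only bounds it, so that dimension zero (e.g. discrete groups) is included.\<close>

record ('m, 'e) mfd =
  model :: "'e set"
  charts :: "('m set \<times> ('m \<Rightarrow> 'e)) set"

definition points :: "('m, 'e) mfd \<Rightarrow> 'm set" where
  "points M = (\<Union>(U, \<phi>)\<in>charts M. U)"

definition mfd_open :: "('m, 'e::euclidean_space) mfd \<Rightarrow> 'm set \<Rightarrow> bool" where
  "mfd_open M S \<longleftrightarrow> S \<subseteq> points M \<and>
     (\<forall>(U, \<phi>)\<in>charts M. \<exists>V. open V \<and> S \<inter> U = U \<inter> \<phi> -` V)"

definition mfd_topology :: "('m, 'e::euclidean_space) mfd \<Rightarrow> 'm topology" where
  "mfd_topology M = topology (mfd_open M)"

lemma istopology_mfd_open: "istopology (mfd_open M)"
  unfolding istopology_def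
proof (intro conjI allI impI)
  fix S T assume S: "mfd_open M S" and T: "mfd_open M T"
  show "mfd_open M (S \<inter> T)"
    unfolding mfd_open_def
  proof (intro conjI ballI)
    show "S \<inter> T \<subseteq> points M" using S by (auto simp: mfd_open_def)
    fix c assume c: "c \<in> charts M"
    obtain U \<phi> where [simp]: "c = (U, \<phi>)" by (cases c)
    obtain V where "open V" "S \<inter> U = U \<inter> \<phi> -` V" using S c by (auto simp: mfd_open_def)
    moreover obtain W where "open W" "T \<inter> U = U \<inter> \<phi> -` W" using T c by (auto simp: mfd_open_def)
    ultimately have "open (V \<inter> W)" "S \<inter> T \<inter> U = U \<inter> \<phi> -` (V \<inter> W)" by auto
    then show "case c of (U, \<phi>) \<Rightarrow> \<exists>V. open V \<and> S \<inter> T \<inter> U = U \<inter> \<phi> -` V" by auto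
  qed
next
  fix K assume K: "\<forall>S\<in>K. mfd_open M S"
  show "mfd_open M (\<Union>K)"
    unfolding mfd_open_def
  proof (intro conjI ballI)
    show "\<Union>K \<subseteq> points M" using K by (auto simp: mfd_open_def)
    fix c assume c: "c \<in> charts M"
    obtain U \<phi> where [simp]: "c = (U, \<phi>)" by (cases c)
    have "\<forall>S\<in>K. \<exists>V. open V \<and> S \<inter> U = U \<inter> \<phi> -` V" using K c by (auto simp: mfd_open_def)
    then obtain V where V: "\<And>S. S \<in> K \<Longrightarrow> open (V S) \<and> S \<inter> U = U \<inter> \<phi> -` V S" by metis
    have "\<Union>K \<inter> U = U \<inter> \<phi> -` (\<Union>S\<in>K. V S)" using V by blast
    then show "case c of (U, \<phi>) \<Rightarrow> \<exists>V. open V \<and> \<Union>K \<inter> U = U \<inter> \<phi> -` V"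
      using V by (auto intro!: exI[of _ "\<Union>S\<in>K. V S"])
  qed
qed

lemma openin_mfd_topology: "openin (mfd_topology M) = mfd_open M"
  unfolding mfd_topology_def by (rule topology_inverse'[OF istopology_mfd_open])

definition smooth_transition :: "'e::euclidean_space set \<Rightarrow> 'm set \<times> ('m \<Rightarrow> 'e) \<Rightarrow> 'm set \<times> ('m \<Rightarrow> 'e) \<Rightarrow> bool"
  where "smooth_transition E = (\<lambda>(U, \<phi>) (V, \<psi>).
     openin (top_of_set E) (\<phi> ` (U \<inter> V)) \<and> smooth_on (\<phi> ` (U \<inter> V)) (\<psi> \<circ> inv_into U \<phi>))"

text \<open>The charts of the maximal atlas.\<close>

definition compatible_chart :: "('m, 'e::euclidean_space) mfd \<Rightarrow> 'm set \<times> ('m \<Rightarrow> 'e) \<Rightarrow> bool" where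
  "compatible_chart M = (\<lambda>(U, \<phi>).
     U \<subseteq> points M \<and> inj_on \<phi> U \<and> openin (top_of_set (model M)) (\<phi> ` U) \<and>
     (\<forall>d\<in>charts M. smooth_transition (model M) (U, \<phi>) d \<and> smooth_transition (model M) d (U, \<phi>)))"

definition smooth_manifold :: "('m, 'e::euclidean_space) mfd \<Rightarrow> bool" where
  "smooth_manifold M \<longleftrightarrow>
     subspace (model M) \<and> (\<forall>c\<in>charts M. compatible_chart M c) \<and>
     Hausdorff_space (mfd_topology M) \<and> second_countable (mfd_topology M)"

text \<open>All pairs of charts are used, so openness of the coordinate domains expresses continuity.\<close>

definition smooth_map ::
  "('m, 'e::euclidean_space) mfd \<Rightarrow> ('n, 'f::euclidean_space) mfd \<Rightarrow> ('m \<Rightarrow> 'n) \<Rightarrow> bool" where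
  "smooth_map M N F \<longleftrightarrow> F ` points M \<subseteq> points N \<and>
     (\<forall>(U, \<phi>)\<in>charts M. \<forall>(V, \<psi>)\<in>charts N.
        openin (top_of_set (model M)) (\<phi> ` (U \<inter> F -` V)) \<and>
        smooth_on (\<phi> ` (U \<inter> F -` V)) (\<psi> \<circ> F \<circ> inv_into U \<phi>))"

definition diffeo ::
  "('m, 'e::euclidean_space) mfd \<Rightarrow> ('n, 'f::euclidean_space) mfd \<Rightarrow> ('m \<Rightarrow> 'n) \<Rightarrow> bool" where
  "diffeo M N F \<longleftrightarrow> bij_betw F (points M) (points N) \<and>
     smooth_map M N F \<and> smooth_map N M (inv_into (points M) F)"

definition open_sub :: "('m, 'e) mfd \<Rightarrow> 'm set \<Rightarrow> ('m, 'e) mfd" where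
  "open_sub M W = \<lparr>model = model M, charts = (\<lambda>(U, \<phi>). (U \<inter> W, \<phi>)) ` charts M\<rparr>"

definition prod_mfd :: "('m, 'e) mfd \<Rightarrow> ('n, 'f) mfd \<Rightarrow> ('m \<times> 'n, 'e \<times> 'f) mfd" where
  "prod_mfd M N = \<lparr>model = model M \<times> model N,
     charts = (\<lambda>((U, \<phi>), (V, \<psi>)). (U \<times> V, map_prod \<phi> \<psi>)) ` (charts M \<times> charts N)\<rparr>"

text \<open>A relatively open subset \<open>W\<close> of the linear subspace \<open>E\<close>.\<close>

definition euclid_mfd :: "'e set \<Rightarrow> 'e set \<Rightarrow> ('e, 'e) mfd" where
  "euclid_mfd E W = \<lparr>model = E, charts = {(W, id)}\<rparr>"

abbreviation real_line :: "(real, real) mfd" where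
  "real_line \<equiv> euclid_mfd UNIV UNIV"

definition local_diffeo ::
  "('m, 'e::euclidean_space) mfd \<Rightarrow> ('n, 'f::euclidean_space) mfd \<Rightarrow> ('m \<Rightarrow> 'n) \<Rightarrow> bool" where
  "local_diffeo M N F \<longleftrightarrow> (\<forall>x\<in>points M. \<exists>W. openin (mfd_topology M) W \<and> x \<in> W \<and>
     openin (mfd_topology N) (F ` W) \<and> diffeo (open_sub M W) (open_sub N (F ` W)) F)"

text \<open>Embedded submanifolds modelled on the subspace \<open>L\<close>, through slice charts.\<close>

definition slice_chart ::
  "('m, 'e::euclidean_space) mfd \<Rightarrow> 'e set \<Rightarrow> 'm set \<Rightarrow> 'm set \<times> ('m \<Rightarrow> 'e) \<Rightarrow> bool" where
  "slice_chart M L S = (\<lambda>(U, \<phi>). compatible_chart M (U, \<phi>) \<and> \<phi> ` (U \<inter> S) = \<phi> ` U \<inter> L)"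

definition embedded_submanifold ::
  "('m, 'e::euclidean_space) mfd \<Rightarrow> 'e set \<Rightarrow> 'm set \<Rightarrow> bool" where
  "embedded_submanifold M L S \<longleftrightarrow> subspace L \<and> L \<subseteq> model M \<and> S \<subseteq> points M \<and>
     (\<forall>x\<in>S. \<exists>U \<phi>. x \<in> U \<and> slice_chart M L S (U, \<phi>))"

definition sub_mfd :: "('m, 'e::euclidean_space) mfd \<Rightarrow> 'e set \<Rightarrow> 'm set \<Rightarrow> ('m, 'e) mfd" where
  "sub_mfd M L S = \<lparr>model = L, charts = {(U \<inter> S, \<phi>) | U \<phi>. slice_chart M L S (U, \<phi>)}\<rparr>"

text \<open>The quotient manifold structure on the image of \<open>\<pi>\<close>: the charts \<open>(U, \<phi>)\<close>
  for which \<open>\<phi> \<circ> \<pi>\<close> is a smooth submersion on the preimage of \<open>U\<close>, a submersion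
  being a smooth map with a smooth local section through every point of its domain.
  At most one smooth structure makes \<open>\<pi>\<close> a submersion; if there is one, modelled on \<open>E\<close>, this is
  its maximal atlas.\<close>

definition quotient_mfd ::
  "('m, 'e::euclidean_space) mfd \<Rightarrow> ('m \<Rightarrow> 'n) \<Rightarrow> 'f::euclidean_space set \<Rightarrow> ('n, 'f) mfd" where
  "quotient_mfd M \<pi> E = \<lparr>model = E, charts = {(U, \<phi>).
     U \<subseteq> \<pi> ` points M \<and> inj_on \<phi> U \<and> openin (top_of_set E) (\<phi> ` U) \<and>
     openin (mfd_topology M) {x \<in> points M. \<pi> x \<in> U} \<and>
     smooth_map (open_sub M {x \<in> points M. \<pi> x \<in> U}) (euclid_mfd E E) (\<phi> \<circ> \<pi>) \<and>
     (\<forall>x\<in>points M. \<pi> x \<in> U \<longrightarrow>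
        (\<exists>W \<sigma>. openin (top_of_set E) W \<and> W \<subseteq> \<phi> ` U \<and> \<phi> (\<pi> x) \<in> W \<and>
               smooth_map (euclid_mfd E W) M \<sigma> \<and> \<sigma> (\<phi> (\<pi> x)) = x \<and>
               (\<forall>y\<in>W. \<pi> (\<sigma> y) \<in> U \<and> \<phi> (\<pi> (\<sigma> y)) = y)))}\<rparr>"

section \<open>Tangent vectors\<close>

text \<open>Tangent vectors at \<open>p\<close> are the derivations of the functions that are smooth near \<open>p\<close>.
  They are extended by zero to all other functions, so that equality of tangent vectors is
  equality of HOL functions; sum and zero vector are the pointwise ones of
  \<^theory>\<open>HOL-Library.Function_Algebras\<close>. Dependence on the germ only is a consequence of the
  Leibniz rule.\<close>

type_synonym 'm tvec = "('m \<Rightarrow> real) \<Rightarrow> real"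

definition smooth_at :: "('m, 'e::euclidean_space) mfd \<Rightarrow> 'm \<Rightarrow> ('m \<Rightarrow> real) set" where
  "smooth_at M p =
     {f. \<exists>W. openin (mfd_topology M) W \<and> p \<in> W \<and> smooth_map (open_sub M W) real_line f}"

definition tangent_space :: "('m, 'e::euclidean_space) mfd \<Rightarrow> 'm \<Rightarrow> 'm tvec set" where
  "tangent_space M p = {\<delta>.
     (\<forall>f. f \<notin> smooth_at M p \<longrightarrow> \<delta> f = 0) \<and>
     (\<forall>f\<in>smooth_at M p. \<forall>c. \<delta> (\<lambda>x. c * f x) = c * \<delta> f) \<and>
     (\<forall>f\<in>smooth_at M p. \<forall>g\<in>smooth_at M p.
        \<delta> (\<lambda>x. f x + g x) = \<delta> f + \<delta> g \<and>
        \<delta> (\<lambda>x. f x * g x) = \<delta> f * g p + f p * \<delta> g)}"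

text \<open>\<open>differential N F p\<close> is \<open>dF(p)\<close> for a map \<open>F\<close> into \<open>N\<close> that is smooth near \<open>p\<close>.\<close>

definition differential ::
  "('n, 'f::euclidean_space) mfd \<Rightarrow> ('m \<Rightarrow> 'n) \<Rightarrow> 'm \<Rightarrow> 'm tvec \<Rightarrow> 'n tvec" where
  "differential N F p \<delta> = (\<lambda>f. if f \<in> smooth_at N (F p) then \<delta> (f \<circ> F) else 0)"

text \<open>The two mutually inverse identifications between \<open>T\<^sub>x M \<times> T\<^sub>y N\<close> and
  the tangent space of \<open>M \<times> N\<close> at \<open>(x, y)\<close>.\<close>

definition tpair ::
  "('m, 'e::euclidean_space) mfd \<Rightarrow> ('n, 'f::euclidean_space) mfd \<Rightarrow> 'm \<times> 'n \<Rightarrow>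
   'm tvec \<times> 'n tvec \<Rightarrow> ('m \<times> 'n) tvec" where
  "tpair M N = (\<lambda>(x, y) (\<delta>, \<epsilon>) f.
     if f \<in> smooth_at (prod_mfd M N) (x, y) then \<delta> (\<lambda>a. f (a, y)) + \<epsilon> (\<lambda>b. f (x, b)) else 0)"

definition tsplit ::
  "('m, 'e::euclidean_space) mfd \<Rightarrow> ('n, 'f::euclidean_space) mfd \<Rightarrow> 'm \<times> 'n \<Rightarrow>
   ('m \<times> 'n) tvec \<Rightarrow> 'm tvec \<times> 'n tvec" where
  "tsplit M N z \<zeta> = (differential M fst z \<zeta>, differential N snd z \<zeta>)"

definition partial1 ::
  "('n, 'f::euclidean_space) mfd \<Rightarrow> ('a \<times> 'b \<Rightarrow> 'n) \<Rightarrow> 'a \<times> 'b \<Rightarrow> 'a tvec \<Rightarrow> 'n tvec" where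
  "partial1 N F = (\<lambda>(x, y). differential N (\<lambda>a. F (a, y)) x)"

definition partial2 ::
  "('n, 'f::euclidean_space) mfd \<Rightarrow> ('a \<times> 'b \<Rightarrow> 'n) \<Rightarrow> 'a \<times> 'b \<Rightarrow> 'b tvec \<Rightarrow> 'n tvec" where
  "partial2 N F = (\<lambda>(x, y). differential N (\<lambda>b. F (x, b)) y)"

text \<open>Subbundles of \<open>TM\<close>, through smooth local frames.\<close>

definition smooth_vector_field ::
  "('m, 'e::euclidean_space) mfd \<Rightarrow> 'm set \<Rightarrow> ('m \<Rightarrow> 'm tvec) \<Rightarrow> bool" where
  "smooth_vector_field M U X \<longleftrightarrow> (\<forall>x\<in>U. X x \<in> tangent_space M x) \<and>
     (\<forall>W f. openin (mfd_topology M) W \<and> W \<subseteq> U \<and> smooth_map (open_sub M W) real_line f \<longrightarrow>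
        smooth_map (open_sub M W) real_line (\<lambda>x. X x f))"

definition subbundle :: "('m, 'e::euclidean_space) mfd \<Rightarrow> ('m \<Rightarrow> 'm tvec set) \<Rightarrow> bool" where
  "subbundle M D \<longleftrightarrow> (\<forall>p\<in>points M. \<exists>U n X. openin (mfd_topology M) U \<and> p \<in> U \<and>
     (\<forall>i<n::nat. smooth_vector_field M U (X i)) \<and>
     (\<forall>x\<in>U. D x = {(\<lambda>f. \<Sum>i<n. c i * X i x f) | c. True} \<and>
             (\<forall>c. (\<forall>f. (\<Sum>i<n. c i * X i x f) = 0) \<longrightarrow> (\<forall>i<n. c i = 0))))"

section \<open>Lie groups and principal bundles\<close>

definition Lie_group :: "'g monoid \<Rightarrow> ('g, 'f::euclidean_space) mfd \<Rightarrow> bool" where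
  "Lie_group G MG \<longleftrightarrow> Group.group G \<and> smooth_manifold MG \<and> points MG = carrier G \<and>
     smooth_map (prod_mfd MG MG) MG (\<lambda>(g, h). g \<otimes>\<^bsub>G\<^esub> h) \<and>
     smooth_map MG MG (\<lambda>g. inv\<^bsub>G\<^esub> g)"

definition smooth_action ::
  "'g monoid \<Rightarrow> ('g, 'f::euclidean_space) mfd \<Rightarrow> ('q, 'e::euclidean_space) mfd \<Rightarrow>
   ('g \<Rightarrow> 'q \<Rightarrow> 'q) \<Rightarrow> bool" where
  "smooth_action G MG M act \<longleftrightarrow> group_action G (points M) act \<and>
     smooth_map (prod_mfd MG M) M (\<lambda>(g, x). act g x)"

text \<open>\<open>M \<rightarrow> M/G\<close> is a principal bundle whose base is modelled on \<open>E\<close>: the quotient manifold exists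
  and there are equivariant local trivializations \<open>x \<mapsto> (\<pi> x, \<tau> x)\<close>, where \<open>G\<close> acts on the
  fibre \<open>G\<close> by left translations.\<close>

definition principal_bundle ::
  "'g monoid \<Rightarrow> ('g, 'f::euclidean_space) mfd \<Rightarrow> ('q, 'e::euclidean_space) mfd \<Rightarrow>
   ('g \<Rightarrow> 'q \<Rightarrow> 'q) \<Rightarrow> 'b::euclidean_space set \<Rightarrow> bool" where
  "principal_bundle G MG M act E \<longleftrightarrow>
     (let \<pi> = orbit G act; B = quotient_mfd M \<pi> E in
        smooth_manifold B \<and> points B = orbits G (points M) act \<and>
        (\<forall>b\<in>points B. \<exists>U \<tau>. openin (mfd_topology B) U \<and> b \<in> U \<and>
           (\<forall>g\<in>carrier G. \<forall>x\<in>points M. \<pi> x \<in> U \<longrightarrow> \<tau> (act g x) = g \<otimes>\<^bsub>G\<^esub> \<tau> x) \<and>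
           diffeo (open_sub M {x \<in> points M. \<pi> x \<in> U}) (prod_mfd (open_sub B U) MG)
             (\<lambda>x. (\<pi> x, \<tau> x))))"

section \<open>Discrete nonholonomic mechanical systems with symmetry\<close>

record ('q, 'e) nh_system =
  config :: "('q, 'e) mfd"
  Ld :: "'q \<times> 'q \<Rightarrow> real"
  Dd :: "('q \<times> 'q) set"
  Dnh :: "'q \<Rightarrow> 'q tvec set"

text \<open>\<open>base_model\<close> is the model space of \<open>Q/G\<close>.\<close>

record ('q, 'e, 'g, 'f, 'b) sym_system = "('q, 'e) nh_system" +
  sym_group :: "'g monoid"
  group_mfd :: "('g, 'f) mfd"
  act :: "'g \<Rightarrow> 'q \<Rightarrow> 'q"
  base_model :: "'b set"

definition discrete_nh_system :: "('q, 'e::euclidean_space, 'z) nh_system_scheme \<Rightarrow> bool" where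
  "discrete_nh_system S \<longleftrightarrow>
     smooth_manifold (config S) \<and>
     smooth_map (prod_mfd (config S) (config S)) real_line (Ld S) \<and>
     (\<exists>L. embedded_submanifold (prod_mfd (config S) (config S)) L (Dd S)) \<and>
     subbundle (config S) (Dnh S)"

definition symmetry_group ::
  "('q, 'e::euclidean_space, 'g, 'f::euclidean_space, 'b::euclidean_space) sym_system \<Rightarrow> bool" where
  "symmetry_group S \<longleftrightarrow>
     Lie_group (sym_group S) (group_mfd S) \<and>
     smooth_action (sym_group S) (group_mfd S) (config S) (act S) \<and>
     subspace (base_model S) \<and>
     principal_bundle (sym_group S) (group_mfd S) (config S) (act S) (base_model S) \<and>
     (\<forall>g\<in>carrier (sym_group S).
        (\<forall>q0\<in>points (config S). \<forall>q1\<in>points (config S).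
           Ld S (act S g q0, act S g q1) = Ld S (q0, q1)) \<and>
        (\<forall>(q0, q1)\<in>Dd S. (act S g q0, act S g q1) \<in> Dd S) \<and>
        (\<forall>q\<in>points (config S). \<forall>\<delta>\<in>Dnh S q.
           differential (config S) (act S g) q \<delta> \<in> Dnh S (act S g q)))"

definition piQ :: "('q, 'e, 'g, 'f, 'b) sym_system \<Rightarrow> 'q \<Rightarrow> 'q set" where
  "piQ S = orbit (sym_group S) (act S)"

definition shape :: "('q, 'e::euclidean_space, 'g, 'f, 'b::euclidean_space) sym_system \<Rightarrow> ('q set, 'b) mfd" where
  "shape S = quotient_mfd (config S) (piQ S) (base_model S)"

subsection \<open>Discrete connections\<close>

definition discrete_connection ::
  "('q, 'e::euclidean_space, 'g, 'f::euclidean_space, 'b::euclidean_space) sym_system \<Rightarrow>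
   ('q \<times> 'q) set \<Rightarrow> bool" where
  "discrete_connection S Hor \<longleftrightarrow>
     (\<forall>g\<in>carrier (sym_group S). \<forall>(q0, q1)\<in>Hor. (act S g q0, act S g q1) \<in> Hor) \<and>
     (\<exists>\<gamma>. smooth_map (config S) (group_mfd S) \<gamma> \<and>
        (\<forall>g\<in>carrier (sym_group S). \<forall>q\<in>points (config S).
           \<gamma> (act S g q) = g \<otimes>\<^bsub>sym_group S\<^esub> \<gamma> q \<otimes>\<^bsub>sym_group S\<^esub> inv\<^bsub>sym_group S\<^esub> g) \<and>
        (\<forall>q\<in>points (config S). (q, act S (\<gamma> q) q) \<in> Hor)) \<and>
     (\<exists>L. embedded_submanifold (prod_mfd (config S) (config S)) L Hor \<and>
        local_diffeo (sub_mfd (prod_mfd (config S) (config S)) L Hor)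
          (prod_mfd (config S) (shape S)) (\<lambda>(q0, q1). (q0, piQ S q1))) \<and>
     inj_on (\<lambda>(q0, q1). (q0, piQ S q1)) Hor"

definition connection_domain ::
  "('q, 'e, 'g, 'f, 'b) sym_system \<Rightarrow> ('q \<times> 'q) set \<Rightarrow> ('q \<times> 'q) set" where
  "connection_domain S Hor =
     {(q0, act S g q1) | q0 q1 g. (q0, q1) \<in> Hor \<and> g \<in> carrier (sym_group S)}"

definition Ad :: "('q, 'e, 'g, 'f, 'b) sym_system \<Rightarrow> ('q \<times> 'q) set \<Rightarrow> 'q \<Rightarrow> 'q \<Rightarrow> 'g" where
  "Ad S Hor q0 q1 = (THE g. g \<in> carrier (sym_group S) \<and>
     (q0, act S (inv\<^bsub>sym_group S\<^esub> g) q1) \<in> Hor)"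

subsection \<open>Reduced data\<close>

definition conj_act :: "('q, 'e, 'g, 'f, 'b) sym_system \<Rightarrow> 'g \<Rightarrow> 'q \<times> 'g \<Rightarrow> 'q \<times> 'g" where
  "conj_act S g = (\<lambda>(q, w).
     (act S g q, g \<otimes>\<^bsub>sym_group S\<^esub> w \<otimes>\<^bsub>sym_group S\<^esub> inv\<^bsub>sym_group S\<^esub> g))"

definition piQG :: "('q, 'e, 'g, 'f, 'b) sym_system \<Rightarrow> 'q \<times> 'g \<Rightarrow> ('q \<times> 'g) set" where
  "piQG S = orbit (sym_group S) (conj_act S)"

text \<open>The conjugate bundle \<open>(Q \<times> G)/G\<close>; its fibre over \<open>Q/G\<close> is \<open>G\<close>, whence the model space.\<close>

definition Gtilde ::
  "('q, 'e::euclidean_space, 'g, 'f::euclidean_space, 'b::euclidean_space) sym_system \<Rightarrow>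
   (('q \<times> 'g) set, 'b \<times> 'f) mfd" where
  "Gtilde S = quotient_mfd (prod_mfd (config S) (group_mfd S)) (piQG S)
     (base_model S \<times> model (group_mfd S))"

definition pQG :: "('q, 'e, 'g, 'f, 'b) sym_system \<Rightarrow> ('q \<times> 'g) set \<Rightarrow> 'q set" where
  "pQG S v = the_elem ((\<lambda>(q, w). piQ S q) ` v)"

definition Ups :: "('q, 'e, 'g, 'f, 'b) sym_system \<Rightarrow> ('q \<times> 'q) set \<Rightarrow>
    'q \<times> 'q \<Rightarrow> ('q \<times> 'g) set \<times> 'q set" where
  "Ups S Hor = (\<lambda>(q0, q1). (piQG S (q0, Ad S Hor q0 q1), piQ S q1))"

definition dUps ::
  "('q, 'e::euclidean_space, 'g, 'f::euclidean_space, 'b::euclidean_space) sym_system \<Rightarrow>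
   ('q \<times> 'q) set \<Rightarrow> 'q \<times> 'q \<Rightarrow> 'q tvec \<times> 'q tvec \<Rightarrow> ('q \<times> 'g) set tvec \<times> 'q set tvec" where
  "dUps S Hor z \<zeta> = tsplit (Gtilde S) (shape S) (Ups S Hor z)
     (differential (prod_mfd (Gtilde S) (shape S)) (Ups S Hor) z
       (tpair (config S) (config S) z \<zeta>))"

definition Ld_red :: "('q, 'e, 'g, 'f, 'b) sym_system \<Rightarrow> ('q \<times> 'q) set \<Rightarrow>
    ('q \<times> 'g) set \<times> 'q set \<Rightarrow> real" where
  "Ld_red S Hor z = (THE y. \<exists>x\<in>points (config S) \<times> points (config S).
     z = Ups S Hor x \<and> y = Ld S x)"

definition Dd_red :: "('q, 'e, 'g, 'f, 'b) sym_system \<Rightarrow> ('q \<times> 'q) set \<Rightarrow>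
    (('q \<times> 'g) set \<times> 'q set) set" where
  "Dd_red S Hor = Ups S Hor ` Dd S"

definition D_red ::
  "('q, 'e::euclidean_space, 'g, 'f::euclidean_space, 'b::euclidean_space) sym_system \<Rightarrow>
   ('q \<times> 'q) set \<Rightarrow> ('q \<times> 'g) set \<times> 'q set \<Rightarrow> (('q \<times> 'g) set tvec \<times> 'q set tvec) set" where
  "D_red S Hor z = {dUps S Hor (q0, q1) (\<delta>q0, 0) | q0 q1 \<delta>q0.
     q0 \<in> points (config S) \<and> q1 \<in> points (config S) \<and> z = Ups S Hor (q0, q1) \<and> \<delta>q0 \<in> Dnh S q0}"

definition P_red ::
  "('q, 'e::euclidean_space, 'g, 'f::euclidean_space, 'b::euclidean_space) sym_system \<Rightarrow>
   ('q \<times> 'q) set \<Rightarrow> ('q \<times> 'g) set \<times> 'q set \<Rightarrow> ('q \<times> 'g) set \<times> 'q set \<Rightarrow>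
   ('q \<times> 'g) set tvec \<times> 'q set tvec \<Rightarrow> ('q \<times> 'g) set tvec" where
  "P_red S Hor z0 z1 \<zeta> = (THE \<epsilon>. \<exists>q0 q1 q2 \<delta>q1.
     q0 \<in> points (config S) \<and> q1 \<in> points (config S) \<and> q2 \<in> points (config S) \<and>
     z0 = Ups S Hor (q0, q1) \<and> z1 = Ups S Hor (q1, q2) \<and> \<delta>q1 \<in> Dnh S q1 \<and>
     \<zeta> = (partial1 (Gtilde S) (fst \<circ> Ups S Hor) (q1, q2) \<delta>q1, 0) \<and>
     \<epsilon> = partial2 (Gtilde S) (fst \<circ> Ups S Hor) (q0, q1) \<delta>q1)"

section \<open>Discrete Lagrange--D'Alembert--Poincar\'e systems\<close>

record ('v, 'e, 'r, 'f) dldps =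
  total :: "('v, 'e) mfd"
  base :: "('r, 'f) mfd"
  bproj :: "'v \<Rightarrow> 'r"
  Lagr :: "'v \<times> 'r \<Rightarrow> real"
  kin :: "('v \<times> 'r) set"
  var :: "'v \<times> 'r \<Rightarrow> ('v tvec \<times> 'r tvec) set"
  chain :: "'v \<times> 'r \<Rightarrow> 'v \<times> 'r \<Rightarrow> 'v tvec \<times> 'r tvec \<Rightarrow> 'v tvec"

text \<open>Discrete paths are given by \<open>v\<^sub>0, \<dots>, v\<^sub>N\<^sub>-\<^sub>1\<close> and \<open>r\<^sub>1, \<dots>, r\<^sub>N\<close>; all other values of the
  functions \<open>v\<close> and \<open>r\<close> are irrelevant. The same applies to variations.\<close>

definition discrete_path ::
  "('v, 'e, 'r, 'f) dldps \<Rightarrow> nat \<Rightarrow> (nat \<Rightarrow> 'v) \<Rightarrow> (nat \<Rightarrow> 'r) \<Rightarrow> bool" where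
  "discrete_path M N v r \<longleftrightarrow> 2 \<le> N \<and>
     (\<forall>k<N. v k \<in> points (total M) \<and> r (Suc k) \<in> points (base M)) \<and>
     (\<forall>k\<in>{1..<N}. bproj M (v k) = r k)"

definition edges :: "(nat \<Rightarrow> 'v) \<Rightarrow> (nat \<Rightarrow> 'r) \<Rightarrow> nat \<Rightarrow> 'v \<times> 'r" where
  "edges v r k = (v k, r (Suc k))"

definition action_sum :: "('v, 'e, 'r, 'f) dldps \<Rightarrow> nat \<Rightarrow> (nat \<Rightarrow> 'v \<times> 'r) \<Rightarrow> real" where
  "action_sum M N z = (\<Sum>k<N. Lagr M (z k))"

text \<open>The differential of the discrete action on the \<open>N\<close>-fold product of \<open>total M \<times> base M\<close>,
  evaluated on a tuple of tangent vectors: the sum of the partial differentials.\<close>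

definition d_action ::
  "('v, 'e::euclidean_space, 'r, 'f::euclidean_space) dldps \<Rightarrow> nat \<Rightarrow>
   (nat \<Rightarrow> 'v \<times> 'r) \<Rightarrow> (nat \<Rightarrow> 'v tvec \<times> 'r tvec) \<Rightarrow> real" where
  "d_action M N z \<zeta> =
     (\<Sum>k<N. tpair (total M) (base M) (z k) (\<zeta> k) (\<lambda>x. action_sum M N (z(k := x))))"

definition nh_variation ::
  "('v, 'e::euclidean_space, 'r, 'f::euclidean_space) dldps \<Rightarrow> nat \<Rightarrow> (nat \<Rightarrow> 'v) \<Rightarrow> (nat \<Rightarrow> 'r) \<Rightarrow>
   (nat \<Rightarrow> 'v tvec) \<Rightarrow> (nat \<Rightarrow> 'r tvec) \<Rightarrow> bool" where
  "nh_variation M N v r \<delta>v \<delta>r \<longleftrightarrow>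
     (\<forall>k<N. \<delta>v k \<in> tangent_space (total M) (v k) \<and>
            \<delta>r (Suc k) \<in> tangent_space (base M) (r (Suc k))) \<and>
     (\<forall>k\<in>{1..<N}. \<delta>r k = differential (base M) (bproj M) (v k) (\<delta>v k)) \<and>
     \<delta>r N = 0 \<and>
     (\<exists>w. (\<forall>k\<in>{1..<N}. (w k, 0) \<in> var M (edges v r k)) \<and>
          \<delta>v (N - 1) = w (N - 1) \<and>
          (\<forall>k\<in>{1..N - 2}. \<delta>v k = w k + chain M (edges v r k) (edges v r (k + 1)) (w (k + 1), 0)) \<and>
          \<delta>v 0 = chain M (edges v r 0) (edges v r 1) (w 1, 0))"

definition dldps_trajectory ::
  "('v, 'e::euclidean_space, 'r, 'f::euclidean_space) dldps \<Rightarrow> nat \<Rightarrow> (nat \<Rightarrow> 'v) \<Rightarrow> (nat \<Rightarrow> 'r) \<Rightarrow> bool"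
  where
  "dldps_trajectory M N v r \<longleftrightarrow> (\<forall>k<N. edges v r k \<in> kin M) \<and>
     (\<forall>\<delta>v \<delta>r. nh_variation M N v r \<delta>v \<delta>r \<longrightarrow> d_action M N (edges v r) (edges \<delta>v \<delta>r) = 0)"

definition associated_dldps ::
  "('q, 'e::euclidean_space, 'g, 'f::euclidean_space, 'b::euclidean_space) sym_system \<Rightarrow>
   ('q \<times> 'q) set \<Rightarrow> (('q \<times> 'g) set, 'b \<times> 'f, 'q set, 'b) dldps" where
  "associated_dldps S Hor = \<lparr>total = Gtilde S, base = shape S, bproj = pQG S,
     Lagr = Ld_red S Hor, kin = Dd_red S Hor, var = D_red S Hor, chain = P_red S Hor\<rparr>"

section \<open>Trajectories of the reduced system\<close>

definition lifted_path ::
  "('q, 'e, 'g, 'f, 'b) sym_system \<Rightarrow> ('q \<times> 'q) set \<Rightarrow> nat \<Rightarrow>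
   (nat \<Rightarrow> ('q \<times> 'g) set) \<Rightarrow> (nat \<Rightarrow> 'q set) \<Rightarrow> (nat \<Rightarrow> 'q) \<Rightarrow> bool" where
  "lifted_path S Hor N v r q \<longleftrightarrow> (\<forall>k\<le>N. q k \<in> points (config S)) \<and>
     (\<forall>k<N. edges v r k = Ups S Hor (q k, q (Suc k)))"

definition reduced_trajectory ::
  "('q, 'e::euclidean_space, 'g, 'f::euclidean_space, 'b::euclidean_space) sym_system \<Rightarrow>
   ('q \<times> 'q) set \<Rightarrow> nat \<Rightarrow> (nat \<Rightarrow> ('q \<times> 'g) set) \<Rightarrow> (nat \<Rightarrow> 'q set) \<Rightarrow> (nat \<Rightarrow> 'q) \<Rightarrow> bool" where
  "reduced_trajectory S Hor N v r q \<longleftrightarrow>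
     (\<forall>k<N. edges v r k \<in> Dd_red S Hor) \<and>
     (\<forall>\<delta>q. (\<forall>k\<le>N. \<delta>q k \<in> Dnh S (q k)) \<and> \<delta>q 0 = 0 \<and> \<delta>q N = 0 \<longrightarrow>
        d_action (associated_dldps S Hor) N (edges v r)
          (\<lambda>k. dUps S Hor (q k, q (Suc k)) (\<delta>q k, \<delta>q (Suc k))) = 0)"

end

theory Submission
  imports Defs
begin

text \<open>Lift the path to \<open>q\<^sub>0, \<dots>, q\<^sub>N\<close>. With \<open>D\<^sub>1, D\<^sub>2\<close> the partial differentials of the first
  component of \<open>\<Upsilon>\<close>, the image of a variation \<open>\<delta>q\<close> has components
  \<open>\<delta>v\<^sub>k = D\<^sub>1(q\<^sub>k, q\<^sub>k\<^sub>+\<^sub>1) \<delta>q\<^sub>k + D\<^sub>2(q\<^sub>k, q\<^sub>k\<^sub>+\<^sub>1) \<delta>q\<^sub>k\<^sub>+\<^sub>1\<close>, and the second summand is the chain term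
  applied to \<open>D\<^sub>1(q\<^sub>k\<^sub>+\<^sub>1, q\<^sub>k\<^sub>+\<^sub>2) \<delta>q\<^sub>k\<^sub>+\<^sub>1\<close>. So the nonholonomic variations of the reduced path are
  exactly the images of the variations of the lift that vanish at both ends. That the chain map is
  well defined rests on the injectivity of \<open>D\<^sub>1(q\<^sub>1, q\<^sub>2)\<close>: the map
  \<open>q \<mapsto> [q, \<A>(q, q\<^sub>2)]\<close> has a smooth left inverse, given by horizontal lifting and
  the free action.\<close>

section \<open>Calculus of smooth maps\<close>

text \<open>Three obstacles shape the development. The points of \<open>Gtilde S\<close> are only
  the classes covered by a chart of \<open>quotient_mfd\<close>, and its manifold axioms are never
  established. So smoothness into it is asserted only at its points, which the discrete path
  supplies, and the maps \<open>pQG\<close> and \<open>retract\<close> out of it are shown smooth by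
  descent from Q x G. Next, \<open>D_red\<close> and \<open>P_red\<close> quantify over all lifts of
  an edge, so any other lift has to be moved onto the fixed one by the diagonal action; for two
  consecutive edges the two group elements agree because the action is free. Freeness and the
  smoothness of \<open>Ad\<close> are consequences, not clauses, of the definitions. Finally, the
  gluing condition on the base components holds automatically for images of lifted variations:
  \<open>pQG\<close> after the first component of Upsilon is the projection of the first argument,
  so its differential turns the D1 term into the differential of \<open>piQ\<close> and kills the D2
  term. The differential of the action is never computed; only the families of tangent tuples on
  which it must vanish are compared.\<close>

lemma Ck_subset: "Ck k U f \<Longrightarrow> V \<subseteq> U \<Longrightarrow> Ck k V f"
proof (induction k arbitrary: f)
  case 0
  then show ?case by (auto intro: continuous_on_subset)
next
  case (Suc k)
  then show ?case unfolding Ck.simps by (meson subsetD)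
qed

lemma Ck_Suc_imp: "Ck (Suc k) U f \<Longrightarrow> Ck k U f"
proof (induction k arbitrary: f)
  case 0
  then show ?case
    by (auto intro!: continuous_at_imp_continuous_on dest: has_derivative_continuous)
next
  case (Suc k)
  then show ?case by (metis Ck.simps(2))
qed

lemma Ck_const: "Ck k U (\<lambda>x. c)"
proof (induction k arbitrary: c)
  case (Suc k)
  then show ?case by (auto intro!: exI[of _ "\<lambda>x h. 0"])
qed auto

lemma Ck_bounded_linear: "bounded_linear L \<Longrightarrow> Ck k U L"
proof (cases k)
  case 0
  then show "bounded_linear L \<Longrightarrow> Ck k U L" by (auto intro: linear_continuous_on)
next
  case (Suc n)
  assume "bounded_linear L"
  then have "\<forall>x\<in>U. (L has_derivative L) (at x)" by (auto intro: bounded_linear_imp_has_derivative)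
  then show "Ck k U L" unfolding Suc Ck.simps by (intro exI[of _ "\<lambda>x. L"]) (auto intro: Ck_const)
qed

lemma Ck_bounded_linear_comp:
  assumes L: "bounded_linear L" and "Ck k U f"
  shows "Ck k U (\<lambda>x. L (f x))"
  using assms(2)
proof (induction k arbitrary: f)
  case 0
  then show ?case
    using bounded_linear.continuous_on[OF L] by auto
next
  case (Suc k)
  then obtain f' where "\<forall>x\<in>U. (f has_derivative f' x) (at x)" "\<forall>h. Ck k U (\<lambda>x. f' x h)" by auto
  then show ?case unfolding Ck.simps
    by (intro exI[of _ "\<lambda>x h. L (f' x h)"])
       (auto intro!: Suc.IH bounded_linear.has_derivative[OF L])
qed

lemma Ck_add: "Ck k U f \<Longrightarrow> Ck k U g \<Longrightarrow> Ck k U (\<lambda>x. f x + g x)"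
proof (induction k arbitrary: f g)
  case 0
  then show ?case by (auto intro: continuous_on_add)
next
  case (Suc k)
  then obtain f' g' where
    "\<forall>x\<in>U. (f has_derivative f' x) (at x)" "\<forall>h. Ck k U (\<lambda>x. f' x h)"
    "\<forall>x\<in>U. (g has_derivative g' x) (at x)" "\<forall>h. Ck k U (\<lambda>x. g' x h)" by auto
  then show ?case unfolding Ck.simps
    by (intro exI[of _ "\<lambda>x h. f' x h + g' x h"]) (auto intro!: Suc.IH has_derivative_add)
qed

lemma Ck_sum:
  "(\<And>i. i \<in> I \<Longrightarrow> Ck k U (f i)) \<Longrightarrow> Ck k U (\<lambda>x. \<Sum>i\<in>I. f i x)"
  by (induction I rule: infinite_finite_induct) (auto intro: Ck_add Ck_const)

lemma Ck_scaleR: "Ck k U f \<Longrightarrow> Ck k U g \<Longrightarrow> Ck k U (\<lambda>x. f x *\<^sub>R g x)"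
proof (induction k arbitrary: f g)
  case 0
  then show ?case by (auto intro: continuous_on_scaleR)
next
  case (Suc k)
  then obtain f' g' where
    d: "\<forall>x\<in>U. (f has_derivative f' x) (at x)" "\<forall>h. Ck k U (\<lambda>x. f' x h)"
    "\<forall>x\<in>U. (g has_derivative g' x) (at x)" "\<forall>h. Ck k U (\<lambda>x. g' x h)" by auto
  moreover have "Ck k U f" "Ck k U g" using Suc.prems by (blast intro: Ck_Suc_imp)+
  ultimately show ?case unfolding Ck.simps
    by (intro exI[of _ "\<lambda>x h. f x *\<^sub>R g' x h + f' x h *\<^sub>R g x"])
       (auto intro!: Suc.IH Ck_add has_derivative_scaleR)
qed

lemma Ck_Pair: "Ck k U f \<Longrightarrow> Ck k U g \<Longrightarrow> Ck k U (\<lambda>x. (f x, g x))"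
proof (induction k arbitrary: f g)
  case 0
  then show ?case by (auto intro: continuous_on_Pair)
next
  case (Suc k)
  then obtain f' g' where
    "\<forall>x\<in>U. (f has_derivative f' x) (at x)" "\<forall>h. Ck k U (\<lambda>x. f' x h)"
    "\<forall>x\<in>U. (g has_derivative g' x) (at x)" "\<forall>h. Ck k U (\<lambda>x. g' x h)" by auto
  then show ?case unfolding Ck.simps
    by (intro exI[of _ "\<lambda>x h. (f' x h, g' x h)"]) (auto intro!: Suc.IH has_derivative_Pair)
qed

text \<open>In the chain rule the direction \<open>f' x h\<close> depends on \<open>x\<close>,
  whereas \<open>Ck\<close> controls \<open>g'\<close> only in constant directions. Expanding the
  direction in the basis leaves products of \<open>Ck\<close> functions.\<close>

lemma Ck_comp:
  fixes f :: "'a::euclidean_space \<Rightarrow> 'b::euclidean_space"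
    and g :: "'b \<Rightarrow> 'c::euclidean_space"
  assumes "Ck k U f" "Ck k V g" "f ` U \<subseteq> V"
  shows "Ck k U (\<lambda>x. g (f x))"
  using assms
proof (induction k arbitrary: g)
  case 0
  then show ?case by (auto intro: continuous_on_compose2)
next
  case (Suc k)
  then obtain f' g' where
    d: "\<And>x. x \<in> U \<Longrightarrow> (f has_derivative f' x) (at x)" "\<And>h. Ck k U (\<lambda>x. f' x h)"
    "\<And>x. x \<in> V \<Longrightarrow> (g has_derivative g' x) (at x)" "\<And>h. Ck k V (\<lambda>x. g' x h)"
    unfolding Ck.simps by metis
  have fk: "Ck k U f" using Suc.prems(1) by (rule Ck_Suc_imp)
  \<comment> \<open>This is \<open>g' (f x) (f' x h)\<close> with the inner vector written in
    coordinates, so that \<open>g'\<close> is only applied to the fixed vectors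
    \<open>b\<close>.\<close>
  define D where "D x h = (\<Sum>b\<in>Basis. (f' x h \<bullet> b) *\<^sub>R g' (f x) b)" for x h
  have "((\<lambda>x. g (f x)) has_derivative D x) (at x)" if "x \<in> U" for x
  proof -
    have fx: "f x \<in> V" using that Suc.prems by auto
    have "linear (g' (f x))" using d(3)[OF fx] by (auto intro: has_derivative_linear)
    then have "g' (f x) (\<Sum>b\<in>Basis. (y \<bullet> b) *\<^sub>R b) = (\<Sum>b\<in>Basis. (y \<bullet> b) *\<^sub>R g' (f x) b)" for y
      by (simp add: linear_sum linear_cmul)
    then have "g' (f x) y = (\<Sum>b\<in>Basis. (y \<bullet> b) *\<^sub>R g' (f x) b)" for y
      unfolding euclidean_representation .
    then have "D x = (\<lambda>h. g' (f x) (f' x h))" unfolding D_def by metis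
    then show ?thesis using has_derivative_compose[OF d(1)[OF that] d(3)[OF fx]] by simp
  qed
  moreover have "Ck k U (\<lambda>x. D x h)" for h
    unfolding D_def
    by (intro Ck_sum Ck_scaleR Ck_bounded_linear_comp[OF bounded_linear_inner_left] d(2)
        Suc.IH[OF fk d(4) Suc.prems(3)])
  ultimately show ?case by auto
qed

section \<open>Smooth maps near a point\<close>

text \<open>The clause \<open>F y \<in> fst d\<close> for all nearby \<open>y\<close> builds
  continuity into the notion. The set \<open>O'\<close> is open in the whole Euclidean type, not
  only in the model subspace, because \<open>Ck\<close> differentiates there.\<close>

definition smooth_rep :: "'m set \<times> ('m \<Rightarrow> 'e::euclidean_space) \<Rightarrow> 'n set \<times> ('n \<Rightarrow> 'f::euclidean_space)
    \<Rightarrow> ('m \<Rightarrow> 'n) \<Rightarrow> 'm \<Rightarrow> bool" where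
  "smooth_rep c d F x \<longleftrightarrow> (\<exists>O' g. open O' \<and> snd c x \<in> O' \<and> (\<forall>k. Ck k O' g) \<and>
     (\<forall>y\<in>fst c. snd c y \<in> O' \<longrightarrow> F y \<in> fst d \<and> snd d (F y) = g (snd c y)))"

text \<open>Smoothness of \<open>F\<close> on the open set \<open>W\<close>, free of the inverses of the coordinate maps.\<close>

definition smap :: "('m, 'e::euclidean_space) mfd \<Rightarrow> 'm set \<Rightarrow> ('n, 'f::euclidean_space) mfd
    \<Rightarrow> ('m \<Rightarrow> 'n) \<Rightarrow> bool" where
  "smap M W N F \<longleftrightarrow> mfd_open M W \<and> F ` W \<subseteq> points N \<and>
     (\<forall>c\<in>charts M. \<forall>d\<in>charts N. \<forall>x\<in>fst c \<inter> W. F x \<in> fst d \<longrightarrow> smooth_rep c d F x)"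

text \<open>This is the part of the manifold axioms that is built into the charts of
  \<open>quotient_mfd\<close>; it is therefore available for \<open>Gtilde\<close> without any
  compatibility of charts.\<close>

definition atlas_ok :: "('m, 'e::euclidean_space) mfd \<Rightarrow> bool" where
  "atlas_ok M \<longleftrightarrow> (\<forall>(U, \<phi>)\<in>charts M. inj_on \<phi> U \<and> openin (top_of_set (model M)) (\<phi> ` U))"

lemma points_eq: "points M = (\<Union>c\<in>charts M. fst c)"
  by (auto simp: points_def split_beta)

lemma chart_subset_points: "c \<in> charts M \<Longrightarrow> fst c \<subseteq> points M"
  by (auto simp: points_eq)

lemma in_pointsE:
  assumes "x \<in> points M"
  obtains c where "c \<in> charts M" "x \<in> fst c"
  using assms by (auto simp: points_eq)

text \<open>The single set \<open>V\<close> required for a chart is the union of the local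
  witnesses. The pointwise form lets openness be checked together with local
  representatives.\<close>

lemma mfd_open_iff:
  "mfd_open M S \<longleftrightarrow> S \<subseteq> points M \<and> (\<forall>c\<in>charts M. \<forall>x\<in>S \<inter> fst c. \<exists>O'. open O' \<and> snd c x \<in> O' \<and>
      (\<forall>y\<in>fst c. snd c y \<in> O' \<longrightarrow> y \<in> S))" (is "?l \<longleftrightarrow> ?r")
proof
  assume l: ?l
  show ?r
  proof (intro conjI ballI)
    show "S \<subseteq> points M" using l by (simp add: mfd_open_def)
    fix c x assume cx: "c \<in> charts M" "x \<in> S \<inter> fst c"
    then obtain V where "open V" "S \<inter> fst c = fst c \<inter> snd c -` V"
      using l by (auto simp: mfd_open_def split_beta)
    then show "\<exists>O'. open O' \<and> snd c x \<in> O' \<and> (\<forall>y\<in>fst c. snd c y \<in> O' \<longrightarrow> y \<in> S)"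
      using cx by (intro exI[of _ V]) auto
  qed
next
  assume r: ?r
  show ?l unfolding mfd_open_def split_beta
  proof (intro conjI ballI)
    show "S \<subseteq> points M" using r by blast
    fix c assume c: "c \<in> charts M"
    then have "\<forall>x\<in>S \<inter> fst c. \<exists>O'. open O' \<and> snd c x \<in> O' \<and> (\<forall>y\<in>fst c. snd c y \<in> O' \<longrightarrow> y \<in> S)"
      using r by blast
    then obtain O' where O': "\<And>x. x \<in> S \<inter> fst c \<Longrightarrow>
        open (O' x) \<and> snd c x \<in> O' x \<and> (\<forall>y\<in>fst c. snd c y \<in> O' x \<longrightarrow> y \<in> S)" by metis
    then show "\<exists>V. open V \<and> S \<inter> fst c = fst c \<inter> snd c -` V"
      by (intro exI[of _ "\<Union>x\<in>S \<inter> fst c. O' x"]) auto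
  qed
qed

lemma mfd_openD:
  assumes "mfd_open M S" "c \<in> charts M" "x \<in> S" "x \<in> fst c"
  obtains O' where "open O'" "snd c x \<in> O'" "\<And>y. y \<in> fst c \<Longrightarrow> snd c y \<in> O' \<Longrightarrow> y \<in> S"
  using assms by (metis (no_types, lifting) IntI mfd_open_iff)

lemma mfd_open_subset: "mfd_open M S \<Longrightarrow> S \<subseteq> points M"
  by (simp add: mfd_open_def)

lemma mfd_open_Int: "mfd_open M S \<Longrightarrow> mfd_open M T \<Longrightarrow> mfd_open M (S \<inter> T)"
  by (metis openin_Int openin_mfd_topology)

lemma mfd_open_Union: "(\<And>S. S \<in> K \<Longrightarrow> mfd_open M S) \<Longrightarrow> mfd_open M (\<Union>K)"
  by (metis openin_Union openin_mfd_topology)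

lemma mfd_open_points: "mfd_open M (points M)"
  unfolding mfd_open_iff using chart_subset_points by (auto intro!: exI[of _ UNIV])

lemma smooth_repE:
  assumes "smooth_rep c d F x"
  obtains O' g where "open O'" "snd c x \<in> O'" "\<And>k. Ck k O' g"
     "\<And>y. y \<in> fst c \<Longrightarrow> snd c y \<in> O' \<Longrightarrow> F y \<in> fst d \<and> snd d (F y) = g (snd c y)"
  using assms unfolding smooth_rep_def by metis

lemma Ck_imp_cont: "(\<And>k. Ck k U f) \<Longrightarrow> continuous_on U f"
  by (metis Ck.simps(1))

lemma smapD: "smap M W N F \<Longrightarrow> c \<in> charts M \<Longrightarrow> d \<in> charts N \<Longrightarrow> x \<in> fst c \<Longrightarrow> x \<in> W \<Longrightarrow> F x \<in> fst d
    \<Longrightarrow> smooth_rep c d F x"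
  unfolding smap_def by blast

lemma smap_in_points: "smap M W N F \<Longrightarrow> x \<in> W \<Longrightarrow> F x \<in> points N"
  unfolding smap_def by blast

lemma smap_subset: "smap M W N F \<Longrightarrow> mfd_open M W' \<Longrightarrow> W' \<subseteq> W \<Longrightarrow> smap M W' N F"
  unfolding smap_def by blast

lemma smap_vimage_open:
  assumes "smap M W N F" "mfd_open N W'"
  shows "mfd_open M (W \<inter> F -` W')"
  unfolding mfd_open_iff
proof (intro conjI ballI)
  show "W \<inter> F -` W' \<subseteq> points M" using assms by (auto simp: smap_def dest: mfd_open_subset)
  fix c x assume c: "c \<in> charts M" and "x \<in> W \<inter> F -` W' \<inter> fst c"
  then have x: "x \<in> W" "F x \<in> W'" "x \<in> fst c" by auto
  obtain d where d: "d \<in> charts N" "F x \<in> fst d"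
    using smap_in_points[OF assms(1) x(1)] by (rule in_pointsE)
  obtain O1 g where O1: "open O1" "snd c x \<in> O1" "\<And>k. Ck k O1 g"
     "\<And>y. y \<in> fst c \<Longrightarrow> snd c y \<in> O1 \<Longrightarrow> F y \<in> fst d \<and> snd d (F y) = g (snd c y)"
    using smapD[OF assms(1) c d(1) x(3,1) d(2)] by (metis smooth_repE)
  obtain O2 where O2: "open O2" "snd d (F x) \<in> O2" "\<And>y. y \<in> fst d \<Longrightarrow> snd d y \<in> O2 \<Longrightarrow> y \<in> W'"
    using mfd_openD[OF assms(2) d(1) x(2) d(2)] by blast
  obtain O3 where O3: "open O3" "snd c x \<in> O3" "\<And>y. y \<in> fst c \<Longrightarrow> snd c y \<in> O3 \<Longrightarrow> y \<in> W"
    using mfd_openD[OF _ c x(1,3)] assms(1) unfolding smap_def by blast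
  have "open (O3 \<inter> (O1 \<inter> g -` O2))"
    using O1 O2 O3 Ck_imp_cont continuous_on_open_vimage by (metis inf_commute open_Int)
  moreover have "snd c x \<in> O3 \<inter> (O1 \<inter> g -` O2)" using O1 O2 O3 x by auto
  moreover have "y \<in> W \<inter> F -` W'" if "y \<in> fst c" "snd c y \<in> O3 \<inter> (O1 \<inter> g -` O2)" for y
    using that O1(4)[of y] O2(3)[of "F y"] O3(3)[of y] by auto
  ultimately show "\<exists>O'. open O' \<and> snd c x \<in> O' \<and> (\<forall>y\<in>fst c. snd c y \<in> O' \<longrightarrow> y \<in> W \<inter> F -` W')"
    by blast
qed

lemma smap_comp:
  assumes F: "smap M W N F" and H: "smap N W' P H"
  shows "smap M (W \<inter> F -` W') P (H \<circ> F)"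
  unfolding smap_def
proof (intro conjI ballI impI)
  show "mfd_open M (W \<inter> F -` W')" using smap_vimage_open[OF F] H by (simp add: smap_def)
  show "(H \<circ> F) ` (W \<inter> F -` W') \<subseteq> points P" using smap_in_points[OF H] by auto
  fix c e x assume c: "c \<in> charts M" and e: "e \<in> charts P" "(H \<circ> F) x \<in> fst e"
    and "x \<in> fst c \<inter> (W \<inter> F -` W')"
  then have x: "x \<in> W" "F x \<in> W'" "x \<in> fst c" by auto
  obtain d where d: "d \<in> charts N" "F x \<in> fst d"
    using smap_in_points[OF F x(1)] by (rule in_pointsE)
  obtain O1 g where O1: "open O1" "snd c x \<in> O1" "\<And>k. Ck k O1 g"
     "\<And>y. y \<in> fst c \<Longrightarrow> snd c y \<in> O1 \<Longrightarrow> F y \<in> fst d \<and> snd d (F y) = g (snd c y)"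
    using smapD[OF F c d(1) x(3,1) d(2)] by (metis smooth_repE)
  have "smooth_rep d e H (F x)" using smapD[OF H d(1) e(1) d(2) x(2)] e(2) by simp
  then obtain O2 h where O2: "open O2" "snd d (F x) \<in> O2" "\<And>k. Ck k O2 h"
     "\<And>y. y \<in> fst d \<Longrightarrow> snd d y \<in> O2 \<Longrightarrow> H y \<in> fst e \<and> snd e (H y) = h (snd d y)"
    by (metis smooth_repE)
  have "open (O1 \<inter> g -` O2)"
    using O1 O2 Ck_imp_cont continuous_on_open_vimage by (metis inf_commute)
  moreover have "snd c x \<in> O1 \<inter> g -` O2" using O1 O2 x by auto
  moreover have "Ck k (O1 \<inter> g -` O2) (\<lambda>z. h (g z))" for k
    by (rule Ck_comp[OF Ck_subset[OF O1(3)] O2(3)]) auto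
  moreover have "(H \<circ> F) y \<in> fst e \<and> snd e ((H \<circ> F) y) = h (g (snd c y))"
    if "y \<in> fst c" "snd c y \<in> O1 \<inter> g -` O2" for y
    using that O1(4)[of y] O2(4)[of "F y"] by auto
  ultimately show "smooth_rep c e (H \<circ> F) x" unfolding smooth_rep_def by blast
qed

lemma smap_cong:
  assumes F: "smap M W N F" and eq: "\<And>x. x \<in> W \<Longrightarrow> F x = F' x"
  shows "smap M W N F'"
  unfolding smap_def
proof (intro conjI ballI impI)
  show W: "mfd_open M W" using F by (simp add: smap_def)
  show "F' ` W \<subseteq> points N" using F eq unfolding smap_def by force
  fix c d x assume c: "c \<in> charts M" and d: "d \<in> charts N" and x: "x \<in> fst c \<inter> W" and dx: "F' x \<in> fst d"
  obtain O1 g where O1: "open O1" "snd c x \<in> O1" "\<And>k. Ck k O1 g"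
     "\<And>y. y \<in> fst c \<Longrightarrow> snd c y \<in> O1 \<Longrightarrow> F y \<in> fst d \<and> snd d (F y) = g (snd c y)"
    using smapD[OF F c d] x dx eq by (metis IntD1 IntD2 smooth_repE)
  obtain O3 where O3: "open O3" "snd c x \<in> O3" "\<And>y. y \<in> fst c \<Longrightarrow> snd c y \<in> O3 \<Longrightarrow> y \<in> W"
    using mfd_openD[OF W c] x by blast
  have "open (O1 \<inter> O3)" "snd c x \<in> O1 \<inter> O3" using O1 O3 by auto
  moreover have "Ck k (O1 \<inter> O3) g" for k using O1(3) Ck_subset by blast
  moreover have "F' y \<in> fst d \<and> snd d (F' y) = g (snd c y)"
    if "y \<in> fst c" "snd c y \<in> O1 \<inter> O3" for y
    using that O1(4)[of y] O3(3)[of y] eq[of y] by auto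
  ultimately show "smooth_rep c d F' x" unfolding smooth_rep_def by blast
qed

lemma smap_Union:
  assumes "\<And>W. W \<in> K \<Longrightarrow> smap M W N F"
  shows "smap M (\<Union>K) N F"
  using assms mfd_open_Union[of K M] unfolding smap_def by blast

lemma atlas_okD:
  "atlas_ok M \<Longrightarrow> c \<in> charts M \<Longrightarrow> inj_on (snd c) (fst c)"
  "atlas_ok M \<Longrightarrow> c \<in> charts M \<Longrightarrow> openin (top_of_set (model M)) (snd c ` fst c)"
  by (auto simp: atlas_ok_def split_beta)

text \<open>Injectivity of the charts translates between points and coordinates, and openness of
  their images makes relatively open sets of coordinates correspond to traces of open sets.
  Afterwards \<open>inv_into\<close> can be forgotten.\<close>

lemma smooth_map_iff_smap:
  assumes M: "atlas_ok M"
  shows "smooth_map M N F \<longleftrightarrow> smap M (points M) N F"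
proof
  assume F: "smooth_map M N F"
  show "smap M (points M) N F"
    unfolding smap_def
  proof (intro conjI ballI impI)
    show "mfd_open M (points M)" by (rule mfd_open_points)
    show "F ` points M \<subseteq> points N" using F by (simp add: smooth_map_def)
    fix c d x assume c: "c \<in> charts M" and d: "d \<in> charts N" and x: "x \<in> fst c \<inter> points M"
      and dx: "F x \<in> fst d"
    let ?A = "snd c ` (fst c \<inter> F -` fst d)"
    have *: "openin (top_of_set (model M)) ?A"
      "smooth_on ?A (snd d \<circ> F \<circ> inv_into (fst c) (snd c))"
      using F c d by (auto simp: smooth_map_def split_beta)
    \<comment> \<open>A coordinate of the chart that lies in \<open>O1\<close> lies in
      \<open>?A\<close>; injectivity then shows that the point itself is mapped into
      \<open>fst d\<close>.\<close>
    obtain O1 where O1: "open O1" "?A = model M \<inter> O1" using *(1) by (auto simp: openin_open)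
    have xA: "snd c x \<in> ?A" using x dx by auto
    obtain O2 g where O2: "open O2" "snd c x \<in> O2" "\<And>k. Ck k O2 g"
       "\<And>y. y \<in> ?A \<inter> O2 \<Longrightarrow> g y = (snd d \<circ> F \<circ> inv_into (fst c) (snd c)) y"
      using *(2) xA unfolding smooth_on_def by meson
    have "open (O1 \<inter> O2)" "snd c x \<in> O1 \<inter> O2" using O1 O2 xA by auto
    moreover have "Ck k (O1 \<inter> O2) g" for k using O2(3) Ck_subset by blast
    moreover have "F y \<in> fst d \<and> snd d (F y) = g (snd c y)"
      if y: "y \<in> fst c" "snd c y \<in> O1 \<inter> O2" for y
    proof -
      have "snd c y \<in> model M" using atlas_okD(2)[OF M c] y openin_imp_subset by fastforce
      then have yA: "snd c y \<in> ?A" using y O1 by auto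
      then obtain y' where "y' \<in> fst c" "F y' \<in> fst d" "snd c y = snd c y'" by auto
      then have "F y \<in> fst d" using inj_onD[OF atlas_okD(1)[OF M c]] y by metis
      moreover have "g (snd c y) = snd d (F y)"
        using O2(4)[of "snd c y"] yA y inv_into_f_f[OF atlas_okD(1)[OF M c] y(1)] by simp
      ultimately show ?thesis by simp
    qed
    ultimately show "smooth_rep c d F x" unfolding smooth_rep_def by blast
  qed
next
  assume F: "smap M (points M) N F"
  have *: "openin (top_of_set (model M)) (snd c ` (fst c \<inter> F -` fst d)) \<and>
     smooth_on (snd c ` (fst c \<inter> F -` fst d)) (snd d \<circ> F \<circ> inv_into (fst c) (snd c))"
    if c: "c \<in> charts M" and d: "d \<in> charts N" for c d
  proof
    let ?A = "snd c ` (fst c \<inter> F -` fst d)"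
    have rep: "smooth_rep c d F x" if "x \<in> fst c" "F x \<in> fst d" for x
      using smapD[OF F c d] that chart_subset_points[OF c] by blast
    show "openin (top_of_set (model M)) ?A"
    proof (subst openin_subopen, intro ballI)
      fix z assume "z \<in> ?A"
      then obtain x where x: "x \<in> fst c" "F x \<in> fst d" "z = snd c x" by auto
      obtain O1 g where O1: "open O1" "snd c x \<in> O1" 
        "\<And>y. y \<in> fst c \<Longrightarrow> snd c y \<in> O1 \<Longrightarrow> F y \<in> fst d \<and> snd d (F y) = g (snd c y)"
        using rep[OF x(1,2)] by (metis smooth_repE)
      have "openin (top_of_set (model M)) (snd c ` fst c \<inter> O1)"
        using atlas_okD(2)[OF M c] O1(1) by (metis openin_Int_open)
      moreover have "z \<in> snd c ` fst c \<inter> O1" "snd c ` fst c \<inter> O1 \<subseteq> ?A" using x O1 by auto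
      ultimately show "\<exists>T. openin (top_of_set (model M)) T \<and> z \<in> T \<and> T \<subseteq> ?A" by blast
    qed
    show "smooth_on ?A (snd d \<circ> F \<circ> inv_into (fst c) (snd c))"
      unfolding smooth_on_def
    proof
      fix z assume "z \<in> ?A"
      then obtain x where x: "x \<in> fst c" "F x \<in> fst d" "z = snd c x" by auto
      obtain O1 g where O1: "open O1" "snd c x \<in> O1" "\<And>k. Ck k O1 g"
        "\<And>y. y \<in> fst c \<Longrightarrow> snd c y \<in> O1 \<Longrightarrow> F y \<in> fst d \<and> snd d (F y) = g (snd c y)"
        using rep[OF x(1,2)] by (metis smooth_repE)
      have "g y = (snd d \<circ> F \<circ> inv_into (fst c) (snd c)) y" if "y \<in> ?A \<inter> O1" for y
        using that O1(4) inv_into_f_f[OF atlas_okD(1)[OF M c]] by auto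
      then show "\<exists>U g. open U \<and> z \<in> U \<and> (\<forall>k. Ck k U g) \<and>
          (\<forall>y\<in>?A \<inter> U. g y = (snd d \<circ> F \<circ> inv_into (fst c) (snd c)) y)"
        using O1 x by blast
    qed
  qed
  show "smooth_map M N F"
    using F * by (auto simp: smooth_map_def smap_def split_beta)
qed

lemma points_open_sub: "points (open_sub M W) = points M \<inter> W"
  by (auto simp: points_def open_sub_def)

lemma charts_open_sub: "charts (open_sub M W) = (\<lambda>c. (fst c \<inter> W, snd c)) ` charts M"
  by (auto simp: open_sub_def split_beta)

lemma atlas_ok_open_sub:
  assumes "atlas_ok M" "mfd_open M W"
  shows "atlas_ok (open_sub M W)"
  unfolding atlas_ok_def charts_open_sub
proof (clarsimp, intro conjI)
  fix U \<phi> assume c: "(U, \<phi>) \<in> charts M"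
  have inj: "inj_on \<phi> U" and op: "openin (top_of_set (model M)) (\<phi> ` U)"
    using atlas_okD[OF assms(1) c] by auto
  then show "inj_on \<phi> (U \<inter> W)" by (auto intro: inj_on_subset)
  obtain V where "open V" "W \<inter> U = U \<inter> \<phi> -` V" using assms(2) c by (auto simp: mfd_open_def)
  then have "\<phi> ` (U \<inter> W) = \<phi> ` U \<inter> V" "open V" by auto
  then show "openin (top_of_set (model (open_sub M W))) (\<phi> ` (U \<inter> W))"
    using op by (simp add: open_sub_def openin_Int_open)
qed

lemma smap_open_sub:
  assumes W: "mfd_open M W"
  shows "smap (open_sub M W) W N F \<longleftrightarrow> smap M W N F"
proof -
  have ps: "points (open_sub M W) = W" using mfd_open_subset[OF W] by (auto simp: points_open_sub)
  have "smooth_rep (fst c \<inter> W, snd c) d F x \<longleftrightarrow> smooth_rep c d F x"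
    if c: "c \<in> charts M" and "d \<in> charts N" and x: "x \<in> fst c" "x \<in> W" for c d x
  proof
    assume "smooth_rep (fst c \<inter> W, snd c) d F x"
    then obtain O1 g where O1: "open O1" "snd c x \<in> O1" "\<And>k. Ck k O1 g"
      "\<And>y. y \<in> fst c \<inter> W \<Longrightarrow> snd c y \<in> O1 \<Longrightarrow> F y \<in> fst d \<and> snd d (F y) = g (snd c y)"
      using smooth_repE[of "(fst c \<inter> W, snd c)" d F x] by (metis fst_conv snd_conv)
    obtain O3 where O3: "open O3" "snd c x \<in> O3" "\<And>y. y \<in> fst c \<Longrightarrow> snd c y \<in> O3 \<Longrightarrow> y \<in> W"
      using mfd_openD[OF W c x(2,1)] by blast
    have "open (O1 \<inter> O3)" "snd c x \<in> O1 \<inter> O3" using O1 O3 by auto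
    moreover have "Ck k (O1 \<inter> O3) g" for k using O1(3) Ck_subset by blast
    moreover have "F y \<in> fst d \<and> snd d (F y) = g (snd c y)"
      if "y \<in> fst c" "snd c y \<in> O1 \<inter> O3" for y
      using that O1(4)[of y] O3(3)[of y] by auto
    ultimately show "smooth_rep c d F x" unfolding smooth_rep_def by blast
  qed (auto simp: smooth_rep_def)
  moreover have "mfd_open (open_sub M W) W" using mfd_open_points[of "open_sub M W"] ps by simp
  ultimately have "smap (open_sub M W) W N F \<longleftrightarrow> mfd_open M W \<and> F ` W \<subseteq> points N \<and>
     (\<forall>c\<in>charts M. \<forall>d\<in>charts N. \<forall>x\<in>fst c \<inter> W. F x \<in> fst d \<longrightarrow> smooth_rep c d F x)"
    unfolding smap_def charts_open_sub using W by auto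
  then show ?thesis unfolding smap_def .
qed

lemma smooth_map_open_sub:
  assumes "atlas_ok M" "mfd_open M W"
  shows "smooth_map (open_sub M W) N F \<longleftrightarrow> smap M W N F"
proof -
  have "points (open_sub M W) = W" using mfd_open_subset[OF assms(2)] by (auto simp: points_open_sub)
  then show ?thesis
    using smooth_map_iff_smap[OF atlas_ok_open_sub[OF assms]] smap_open_sub[OF assms(2)] by metis
qed

text \<open>The domain is hidden in the quantifier, so compositions need no bookkeeping of open
  sets; \<open>smap_if_near\<close> recovers the version on a given open set.\<close>

definition smooth_near ::
  "('m, 'e::euclidean_space) mfd \<Rightarrow> ('n, 'f::euclidean_space) mfd \<Rightarrow> ('m \<Rightarrow> 'n) \<Rightarrow> 'm \<Rightarrow> bool" where
  "smooth_near M N F x \<longleftrightarrow> (\<exists>W. x \<in> W \<and> smap M W N F)"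

lemma smooth_at_iff:
  assumes "atlas_ok M"
  shows "f \<in> smooth_at M p \<longleftrightarrow> smooth_near M real_line f p"
  unfolding smooth_at_def smooth_near_def openin_mfd_topology
  using smooth_map_open_sub[OF assms] by (auto simp: smap_def)

lemma smooth_near_in_points:
  "smooth_near M N F x \<Longrightarrow> x \<in> points M" "smooth_near M N F x \<Longrightarrow> F x \<in> points N"
  unfolding smooth_near_def smap_def using mfd_open_subset by blast+

lemma smooth_near_comp:
  assumes "smooth_near M N F x" "smooth_near N P H (F x)"
  shows "smooth_near M P (H \<circ> F) x"
  using assms smap_comp unfolding smooth_near_def by (metis IntI vimageI)

lemma smooth_near_cong:
  assumes F: "smooth_near M N F x" and W: "mfd_open M W" "x \<in> W" and eq: "\<And>y. y \<in> W \<Longrightarrow> F y = F' y"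
  shows "smooth_near M N F' x"
proof -
  obtain V where V: "x \<in> V" "smap M V N F" using F by (auto simp: smooth_near_def)
  then have "smap M (V \<inter> W) N F"
    using smap_subset mfd_open_Int W by (metis inf_le1 smap_def)
  then show ?thesis using V W eq smap_cong[of M "V \<inter> W" N F F'] by (auto simp: smooth_near_def)
qed

lemma smooth_map_imp_near:
  "smooth_map M N F \<Longrightarrow> atlas_ok M \<Longrightarrow> x \<in> points M \<Longrightarrow> smooth_near M N F x"
  unfolding smooth_near_def using smooth_map_iff_smap by blast

lemma smap_imp_near: "smap M W N F \<Longrightarrow> x \<in> W \<Longrightarrow> smooth_near M N F x"
  by (auto simp: smooth_near_def)

lemma smap_if_near:
  assumes "mfd_open M W" "\<And>x. x \<in> W \<Longrightarrow> smooth_near M N F x"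
  shows "smap M W N F"
proof -
  let ?K = "{V. smap M V N F}"
  have "smap M (\<Union>?K) N F" by (rule smap_Union) auto
  moreover have "W \<subseteq> \<Union>?K" using assms(2) by (auto simp: smooth_near_def)
  ultimately show ?thesis using smap_subset assms(1) by blast
qed

section \<open>Products, quotients and submanifolds\<close>

lemma smooth_repI:
  assumes "open O'" "snd c x \<in> O'" "\<And>k. Ck k O' g"
     "\<And>y. y \<in> fst c \<Longrightarrow> snd c y \<in> O' \<Longrightarrow> F y \<in> fst d \<and> snd d (F y) = g (snd c y)"
  shows "smooth_rep c d F x"
  using assms unfolding smooth_rep_def by blast

lemma smooth_near_const:
  assumes "x \<in> points M" "a \<in> points N"
  shows "smooth_near M N (\<lambda>y. a) x"
proof -
  have "smap M (points M) N (\<lambda>y. a)"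
    unfolding smap_def using assms mfd_open_points
    by (auto intro!: smooth_repI[where O' = UNIV] Ck_const)
  then show ?thesis using assms by (auto simp: smooth_near_def)
qed

text \<open>A transition map is the identity read in two charts. The chart \<open>c\<close> need not
  belong to the atlas, which allows slice charts of submanifolds.\<close>

lemma compatible_chart_imp_rep:
  assumes c: "compatible_chart M c" and d: "d \<in> charts M" and x: "x \<in> fst c" "x \<in> fst d"
  shows "smooth_rep c d (\<lambda>y. y) x"
proof -
  let ?A = "snd c ` (fst c \<inter> fst d)"
  have inj: "inj_on (snd c) (fst c)" and sub: "snd c ` fst c \<subseteq> model M"
    and op: "openin (top_of_set (model M)) ?A"
    and sm: "smooth_on ?A (snd d \<circ> inv_into (fst c) (snd c))"
    using c d by (auto simp: compatible_chart_def smooth_transition_def split_beta dest: openin_imp_subset)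
  obtain O1 where O1: "open O1" "?A = model M \<inter> O1" using op by (auto simp: openin_open)
  obtain O2 g where O2: "open O2" "snd c x \<in> O2" "\<And>k. Ck k O2 g"
     "\<And>y. y \<in> ?A \<inter> O2 \<Longrightarrow> g y = (snd d \<circ> inv_into (fst c) (snd c)) y"
    using sm x unfolding smooth_on_def by (metis (no_types, lifting) IntI image_eqI)
  show ?thesis
  proof (rule smooth_repI)
    show "open (O1 \<inter> O2)" using O1 O2 by auto
    show "snd c x \<in> O1 \<inter> O2" using O1 O2 x by blast
    show "Ck k (O1 \<inter> O2) g" for k using O2(3) Ck_subset by blast
    fix y assume y: "y \<in> fst c" "snd c y \<in> O1 \<inter> O2"
    then have yA: "snd c y \<in> ?A" using O1 sub by blast
    then obtain y' where "y' \<in> fst c" "y' \<in> fst d" "snd c y = snd c y'" by auto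
    then have "y \<in> fst d" using inj_onD[OF inj] y by metis
    then show "y \<in> fst d \<and> snd d y = g (snd c y)"
      using O2(4)[of "snd c y"] yA y inv_into_f_f[OF inj y(1)] by simp
  qed
qed

lemma smooth_manifold_atlas_ok: "smooth_manifold M \<Longrightarrow> atlas_ok M"
  by (auto simp: smooth_manifold_def atlas_ok_def compatible_chart_def)

text \<open>Smoothness of the identity is exactly compatibility of the charts, hence the full
  manifold hypothesis instead of \<open>atlas_ok\<close>.\<close>

lemma smooth_near_id:
  assumes "smooth_manifold M" "x \<in> points M"
  shows "smooth_near M M (\<lambda>y. y) x"
proof -
  have "smap M (points M) M (\<lambda>y. y)"
    unfolding smap_def
  proof (intro conjI ballI impI)
    fix c d x assume "c \<in> charts M" "d \<in> charts M" "x \<in> fst c \<inter> points M" "x \<in> fst d"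
    then show "smooth_rep c d (\<lambda>y. y) x"
      using assms(1) compatible_chart_imp_rep[of M c d x] by (simp add: smooth_manifold_def)
  qed (auto simp: mfd_open_points)
  then show ?thesis using assms by (auto simp: smooth_near_def)
qed

lemma charts_prod: "charts (prod_mfd M N) =
    (\<lambda>(c, d). (fst c \<times> fst d, map_prod (snd c) (snd d))) ` (charts M \<times> charts N)"
  by (auto simp: prod_mfd_def split_beta)

lemma points_prod: "points (prod_mfd M N) = points M \<times> points N"
  by (auto simp: points_eq charts_prod)

lemma atlas_ok_prod:
  assumes "atlas_ok M" "atlas_ok N"
  shows "atlas_ok (prod_mfd M N)"
proof -
  have "inj_on (map_prod \<phi> \<psi>) (U \<times> V) \<and>
      openin (top_of_set (model M \<times> model N)) (map_prod \<phi> \<psi> ` (U \<times> V))"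
    if "(U, \<phi>) \<in> charts M" "(V, \<psi>) \<in> charts N" for U \<phi> V \<psi>
  proof
    have "inj_on \<phi> U" "inj_on \<psi> V" 
      and *: "openin (top_of_set (model M)) (\<phi> ` U)" "openin (top_of_set (model N)) (\<psi> ` V)"
      using that assms by (auto simp: atlas_ok_def)
    then show "inj_on (map_prod \<phi> \<psi>) (U \<times> V)" by (simp add: map_prod_inj_on)
    show "openin (top_of_set (model M \<times> model N)) (map_prod \<phi> \<psi> ` (U \<times> V))"
      using openin_Times[OF *] by (simp add: map_prod_surj_on)
  qed
  then show ?thesis unfolding atlas_ok_def prod_mfd_def by auto
qed

lemma mfd_open_Times:
  assumes "mfd_open M W" "mfd_open N W'"
  shows "mfd_open (prod_mfd M N) (W \<times> W')"
  unfolding mfd_open_iff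
proof (intro conjI ballI)
  show "W \<times> W' \<subseteq> points (prod_mfd M N)" using assms by (auto simp: points_prod dest: mfd_open_subset)
  fix e z assume "e \<in> charts (prod_mfd M N)" and z: "z \<in> W \<times> W' \<inter> fst e"
  then obtain c d where cd: "c \<in> charts M" "d \<in> charts N"
    and e: "e = (fst c \<times> fst d, map_prod (snd c) (snd d))" by (auto simp: charts_prod)
  obtain O1 where O1: "open O1" "snd c (fst z) \<in> O1" "\<And>y. y \<in> fst c \<Longrightarrow> snd c y \<in> O1 \<Longrightarrow> y \<in> W"
    using mfd_openD[OF assms(1) cd(1), of "fst z"] z e by (metis IntD1 IntD2 fst_conv mem_Times_iff)
  obtain O2 where O2: "open O2" "snd d (snd z) \<in> O2" "\<And>y. y \<in> fst d \<Longrightarrow> snd d y \<in> O2 \<Longrightarrow> y \<in> W'"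
    using mfd_openD[OF assms(2) cd(2), of "snd z"] z e by (metis IntD1 IntD2 fst_conv mem_Times_iff)
  show "\<exists>O'. open O' \<and> snd e z \<in> O' \<and> (\<forall>y\<in>fst e. snd e y \<in> O' \<longrightarrow> y \<in> W \<times> W')"
    using O1 O2 e by (intro exI[of _ "O1 \<times> O2"]) (auto simp: open_Times map_prod_def split_beta)
qed

lemma smap_Pair:
  assumes F: "smap M W N F" and H: "smap M W P H"
  shows "smap M W (prod_mfd N P) (\<lambda>y. (F y, H y))"
  unfolding smap_def
proof (intro conjI ballI impI)
  show "mfd_open M W" using F by (simp add: smap_def)
  show "(\<lambda>y. (F y, H y)) ` W \<subseteq> points (prod_mfd N P)"
    using F H by (auto simp: points_prod smap_def)
  fix c e x assume c: "c \<in> charts M" and "e \<in> charts (prod_mfd N P)" and x: "x \<in> fst c \<inter> W"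
    and ex: "(F x, H x) \<in> fst e"
  then obtain d d' where dd: "d \<in> charts N" "d' \<in> charts P"
    and e: "e = (fst d \<times> fst d', map_prod (snd d) (snd d'))" by (auto simp: charts_prod)
  have r: "smooth_rep c d F x" "smooth_rep c d' H x"
    using F H c dd x ex e by (auto simp: smap_def)
  obtain O1 g where O1: "open O1" "snd c x \<in> O1" "\<And>k. Ck k O1 g"
     "\<And>y. y \<in> fst c \<Longrightarrow> snd c y \<in> O1 \<Longrightarrow> F y \<in> fst d \<and> snd d (F y) = g (snd c y)"
    using r(1) by (metis smooth_repE)
  obtain O2 h where O2: "open O2" "snd c x \<in> O2" "\<And>k. Ck k O2 h"
     "\<And>y. y \<in> fst c \<Longrightarrow> snd c y \<in> O2 \<Longrightarrow> H y \<in> fst d' \<and> snd d' (H y) = h (snd c y)"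
    using r(2) by (metis smooth_repE)
  show "smooth_rep c e (\<lambda>y. (F y, H y)) x"
  proof (rule smooth_repI[where O' = "O1 \<inter> O2" and g = "\<lambda>z. (g z, h z)"])
    show "Ck k (O1 \<inter> O2) (\<lambda>z. (g z, h z))" for k
      using O1(3) O2(3) by (auto intro!: Ck_Pair intro: Ck_subset)
  qed (use O1 O2 e in auto)
qed

lemma smooth_near_Pair:
  assumes "smooth_near M N F x" "smooth_near M P H x"
  shows "smooth_near M (prod_mfd N P) (\<lambda>y. (F y, H y)) x"
proof -
  obtain W W' where W: "smap M W N F" "x \<in> W" "smap M W' P H" "x \<in> W'"
    using assms by (auto simp: smooth_near_def)
  then have "mfd_open M (W \<inter> W')" by (simp add: smap_def mfd_open_Int)
  then have "smap M (W \<inter> W') (prod_mfd N P) (\<lambda>y. (F y, H y))"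
    using W by (intro smap_Pair) (auto elim: smap_subset)
  then show ?thesis using W by (auto simp: smooth_near_def)
qed

text \<open>Composing with the projection in one step avoids smoothness of \<open>fst\<close>
  itself, which would require compatible charts on \<open>M\<close>. In this form it applies to
  functions on \<open>Gtilde\<close>.\<close>

lemma smooth_near_comp_fst:
  assumes "smooth_near M N F x" "y \<in> points P"
  shows "smooth_near (prod_mfd M P) N (\<lambda>z. F (fst z)) (x, y)"
proof -
  obtain W where W: "smap M W N F" "x \<in> W" using assms by (auto simp: smooth_near_def)
  have "smap (prod_mfd M P) (W \<times> points P) N (\<lambda>z. F (fst z))"
    unfolding smap_def
  proof (intro conjI ballI impI)
    show "mfd_open (prod_mfd M P) (W \<times> points P)"
      using W by (simp add: smap_def mfd_open_Times mfd_open_points)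
    show "(\<lambda>z. F (fst z)) ` (W \<times> points P) \<subseteq> points N" using W by (auto simp: smap_def)
    fix e d z assume "e \<in> charts (prod_mfd M P)" and d: "d \<in> charts N"
      and z: "z \<in> fst e \<inter> W \<times> points P" and dz: "F (fst z) \<in> fst d"
    then obtain c c' where cc: "c \<in> charts M"
      and e: "e = (fst c \<times> fst c', map_prod (snd c) (snd c'))" by (auto simp: charts_prod)
    have "smooth_rep c d F (fst z)" using W cc d z dz e by (auto simp: smap_def)
    then obtain O1 g where O1: "open O1" "snd c (fst z) \<in> O1" "\<And>k. Ck k O1 g"
       "\<And>y. y \<in> fst c \<Longrightarrow> snd c y \<in> O1 \<Longrightarrow> F y \<in> fst d \<and> snd d (F y) = g (snd c y)"
      by (metis smooth_repE)
    show "smooth_rep e d (\<lambda>z. F (fst z)) z"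
    proof (rule smooth_repI[where O' = "O1 \<times> UNIV" and g = "\<lambda>z. g (fst z)"])
      show "Ck k (O1 \<times> UNIV) (\<lambda>z. g (fst z))" for k
        by (rule Ck_comp[OF Ck_bounded_linear[OF bounded_linear_fst] O1(3)]) auto
    qed (use O1 e in \<open>auto simp: open_Times map_prod_def split_beta\<close>)
  qed
  then show ?thesis using W assms by (auto simp: smooth_near_def)
qed

lemma smooth_near_comp_snd:
  assumes "smooth_near M N F x" "y \<in> points P"
  shows "smooth_near (prod_mfd P M) N (\<lambda>z. F (snd z)) (y, x)"
proof -
  obtain W where W: "smap M W N F" "x \<in> W" using assms by (auto simp: smooth_near_def)
  have "smap (prod_mfd P M) (points P \<times> W) N (\<lambda>z. F (snd z))"
    unfolding smap_def
  proof (intro conjI ballI impI)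
    show "mfd_open (prod_mfd P M) (points P \<times> W)"
      using W by (simp add: smap_def mfd_open_Times mfd_open_points)
    show "(\<lambda>z. F (snd z)) ` (points P \<times> W) \<subseteq> points N" using W by (auto simp: smap_def)
    fix e d z assume "e \<in> charts (prod_mfd P M)" and d: "d \<in> charts N"
      and z: "z \<in> fst e \<inter> points P \<times> W" and dz: "F (snd z) \<in> fst d"
    then obtain c c' where cc: "c \<in> charts M"
      and e: "e = (fst c' \<times> fst c, map_prod (snd c') (snd c))" by (auto simp: charts_prod)
    have "smooth_rep c d F (snd z)" using W cc d z dz e by (auto simp: smap_def)
    then obtain O1 g where O1: "open O1" "snd c (snd z) \<in> O1" "\<And>k. Ck k O1 g"
       "\<And>y. y \<in> fst c \<Longrightarrow> snd c y \<in> O1 \<Longrightarrow> F y \<in> fst d \<and> snd d (F y) = g (snd c y)"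
      by (metis smooth_repE)
    show "smooth_rep e d (\<lambda>z. F (snd z)) z"
    proof (rule smooth_repI[where O' = "UNIV \<times> O1" and g = "\<lambda>z. g (snd z)"])
      show "Ck k (UNIV \<times> O1) (\<lambda>z. g (snd z))" for k
        by (rule Ck_comp[OF Ck_bounded_linear[OF bounded_linear_snd] O1(3)]) auto
    qed (use O1 e in \<open>auto simp: open_Times map_prod_def split_beta\<close>)
  qed
  then show ?thesis using W assms by (auto simp: smooth_near_def)
qed

lemma points_real_line [simp]: "points real_line = UNIV"
  by (simp add: points_def euclid_mfd_def)

lemma atlas_ok_euclid:
  "openin (top_of_set E) W \<Longrightarrow> atlas_ok (euclid_mfd E W)"
  by (simp add: atlas_ok_def euclid_mfd_def)

lemma points_euclid: "points (euclid_mfd E W) = W"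
  by (simp add: points_def euclid_mfd_def)

text \<open>The binary operation is composed with the pair \<open>(f, g)\<close>, so closure under
  sums and products reduces to \<open>Ck\<close> facts on the plane.\<close>

lemma smooth_near_op:
  assumes B: "\<And>k. Ck k UNIV (\<lambda>z :: real \<times> real. B z :: real)"
    and f: "smooth_near M real_line f x" and g: "smooth_near M real_line g x"
  shows "smooth_near M real_line (\<lambda>y. B (f y, g y)) x"
proof -
  have "smap (prod_mfd real_line real_line) UNIV real_line B"
    unfolding smap_def
  proof (intro conjI ballI impI)
    show "mfd_open (prod_mfd real_line real_line) (UNIV :: (real \<times> real) set)"
      using mfd_open_points[of "prod_mfd real_line real_line"] by (simp add: points_prod)
    show "B ` UNIV \<subseteq> points real_line" by simp
    fix c d and x :: "real \<times> real"
    assume "c \<in> charts (prod_mfd real_line real_line)" "d \<in> charts real_line"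
    then have "c = (UNIV, id)" "d = (UNIV, id)"
      by (auto simp: charts_prod euclid_mfd_def map_prod_def fun_eq_iff)
    then show "smooth_rep c d B x" using B by (auto intro!: smooth_repI[where O' = UNIV])
  qed
  then have "smooth_near (prod_mfd real_line real_line) real_line B (f x, g x)"
    by (auto simp: smooth_near_def)
  from smooth_near_comp[OF smooth_near_Pair[OF f g] this] show ?thesis by (simp add: comp_def)
qed

lemma smooth_near_add:
  assumes "smooth_near M real_line f x" "smooth_near M real_line g x"
  shows "smooth_near M real_line (\<lambda>y. f y + g y) x"
  using smooth_near_op[OF Ck_add[OF Ck_bounded_linear[OF bounded_linear_fst]
    Ck_bounded_linear[OF bounded_linear_snd]] assms] by simp

lemma smooth_near_mult:
  assumes "smooth_near M real_line f x" "smooth_near M real_line g x"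
  shows "smooth_near M real_line (\<lambda>y. f y * g y) x"
  using smooth_near_op[OF Ck_scaleR[OF Ck_bounded_linear[OF bounded_linear_fst]
    Ck_bounded_linear[OF bounded_linear_snd]] assms] by simp

lemma smooth_near_cmult:
  assumes "smooth_near M real_line f x"
  shows "smooth_near M real_line (\<lambda>y. c * f y) x"
  using smooth_near_mult[OF smooth_near_const assms] smooth_near_in_points[OF assms] by simp

section \<open>Open pieces, embedded submanifolds and quotients\<close>

lemma smap_into_open_sub:
  assumes "smap M W (open_sub N V) F"
  shows "smap M W N F"
  unfolding smap_def
proof (intro conjI ballI impI)
  show "mfd_open M W" "F ` W \<subseteq> points N" using assms by (auto simp: smap_def points_open_sub)
  fix c d x assume c: "c \<in> charts M" and d: "d \<in> charts N" and x: "x \<in> fst c \<inter> W" "F x \<in> fst d"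
  have "(fst d \<inter> V, snd d) \<in> charts (open_sub N V)" using d by (auto simp: charts_open_sub)
  moreover have "F x \<in> V" using smap_in_points[OF assms] x by (auto simp: points_open_sub)
  ultimately have "smooth_rep c (fst d \<inter> V, snd d) F x"
    using smapD[OF assms c] x by simp
  then show "smooth_rep c d F x" by (auto simp: smooth_rep_def)
qed

lemma points_sub_mfd:
  assumes "embedded_submanifold M L S"
  shows "points (sub_mfd M L S) = S"
proof
  show "points (sub_mfd M L S) \<subseteq> S" by (auto simp: points_def sub_mfd_def)
  show "S \<subseteq> points (sub_mfd M L S)"
  proof
    fix x assume x: "x \<in> S"
    then obtain U \<phi> where "x \<in> U" "slice_chart M L S (U, \<phi>)"
      using assms unfolding embedded_submanifold_def by blast
    then have "(U \<inter> S, \<phi>) \<in> charts (sub_mfd M L S)" "x \<in> U \<inter> S"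
      using x by (auto simp: sub_mfd_def)
    then show "x \<in> points (sub_mfd M L S)" unfolding points_def by blast
  qed
qed

text \<open>A chart of the submanifold is a compatible chart of \<open>M\<close> restricted to
  \<open>S\<close>, so a transition map of \<open>M\<close> represents the inclusion.\<close>

lemma sub_mfd_inclusion:
  assumes "embedded_submanifold M L S"
  shows "smap (sub_mfd M L S) S M (\<lambda>y. y)"
  unfolding smap_def
proof (intro conjI ballI impI)
  show "mfd_open (sub_mfd M L S) S" using mfd_open_points points_sub_mfd[OF assms] by metis
  show "(\<lambda>y. y) ` S \<subseteq> points M" using assms by (auto simp: embedded_submanifold_def)
  fix c d x assume "c \<in> charts (sub_mfd M L S)" and d: "d \<in> charts M" 
    and x: "x \<in> fst c \<inter> S" "x \<in> fst d"
  then obtain c' where "compatible_chart M c'" and c: "c = (fst c' \<inter> S, snd c')"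
    by (auto simp: sub_mfd_def slice_chart_def)
  then have "smooth_rep c' d (\<lambda>y. y) x" using compatible_chart_imp_rep[OF _ d] x by simp
  then show "smooth_rep c d (\<lambda>y. y) x" unfolding c smooth_rep_def by auto
qed

lemma atlas_ok_quotient: "atlas_ok (quotient_mfd M \<pi> E)"
  by (auto simp: atlas_ok_def quotient_mfd_def)

lemma quotient_points_subset: "points (quotient_mfd M \<pi> E) \<subseteq> \<pi> ` points M"
  by (auto simp: points_def quotient_mfd_def)

text \<open>The charts of the quotient may fail to cover the image of the projection, so smoothness
  is claimed on the preimage of the covered part.\<close>

lemma smap_quotient_proj:
  fixes E :: "'f::euclidean_space set"
  assumes M: "atlas_ok M"
  shows "smap M {x \<in> points M. \<pi> x \<in> points (quotient_mfd M \<pi> E)} (quotient_mfd M \<pi> E) \<pi>"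
    (is "smap M ?W ?Q \<pi>")
  unfolding smap_def
proof (intro conjI ballI impI)
  have chart: "mfd_open M {x \<in> points M. \<pi> x \<in> fst d}"
     "smap M {x \<in> points M. \<pi> x \<in> fst d} (euclid_mfd E E) (snd d \<circ> \<pi>)" if "d \<in> charts ?Q" for d
  proof -
    show op: "mfd_open M {x \<in> points M. \<pi> x \<in> fst d}"
      using that by (auto simp: quotient_mfd_def openin_mfd_topology)
    show "smap M {x \<in> points M. \<pi> x \<in> fst d} (euclid_mfd E E) (snd d \<circ> \<pi>)"
      using that smooth_map_open_sub[OF M op, of "euclid_mfd E E" "snd d \<circ> \<pi>"]
      by (simp add: quotient_mfd_def split_beta)
  qed
  have "?W = \<Union>((\<lambda>d. {x \<in> points M. \<pi> x \<in> fst d}) ` charts ?Q)"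
    by (auto simp: points_eq[of ?Q])
  then show "mfd_open M ?W" using mfd_open_Union chart(1) by (metis (no_types, lifting) imageE)
  show "\<pi> ` ?W \<subseteq> points ?Q" by auto
  fix c d x assume c: "c \<in> charts M" and d: "d \<in> charts ?Q" and x: "x \<in> fst c \<inter> ?W" "\<pi> x \<in> fst d"
  have E: "(E, id) \<in> charts (euclid_mfd E E)" by (simp add: euclid_mfd_def)
  have "(snd d \<circ> \<pi>) x \<in> fst (E, id :: 'f \<Rightarrow> 'f)"
    using smap_in_points[OF chart(2)[OF d], of x] x by (simp add: points_euclid)
  then have "smooth_rep c (E, id) (snd d \<circ> \<pi>) x"
    using smapD[OF chart(2)[OF d] c E] x by simp
  then obtain O1 g where O1: "open O1" "snd c x \<in> O1" "\<And>k. Ck k O1 g"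
     "\<And>y. y \<in> fst c \<Longrightarrow> snd c y \<in> O1 \<Longrightarrow> snd d (\<pi> y) = g (snd c y)"
    unfolding smooth_rep_def by auto
  \<comment> \<open>The representative found so far only describes the coordinate of the class; that
    nearby classes stay inside the chart \<open>d\<close> comes from openness of the
    preimage.\<close>
  have "x \<in> {x \<in> points M. \<pi> x \<in> fst d}" "x \<in> fst c" using x by auto
  then obtain O2 where O2: "open O2" "snd c x \<in> O2"
    "\<And>y. y \<in> fst c \<Longrightarrow> snd c y \<in> O2 \<Longrightarrow> y \<in> {x \<in> points M. \<pi> x \<in> fst d}"
    using mfd_openD[OF chart(1)[OF d] c, of x] by blast
  show "smooth_rep c d \<pi> x"
    by (rule smooth_repI[where O' = "O1 \<inter> O2" and g = g])
       (use O1 O2 in \<open>auto intro: Ck_subset\<close>)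
qed

text \<open>Smoothness descends to the quotient because the projection has smooth local sections.\<close>

lemma smap_quotient_desc:
  fixes E :: "'f::euclidean_space set"
  assumes hp: "smap M (points M) N (h \<circ> \<pi>)"
  shows "smap (quotient_mfd M \<pi> E) (points (quotient_mfd M \<pi> E)) N h"
    (is "smap ?Q _ N h")
  unfolding smap_def
proof (intro conjI ballI impI)
  show "mfd_open ?Q (points ?Q)" by (rule mfd_open_points)
  show "h ` points ?Q \<subseteq> points N"
    using quotient_points_subset[of M \<pi> E] hp by (auto simp: smap_def)
  fix c d s assume c: "c \<in> charts ?Q" and d: "d \<in> charts N" and s: "s \<in> fst c \<inter> points ?Q" "h s \<in> fst d"
  obtain x where x: "x \<in> points M" "\<pi> x = s" using quotient_points_subset[of M \<pi> E] s by auto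
  have inj: "inj_on (snd c) (fst c)" and op: "openin (top_of_set E) (snd c ` fst c)"
    using c by (auto simp: quotient_mfd_def)
  obtain W \<sigma> where W: "openin (top_of_set E) W" "W \<subseteq> snd c ` fst c" "snd c s \<in> W"
    and \<sigma>: "smooth_map (euclid_mfd E W) M \<sigma>" "\<sigma> (snd c s) = x"
      "\<And>y. y \<in> W \<Longrightarrow> \<pi> (\<sigma> y) \<in> fst c \<and> snd c (\<pi> (\<sigma> y)) = y"
  proof -
    have "(fst c, snd c) \<in> charts ?Q" using c by simp
    then have "\<forall>x\<in>points M. \<pi> x \<in> fst c \<longrightarrow>
        (\<exists>W \<sigma>. openin (top_of_set E) W \<and> W \<subseteq> snd c ` fst c \<and> snd c (\<pi> x) \<in> W \<and>
               smooth_map (euclid_mfd E W) M \<sigma> \<and> \<sigma> (snd c (\<pi> x)) = x \<and>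
               (\<forall>y\<in>W. \<pi> (\<sigma> y) \<in> fst c \<and> snd c (\<pi> (\<sigma> y)) = y))"
      unfolding quotient_mfd_def by (simp add: split_beta)
    then obtain W \<sigma> where "openin (top_of_set E) W" "W \<subseteq> snd c ` fst c" "snd c (\<pi> x) \<in> W"
      "smooth_map (euclid_mfd E W) M \<sigma>" "\<sigma> (snd c (\<pi> x)) = x"
      "\<forall>y\<in>W. \<pi> (\<sigma> y) \<in> fst c \<and> snd c (\<pi> (\<sigma> y)) = y"
      using x s by (metis IntD1)
    then show ?thesis using that[of W \<sigma>] x(2) by simp
  qed
  have "smap (euclid_mfd E W) W M \<sigma>"
    using \<sigma>(1) smooth_map_iff_smap[OF atlas_ok_euclid[OF W(1)]] by (auto simp: points_euclid)
  from smap_comp[OF this hp]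
  have "smap (euclid_mfd E W) (W \<inter> \<sigma> -` points M) N (h \<circ> \<pi> \<circ> \<sigma>)" by simp
  moreover have "(W, id) \<in> charts (euclid_mfd E W)" by (simp add: euclid_mfd_def)
  ultimately have "smooth_rep (W, id) d (h \<circ> \<pi> \<circ> \<sigma>) (snd c s)"
    using d W x \<sigma> s unfolding smap_def by fastforce
  then obtain O1 g where O1: "open O1" "snd c s \<in> O1" "\<And>k. Ck k O1 g"
     "\<And>y. y \<in> W \<Longrightarrow> y \<in> O1 \<Longrightarrow> h (\<pi> (\<sigma> y)) \<in> fst d \<and> snd d (h (\<pi> (\<sigma> y))) = g y"
    unfolding smooth_rep_def by auto
  \<comment> \<open>The set \<open>W\<close> is only relatively open. Coordinates of points of the
    chart lie in \<open>E\<close>, so restricting them to \<open>T\<close> puts them in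
    \<open>W\<close>, where the section is defined.\<close>
  obtain T where T: "open T" "W = E \<inter> T" using W(1) by (auto simp: openin_open)
  show "smooth_rep c d h s"
  proof (rule smooth_repI[where O' = "O1 \<inter> T" and g = g])
    fix y assume y: "y \<in> fst c" "snd c y \<in> O1 \<inter> T"
    then have yW: "snd c y \<in> W" using T op openin_imp_subset by blast
    then have "\<pi> (\<sigma> (snd c y)) = y" using \<sigma>(3) inj y by (meson inj_onD)
    then show "h y \<in> fst d \<and> snd d (h y) = g (snd c y)" using O1(4)[OF yW] y by simp
  qed (use O1 T W in \<open>auto intro: Ck_subset\<close>)
qed

section \<open>Derivations\<close>

lemma tangentD:
  assumes "\<delta> \<in> tangent_space M p"
  shows "f \<notin> smooth_at M p \<Longrightarrow> \<delta> f = 0"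
    "f \<in> smooth_at M p \<Longrightarrow> \<delta> (\<lambda>x. c * f x) = c * \<delta> f"
    "f \<in> smooth_at M p \<Longrightarrow> g \<in> smooth_at M p \<Longrightarrow> \<delta> (\<lambda>x. f x + g x) = \<delta> f + \<delta> g"
    "f \<in> smooth_at M p \<Longrightarrow> g \<in> smooth_at M p \<Longrightarrow> \<delta> (\<lambda>x. f x * g x) = \<delta> f * g p + f p * \<delta> g"
  using assms by (simp_all add: tangent_space_def)

text \<open>Functions need to be smooth near \<open>p\<close> only, so the indicator function of \<open>W\<close> replaces the
  usual bump function.\<close>

lemma tangent_cong:
  assumes M: "atlas_ok M" and \<delta>: "\<delta> \<in> tangent_space M p" and f: "smooth_near M real_line f p"
    and W: "mfd_open M W" "p \<in> W" and eq: "\<And>y. y \<in> W \<Longrightarrow> f y = f' y"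
  shows "\<delta> f = \<delta> f'"
proof -
  define u where "u x = (if x \<in> W then 1 else 0 :: real)" for x
  have p: "p \<in> points M" using smooth_near_in_points(1)[OF f] .
  have f': "f' \<in> smooth_at M p" using smooth_near_cong[OF f W eq] smooth_at_iff[OF M] by simp
  have "smooth_near M real_line (\<lambda>_. 1) p" by (rule smooth_near_const[OF p]) simp
  then have u: "u \<in> smooth_at M p"
    unfolding smooth_at_iff[OF M] using smooth_near_cong[OF _ W] by (force simp: u_def)
  have "(\<lambda>x. u x * f x) = (\<lambda>x. u x * f' x)" using eq by (auto simp: u_def)
  then have "\<delta> u * f p + u p * \<delta> f = \<delta> u * f' p + u p * \<delta> f'"
    using tangentD(4)[OF \<delta> u f'] tangentD(4)[OF \<delta> u, of f] f
    unfolding smooth_at_iff[OF M, symmetric] by simp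
  then show ?thesis using eq[OF W(2)] W by (simp add: u_def)
qed

text \<open>The Leibniz rule for \<open>1 * 1\<close> gives the value zero. The second case arises
  because a member of \<open>tangent_space M p\<close> need not be based at a point of
  \<open>M\<close>; no constant is then smooth at \<open>p\<close>, and the extension by zero
  applies.\<close>

lemma tangent_const:
  assumes M: "atlas_ok M" and \<delta>: "\<delta> \<in> tangent_space M p"
  shows "\<delta> (\<lambda>x. c) = 0"
proof (cases "(\<lambda>x. 1) \<in> smooth_at M p")
  case True
  then have "\<delta> (\<lambda>x. 1 * 1) = \<delta> (\<lambda>x. 1) * 1 + 1 * \<delta> (\<lambda>x. 1)"
    and "\<delta> (\<lambda>x. c * 1) = c * \<delta> (\<lambda>x. 1)"
    using tangentD(4)[OF \<delta> True True] tangentD(2)[OF \<delta> True, of c] by simp_all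
  then show ?thesis by simp
next
  case False
  then have "p \<notin> points M" using smooth_near_const[of p M 1 real_line] smooth_at_iff[OF M] by auto
  then have "(\<lambda>x. c) \<notin> smooth_at M p" using smooth_near_in_points(1)[of M real_line "\<lambda>x. c" p]
    unfolding smooth_at_iff[OF M] by blast
  then show ?thesis using tangentD(1)[OF \<delta>] by simp
qed

lemma tangent_lincomb:
  assumes "\<And>i. i < n \<Longrightarrow> X i \<in> tangent_space M p"
  shows "(\<lambda>f. \<Sum>i<n. c i * X i f) \<in> tangent_space M p"
proof -
  have 0: "X i f = 0" if "i < n" "f \<notin> smooth_at M p" for i f
    using assms[OF that(1)] that(2) by (simp add: tangent_space_def)
  have 1: "X i (\<lambda>x. a * f x) = a * X i f" if "i < n" "f \<in> smooth_at M p" for i f a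
    using assms[OF that(1)] that(2) by (simp add: tangent_space_def)
  have 2: "X i (\<lambda>x. f x + g x) = X i f + X i g" "X i (\<lambda>x. f x * g x) = X i f * g p + f p * X i g"
    if "i < n" "f \<in> smooth_at M p" "g \<in> smooth_at M p" for i f g
    using assms[OF that(1)] that(2,3) by (simp_all add: tangent_space_def)
  show ?thesis unfolding tangent_space_def
    by (auto simp: 0 1 2 algebra_simps sum.distrib sum_distrib_left sum_distrib_right)
qed

lemma differential_apply:
  "f \<in> smooth_at N (F p) \<Longrightarrow> differential N F p \<delta> f = \<delta> (f \<circ> F)"
  "f \<notin> smooth_at N (F p) \<Longrightarrow> differential N F p \<delta> f = 0"
  by (simp_all add: differential_def)

lemma differential_zero: "differential N F p 0 = 0"
  by (auto simp: differential_def)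

lemma smooth_at_pullback:
  assumes "atlas_ok M" "atlas_ok N" "smooth_near M N F p" "f \<in> smooth_at N (F p)"
  shows "f \<circ> F \<in> smooth_at M p"
  using assms smooth_near_comp by (metis smooth_at_iff)

lemma differential_tangent:
  assumes M: "atlas_ok M" and N: "atlas_ok N" and F: "smooth_near M N F p"
    and \<delta>: "\<delta> \<in> tangent_space M p"
  shows "differential N F p \<delta> \<in> tangent_space N (F p)"
proof -
  have pb: "f \<circ> F \<in> smooth_at M p" if "f \<in> smooth_at N (F p)" for f
    using smooth_at_pullback[OF M N F that] .
  have cl: "(\<lambda>x. c * f x) \<in> smooth_at N (F p)" "(\<lambda>x. f x + g x) \<in> smooth_at N (F p)"
    "(\<lambda>x. f x * g x) \<in> smooth_at N (F p)"
    if "f \<in> smooth_at N (F p)" "g \<in> smooth_at N (F p)" for f g c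
    using that unfolding smooth_at_iff[OF N]
    by (simp_all add: smooth_near_add smooth_near_mult smooth_near_cmult)
  show ?thesis
    unfolding tangent_space_def
  proof (intro CollectI conjI allI ballI impI)
    fix f assume f: "f \<in> smooth_at N (F p)"
    show "differential N F p \<delta> (\<lambda>x. c * f x) = c * differential N F p \<delta> f" for c
    proof -
      have "\<delta> (\<lambda>x. c * (f \<circ> F) x) = c * \<delta> (f \<circ> F)" using \<delta> pb[OF f] unfolding tangent_space_def by blast
      then show ?thesis using cl(1)[OF f f] f by (simp add: differential_apply comp_def)
    qed
    fix g assume g: "g \<in> smooth_at N (F p)"
    have "\<delta> (\<lambda>x. (f \<circ> F) x + (g \<circ> F) x) = \<delta> (f \<circ> F) + \<delta> (g \<circ> F) \<and>
      \<delta> (\<lambda>x. (f \<circ> F) x * (g \<circ> F) x) = \<delta> (f \<circ> F) * (g \<circ> F) p + (f \<circ> F) p * \<delta> (g \<circ> F)"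
      using \<delta> pb[OF f] pb[OF g] unfolding tangent_space_def by blast
    then show "differential N F p \<delta> (\<lambda>x. f x + g x) = differential N F p \<delta> f + differential N F p \<delta> g"
      "differential N F p \<delta> (\<lambda>x. f x * g x)
        = differential N F p \<delta> f * g (F p) + f (F p) * differential N F p \<delta> g"
      using cl[OF f g] f g by (simp_all add: differential_apply comp_def)
  qed (simp add: differential_apply)
qed

lemma tangent_add:
  assumes "\<delta> \<in> tangent_space M p" "\<epsilon> \<in> tangent_space M p"
  shows "\<delta> + \<epsilon> \<in> tangent_space M p"
  using assms unfolding tangent_space_def by (auto simp: algebra_simps)

section \<open>Discrete connections\<close>

locale connected_system =
  fixes S :: "('q, 'e::euclidean_space, 'g, 'f::euclidean_space, 'b::euclidean_space) sym_system"
    and Hor :: "('q \<times> 'q) set"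
  assumes nh: "discrete_nh_system S"
    and sym: "symmetry_group S"
    and conn: "discrete_connection S Hor"
    and dom: "connection_domain S Hor = points (config S) \<times> points (config S)"
begin

abbreviation "Q \<equiv> config S"
abbreviation "MG \<equiv> group_mfd S"
abbreviation "G \<equiv> sym_group S"
abbreviation "B \<equiv> shape S"
abbreviation "Gt \<equiv> Gtilde S"
abbreviation "QQ \<equiv> prod_mfd (config S) (config S)"

section \<open>The underlying manifolds and the laws of the action\<close>

lemma Q_manifold: "smooth_manifold Q"
  using nh by (simp add: discrete_nh_system_def)

lemma lie: "Lie_group G MG" and smooth_act: "smooth_action G MG Q (act S)"
  and principal: "principal_bundle G MG Q (act S) (base_model S)"
  using sym by (simp_all add: symmetry_group_def)

lemma MG_manifold: "smooth_manifold MG" and MG_points: "points MG = carrier G"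
  using lie by (simp_all add: Lie_group_def)

text \<open>For the base, covering of all orbits by charts is a clause of
  \<open>principal_bundle\<close>; for \<open>Gt\<close> there is no such clause.\<close>

lemma B_points: "points B = piQ S ` points Q"
  using principal by (auto simp: principal_bundle_def Let_def shape_def piQ_def orbits_def)

lemma Q_ok: "atlas_ok Q" and MG_ok: "atlas_ok MG" and B_ok: "atlas_ok B" and Gt_ok: "atlas_ok Gt"
  using Q_manifold MG_manifold
  by (auto intro: smooth_manifold_atlas_ok atlas_ok_quotient simp: shape_def Gtilde_def)

lemma QQ_ok: "atlas_ok QQ"
  using Q_ok by (rule atlas_ok_prod[OF _ Q_ok])

lemma group_G: "Group.group G"
  using lie by (simp add: Lie_group_def)

lemma group_action_Q: "group_action G (points Q) (act S)"
  using smooth_act by (simp add: smooth_action_def)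

lemma piQ_in_B: "q \<in> points Q \<Longrightarrow> piQ S q \<in> points B"
  by (simp add: B_points)

lemma act_closed: "g \<in> carrier G \<Longrightarrow> q \<in> points Q \<Longrightarrow> act S g q \<in> points Q"
  using group_action.element_image[OF group_action_Q] by blast

lemma act_mult: "g \<in> carrier G \<Longrightarrow> h \<in> carrier G \<Longrightarrow> q \<in> points Q \<Longrightarrow>
    act S (g \<otimes>\<^bsub>G\<^esub> h) q = act S g (act S h q)"
  using group_action.composition_rule[OF group_action_Q] by blast

lemma act_one: "q \<in> points Q \<Longrightarrow> act S \<one>\<^bsub>G\<^esub> q = q"
  using group_action.id_eq_one[OF group_action_Q] by (metis restrict_apply')

lemma act_inv: "g \<in> carrier G \<Longrightarrow> q \<in> points Q \<Longrightarrow> act S (inv\<^bsub>G\<^esub> g) (act S g q) = q"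
  using group_action.orbit_sym_aux[OF group_action_Q] by blast

lemma inv_closed: "g \<in> carrier G \<Longrightarrow> inv\<^bsub>G\<^esub> g \<in> carrier G"
  using group_G by (simp add: group.inv_closed)

lemma mult_closed: "g \<in> carrier G \<Longrightarrow> h \<in> carrier G \<Longrightarrow> g \<otimes>\<^bsub>G\<^esub> h \<in> carrier G"
  using group_G by (simp add: group.is_monoid monoid.m_closed)

lemma conj_closed:
  "g \<in> carrier G \<Longrightarrow> w \<in> carrier G \<Longrightarrow> g \<otimes>\<^bsub>G\<^esub> w \<otimes>\<^bsub>G\<^esub> inv\<^bsub>G\<^esub> g \<in> carrier G"
  by (simp add: inv_closed mult_closed)

lemma act_inv': "g \<in> carrier G \<Longrightarrow> q \<in> points Q \<Longrightarrow> act S g (act S (inv\<^bsub>G\<^esub> g) q) = q"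
  by (metis act_inv group.inv_inv group_G inv_closed)

lemma act_conj:
  assumes "g \<in> carrier G" "w \<in> carrier G" "q \<in> points Q"
  shows "act S (g \<otimes>\<^bsub>G\<^esub> w \<otimes>\<^bsub>G\<^esub> inv\<^bsub>G\<^esub> g) (act S g q) = act S g (act S w q)"
  using assms by (simp add: act_mult act_inv act_closed inv_closed mult_closed)

lemma piQ_act:
  assumes g: "g \<in> carrier G" and q: "q \<in> points Q"
  shows "piQ S (act S g q) = piQ S q"
proof -
  have "act S h q = act S (h \<otimes>\<^bsub>G\<^esub> inv\<^bsub>G\<^esub> g) (act S g q)" if "h \<in> carrier G" for h
    using g q that by (simp add: act_mult act_inv act_closed inv_closed)
  then have "piQ S q \<subseteq> piQ S (act S g q)"
    using g mult_closed inv_closed unfolding piQ_def orbit_def by blast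
  moreover have "act S h (act S g q) = act S (h \<otimes>\<^bsub>G\<^esub> g) q" if "h \<in> carrier G" for h
    using g q that by (simp add: act_mult)
  then have "piQ S (act S g q) \<subseteq> piQ S q"
    using g mult_closed unfolding piQ_def orbit_def by blast
  ultimately show ?thesis by blast
qed

lemma piQ_eqE:
  assumes "piQ S q = piQ S q'" "q' \<in> points Q"
  obtains g where "g \<in> carrier G" "q' = act S g q"
  using assms group_action.orbit_refl[OF group_action_Q assms(2)] by (auto simp: piQ_def orbit_def)

lemma near_piQ: "q \<in> points Q \<Longrightarrow> smooth_near Q B (piQ S) q"
  unfolding shape_def using piQ_in_B
  by (intro smap_imp_near[OF smap_quotient_proj[OF Q_ok]]) (simp add: shape_def)

lemma near_act:
  assumes "g \<in> carrier G" "q \<in> points Q"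
  shows "smooth_near (prod_mfd MG Q) Q (\<lambda>z. act S (fst z) (snd z)) (g, q)"
  using smooth_map_imp_near[of "prod_mfd MG Q" Q "\<lambda>(g, x). act S g x" "(g, q)"] smooth_act assms
  by (simp add: smooth_action_def split_beta' atlas_ok_prod MG_ok Q_ok points_prod MG_points)

lemma near_actI:
  assumes "smooth_near M MG F x" "smooth_near M Q H x"
  shows "smooth_near M Q (\<lambda>y. act S (F y) (H y)) x"
  using smooth_near_comp[OF smooth_near_Pair[OF assms] near_act] assms[THEN smooth_near_in_points(2)]
  by (simp add: comp_def MG_points)

lemma near_multI:
  assumes "smooth_near M MG F x" "smooth_near M MG H x"
  shows "smooth_near M MG (\<lambda>y. F y \<otimes>\<^bsub>G\<^esub> H y) x"
proof -
  have "smooth_near (prod_mfd MG MG) MG (\<lambda>z. fst z \<otimes>\<^bsub>G\<^esub> snd z) (F x, H x)"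
    using smooth_map_imp_near[of "prod_mfd MG MG" MG "\<lambda>(g, h). g \<otimes>\<^bsub>G\<^esub> h" "(F x, H x)"] lie
      assms[THEN smooth_near_in_points(2)]
    by (simp add: Lie_group_def split_beta' atlas_ok_prod MG_ok points_prod)
  from smooth_near_comp[OF smooth_near_Pair[OF assms] this] show ?thesis by (simp add: comp_def)
qed

lemma near_invI:
  assumes "smooth_near M MG F x"
  shows "smooth_near M MG (\<lambda>y. inv\<^bsub>G\<^esub> (F y)) x"
proof -
  have "smooth_map MG MG (\<lambda>g. inv\<^bsub>G\<^esub> g)" using lie by (simp add: Lie_group_def)
  from smooth_near_comp[OF assms smooth_map_imp_near[OF this MG_ok smooth_near_in_points(2)[OF assms]]]
  show ?thesis by (simp add: comp_def)
qed

section \<open>Local trivializations, freeness and division in orbits\<close>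

lemma trivialization:
  assumes q: "q \<in> points Q"
  obtains U \<tau> where "mfd_open Q U" "q \<in> U" "\<And>g x. g \<in> carrier G \<Longrightarrow> x \<in> U \<Longrightarrow> act S g x \<in> U"
    "\<And>g x. g \<in> carrier G \<Longrightarrow> x \<in> U \<Longrightarrow> \<tau> (act S g x) = g \<otimes>\<^bsub>G\<^esub> \<tau> x"
    "\<And>x. x \<in> U \<Longrightarrow> smooth_near Q MG \<tau> x"
proof -
  obtain V \<tau> where V: "mfd_open B V" "piQ S q \<in> V"
    "\<And>g x. g \<in> carrier G \<Longrightarrow> x \<in> points Q \<Longrightarrow> piQ S x \<in> V \<Longrightarrow> \<tau> (act S g x) = g \<otimes>\<^bsub>G\<^esub> \<tau> x"
    and d: "diffeo (open_sub Q {x \<in> points Q. piQ S x \<in> V}) (prod_mfd (open_sub B V) MG) (\<lambda>x. (piQ S x, \<tau> x))"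
    using principal piQ_in_B[OF q]
    unfolding principal_bundle_def Let_def shape_def[symmetric] piQ_def[symmetric] openin_mfd_topology by meson
  let ?U = "{x \<in> points Q. piQ S x \<in> V}"
  have "smap Q (points Q) B (piQ S)" using smap_if_near[OF mfd_open_points near_piQ] by blast
  from smap_vimage_open[OF this V(1)] have U: "mfd_open Q ?U" by (simp add: Int_def)
  have "smap Q ?U (prod_mfd (open_sub B V) MG) (\<lambda>x. (piQ S x, \<tau> x))"
    using d unfolding diffeo_def smooth_map_open_sub[OF Q_ok U] by blast
  then have n: "smooth_near Q (prod_mfd (open_sub B V) MG) (\<lambda>x. (piQ S x, \<tau> x)) x" if "x \<in> ?U" for x
    using that by (rule smap_imp_near)
  have "smooth_near Q MG \<tau> x" if x: "x \<in> ?U" for x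
  proof -
    have "\<tau> x \<in> points MG" "piQ S x \<in> points (open_sub B V)"
      using smooth_near_in_points(2)[OF n[OF x]] by (auto simp: points_prod)
    from smooth_near_comp[OF n[OF x] smooth_near_comp_snd[OF smooth_near_id[OF MG_manifold this(1)] this(2)]]
    show ?thesis by (simp add: comp_def)
  qed
  then show thesis using that[of ?U \<tau>] U V q by (simp add: act_closed piQ_act)
qed

text \<open>The fibre coordinate turns the action into left translation in \<open>G\<close>, where
  cancellation is available.\<close>

lemma act_free:
  assumes "g \<in> carrier G" "h \<in> carrier G" "q \<in> points Q" "act S g q = act S h q"
  shows "g = h"
proof -
  obtain U \<tau> where U: "q \<in> U" "\<And>g x. g \<in> carrier G \<Longrightarrow> x \<in> U \<Longrightarrow> \<tau> (act S g x) = g \<otimes>\<^bsub>G\<^esub> \<tau> x"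
    "smooth_near Q MG \<tau> q" using trivialization[OF assms(3)] by metis
  then have "g \<otimes>\<^bsub>G\<^esub> \<tau> q = h \<otimes>\<^bsub>G\<^esub> \<tau> q" using assms by metis
  moreover have "\<tau> q \<in> carrier G" using smooth_near_in_points(2)[OF U(3)] MG_points by simp
  ultimately show ?thesis using assms group.right_cancel[OF group_G] by metis
qed

text \<open>This is the division map of the principal bundle, meaningful for two points of one
  orbit.\<close>

definition transl :: "'q \<Rightarrow> 'q \<Rightarrow> 'g" where
  "transl x y = (THE g. g \<in> carrier G \<and> act S g x = y)"

lemma transl_eqI: "g \<in> carrier G \<Longrightarrow> x \<in> points Q \<Longrightarrow> act S g x = y \<Longrightarrow> transl x y = g"
  unfolding transl_def using act_free by (intro the_equality) auto

lemma transl: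
  assumes "x \<in> points Q" "y \<in> points Q" "piQ S x = piQ S y"
  shows "transl x y \<in> carrier G" "act S (transl x y) x = y"
proof -
  obtain g where "g \<in> carrier G" "y = act S g x" using piQ_eqE[OF assms(3,2)] by blast
  then show "transl x y \<in> carrier G" "act S (transl x y) x = y"
    using transl_eqI[of g x y] assms by auto
qed

text \<open>In a trivialization \<open>\<tau>\<close> the translation from \<open>x\<close> to \<open>y\<close> is \<open>\<tau> y (\<tau> x)\<^sup>-\<^sup>1\<close>.\<close>

lemma near_translI:
  assumes F: "smooth_near M Q F x" and H: "smooth_near M Q H x"
    and W: "mfd_open M W" "x \<in> W" "\<And>y. y \<in> W \<Longrightarrow> F y \<in> points Q"
      "\<And>y. y \<in> W \<Longrightarrow> H y \<in> points Q" "\<And>y. y \<in> W \<Longrightarrow> piQ S (F y) = piQ S (H y)"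
  shows "smooth_near M MG (\<lambda>y. transl (F y) (H y)) x"
proof -
  obtain U \<tau> where U: "mfd_open Q U" "F x \<in> U" "\<And>g x. g \<in> carrier G \<Longrightarrow> x \<in> U \<Longrightarrow> act S g x \<in> U"
    "\<And>g x. g \<in> carrier G \<Longrightarrow> x \<in> U \<Longrightarrow> \<tau> (act S g x) = g \<otimes>\<^bsub>G\<^esub> \<tau> x"
    "\<And>x. x \<in> U \<Longrightarrow> smooth_near Q MG \<tau> x"
    using trivialization[OF W(3)[OF W(2)]] by metis
  have eq: "\<tau> (H y) \<otimes>\<^bsub>G\<^esub> inv\<^bsub>G\<^esub> (\<tau> (F y)) = transl (F y) (H y)" "H y \<in> U" if "F y \<in> U" "y \<in> W" for y
  proof -
    have t: "transl (F y) (H y) \<in> carrier G" "act S (transl (F y) (H y)) (F y) = H y"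
      using transl W that by auto
    have "\<tau> (F y) \<in> carrier G" using smooth_near_in_points(2)[OF U(5)[OF that(1)]] MG_points by simp
    moreover have "\<tau> (H y) = transl (F y) (H y) \<otimes>\<^bsub>G\<^esub> \<tau> (F y)"
      using U(4)[OF t(1) that(1)] t(2) by simp
    ultimately show "\<tau> (H y) \<otimes>\<^bsub>G\<^esub> inv\<^bsub>G\<^esub> (\<tau> (F y)) = transl (F y) (H y)"
      using t group_G by (simp add: monoid.m_assoc group.is_monoid group.r_inv group.inv_closed monoid.r_one)
    show "H y \<in> U" using U(3)[OF t(1) that(1)] t(2) by simp
  qed
  \<comment> \<open>Only \<open>F y\<close> has to be kept in \<open>U\<close> by continuity;
    \<open>H y\<close> follows, because it lies in the same orbit and \<open>U\<close> is
    invariant.\<close>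
  obtain V where V: "x \<in> V" "smap M V Q F" using F by (auto simp: smooth_near_def)
  have "mfd_open M (W \<inter> (V \<inter> F -` U))"
    using smap_vimage_open[OF V(2) U(1)] W(1) by (simp add: mfd_open_Int)
  moreover have "x \<in> W \<inter> (V \<inter> F -` U)" using W V U by simp
  moreover have "smooth_near M MG (\<lambda>y. \<tau> (H y) \<otimes>\<^bsub>G\<^esub> inv\<^bsub>G\<^esub> (\<tau> (F y))) x"
    using smooth_near_comp[OF H U(5)] smooth_near_comp[OF F U(5)] eq(2)[OF U(2) W(2)] U(2)
    by (auto intro!: near_multI near_invI simp: comp_def)
  ultimately show ?thesis
    using eq(1) by (auto intro: smooth_near_cong)
qed

section \<open>Horizontal lifts and the group-valued map of the connection\<close>

lemma embedded_Hor: "\<exists>L. embedded_submanifold QQ L Hor \<and>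
    local_diffeo (sub_mfd QQ L Hor) (prod_mfd Q B) (\<lambda>(q0, q1). (q0, piQ S q1))"
  using conn by (simp add: discrete_connection_def)

lemma Hor_points: "(q, q') \<in> Hor \<Longrightarrow> q \<in> points Q" "(q, q') \<in> Hor \<Longrightarrow> q' \<in> points Q"
  using embedded_Hor by (auto simp: embedded_submanifold_def points_prod)

lemma Hor_act: "(q, q') \<in> Hor \<Longrightarrow> g \<in> carrier G \<Longrightarrow> (act S g q, act S g q') \<in> Hor"
  using conn by (auto simp: discrete_connection_def)

lemma Hor_inj: "(q, q') \<in> Hor \<Longrightarrow> (q, q'') \<in> Hor \<Longrightarrow> piQ S q' = piQ S q'' \<Longrightarrow> q' = q''"
  using conn by (auto simp: discrete_connection_def inj_on_def)

text \<open>This is the discrete horizontal lift of \<open>r\<close> starting at \<open>q\<close>;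
  it inverts the map from \<open>Hor\<close> to Q x Q/G.\<close>

definition hor :: "'q \<Rightarrow> 'q set \<Rightarrow> 'q" where
  "hor q r = (THE q'. (q, q') \<in> Hor \<and> piQ S q' = r)"

lemma hor_eqI: "(q, q') \<in> Hor \<Longrightarrow> piQ S q' = r \<Longrightarrow> hor q r = q'"
  unfolding hor_def using Hor_inj by (intro the_equality) auto

text \<open>Existence uses that the connection domain is everything: any point over \<open>r\<close>
  is a group translate of the end of a horizontal pair starting at \<open>q\<close>. Uniqueness is
  the injectivity on \<open>Hor\<close>.\<close>

lemma hor:
  assumes "q \<in> points Q" "r \<in> points B"
  shows "(q, hor q r) \<in> Hor" "piQ S (hor q r) = r" "hor q r \<in> points Q"
proof -
  obtain p where p: "p \<in> points Q" "r = piQ S p" using assms B_points by auto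
  then have "(q, p) \<in> connection_domain S Hor" using dom assms by auto
  then obtain q' g where "(q, q') \<in> Hor" "g \<in> carrier G" "p = act S g q'"
    by (auto simp: connection_domain_def)
  moreover from this have "piQ S q' = r" using p by (simp add: piQ_act Hor_points)
  ultimately have *: "hor q r = q'" "(q, q') \<in> Hor" "piQ S q' = r" using hor_eqI by auto
  then show "(q, hor q r) \<in> Hor" "piQ S (hor q r) = r" "hor q r \<in> points Q"
    using Hor_points by auto
qed

lemma hor_act:
  assumes "q \<in> points Q" "r \<in> points B" "g \<in> carrier G"
  shows "hor (act S g q) r = act S g (hor q r)"
  using assms hor[OF assms(1,2)] by (intro hor_eqI) (simp_all add: Hor_act piQ_act)

text \<open>Locally \<open>hor\<close> is the inverse of the local diffeomorphism on
  \<open>Hor\<close>, followed by the inclusion into Q x Q and the second projection.\<close>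

lemma near_hor:
  assumes q: "q \<in> points Q" and r: "r \<in> points B"
  shows "smooth_near (prod_mfd Q B) Q (\<lambda>z. hor (fst z) (snd z)) (q, r)"
proof -
  let ?F = "\<lambda>(q0, q1). (q0, piQ S q1)"
  obtain L where L: "embedded_submanifold QQ L Hor" "local_diffeo (sub_mfd QQ L Hor) (prod_mfd Q B) ?F"
    using embedded_Hor by blast
  let ?H = "sub_mfd QQ L Hor" and ?N = "prod_mfd Q B"
  have pH: "points ?H = Hor" by (rule points_sub_mfd[OF L(1)])
  obtain W where W: "mfd_open ?H W" "(q, hor q r) \<in> W" "mfd_open ?N (?F ` W)"
     "diffeo (open_sub ?H W) (open_sub ?N (?F ` W)) ?F"
    using L(2) hor[OF q r] pH unfolding local_diffeo_def openin_mfd_topology by blast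
  have WH: "W \<subseteq> Hor" using mfd_open_subset[OF W(1)] pH by simp
  then have pW: "points (open_sub ?H W) = W" by (auto simp: points_open_sub pH)
  have N: "atlas_ok ?N" by (simp add: atlas_ok_prod Q_ok B_ok)
  let ?I = "inv_into W ?F"
  have bij: "inj_on ?F W" using W(4) by (auto simp: diffeo_def bij_betw_def pW)
  have "smap ?N (?F ` W) (open_sub ?H W) ?I"
    using W(4) unfolding diffeo_def pW smooth_map_open_sub[OF N W(3)] by blast
  then have "smap ?N (?F ` W) ?H ?I" by (rule smap_into_open_sub)
  moreover have qr: "(q, r) \<in> ?F ` W" using image_eqI[OF _ W(2), of _ ?F] hor(2)[OF q r] by simp
  ultimately have n1: "smooth_near ?N ?H ?I (q, r)" by (auto intro: smap_imp_near)
  \<comment> \<open>The inverse is chosen in the piece \<open>W\<close>, but global injectivity on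
    \<open>Hor\<close> makes it agree with \<open>hor\<close>.\<close>
  have I: "?I z = (fst z, hor (fst z) (snd z))" if z: "z \<in> ?F ` W" for z
  proof -
    obtain q0 q1 where q01: "(q0, q1) \<in> W" "z = (q0, piQ S q1)" using z by auto
    then have "?I z = (q0, q1)" using inv_into_f_f[OF bij q01(1)] by simp
    then show ?thesis using q01 WH hor_eqI by auto
  qed
  have z: "hor q r \<in> points Q" "q \<in> points Q" using hor q r by auto
  have "smooth_near ?H QQ (\<lambda>y. y) (?I (q, r))"
    using smap_imp_near[OF sub_mfd_inclusion[OF L(1)]] I[OF qr] hor[OF q r] by simp
  from smooth_near_comp[OF n1 this] have "smooth_near ?N QQ ?I (q, r)" by (simp add: comp_def)
  moreover have "smooth_near QQ Q snd (?I (q, r))"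
    using smooth_near_comp_snd[OF smooth_near_id[OF Q_manifold z(1)] z(2)] I[OF qr] by (simp add: comp_def)
  ultimately have "smooth_near ?N Q (snd \<circ> ?I) (q, r)" by (rule smooth_near_comp)
  then show ?thesis by (rule smooth_near_cong[OF _ W(3) qr]) (simp add: I)
qed

lemma near_horI:
  assumes "smooth_near M Q F x" "smooth_near M B H x"
  shows "smooth_near M Q (\<lambda>y. hor (F y) (H y)) x"
  using smooth_near_comp[OF smooth_near_Pair[OF assms] near_hor] assms[THEN smooth_near_in_points(2)]
  by (simp add: comp_def)

text \<open>The condition defining \<open>Ad\<close> says that the translate of \<open>q1\<close> by
  the inverse of \<open>g\<close> is the horizontal lift of its class. So \<open>Ad\<close> is a
  division of two points of one orbit, and its smoothness follows from that of \<open>hor\<close>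
  and \<open>transl\<close>.\<close>

lemma Ad_eq_transl:
  assumes "q0 \<in> points Q" "q1 \<in> points Q"
  shows "Ad S Hor q0 q1 = transl (hor q0 (piQ S q1)) q1"
proof -
  note h = hor[OF assms(1) piQ_in_B[OF assms(2)]]
  have "(q0, act S (inv\<^bsub>G\<^esub> g) q1) \<in> Hor \<longleftrightarrow> act S g (hor q0 (piQ S q1)) = q1" if g: "g \<in> carrier G" for g
  proof
    assume "(q0, act S (inv\<^bsub>G\<^esub> g) q1) \<in> Hor"
    then have "hor q0 (piQ S q1) = act S (inv\<^bsub>G\<^esub> g) q1"
      using g assms by (intro hor_eqI) (simp_all add: piQ_act inv_closed)
    then show "act S g (hor q0 (piQ S q1)) = q1" using g assms by (simp add: act_inv')
  next
    assume "act S g (hor q0 (piQ S q1)) = q1"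
    then have "act S (inv\<^bsub>G\<^esub> g) q1 = hor q0 (piQ S q1)" using g h act_inv by metis
    then show "(q0, act S (inv\<^bsub>G\<^esub> g) q1) \<in> Hor" using h by simp
  qed
  then show ?thesis unfolding Ad_def transl_def by metis
qed

lemma Ad:
  assumes "q0 \<in> points Q" "q1 \<in> points Q"
  shows "Ad S Hor q0 q1 \<in> carrier G" "act S (Ad S Hor q0 q1) (hor q0 (piQ S q1)) = q1"
  using assms transl hor[OF assms(1) piQ_in_B[OF assms(2)]] by (simp_all add: Ad_eq_transl)

lemma Ad_eqI:
  assumes "q0 \<in> points Q" "r \<in> points B" "w \<in> carrier G"
  shows "Ad S Hor q0 (act S w (hor q0 r)) = w"
  using assms hor[OF assms(1,2)] transl_eqI by (simp add: Ad_eq_transl act_closed piQ_act)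

text \<open>By equivariance of \<open>hor\<close>, the conjugated element moves the lift from
  \<open>act S g q0\<close> to \<open>act S g q1\<close>, and only one element does so.\<close>

lemma Ad_act:
  assumes "q0 \<in> points Q" "q1 \<in> points Q" "g \<in> carrier G"
  shows "Ad S Hor (act S g q0) (act S g q1) = g \<otimes>\<^bsub>G\<^esub> Ad S Hor q0 q1 \<otimes>\<^bsub>G\<^esub> inv\<^bsub>G\<^esub> g"
proof -
  note h = hor[OF assms(1) piQ_in_B[OF assms(2)]] and A = Ad[OF assms(1,2)]
  have "act S (g \<otimes>\<^bsub>G\<^esub> Ad S Hor q0 q1 \<otimes>\<^bsub>G\<^esub> inv\<^bsub>G\<^esub> g) (hor (act S g q0) (piQ S q1)) = act S g q1"
    using assms h A by (simp add: hor_act act_conj piQ_in_B)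
  then show ?thesis
    using Ad_eqI[of "act S g q0" "piQ S q1"] assms A by (metis act_closed conj_closed piQ_in_B)
qed

lemma near_Ad:
  assumes "q0 \<in> points Q" "q1 \<in> points Q"
  shows "smooth_near QQ MG (\<lambda>z. Ad S Hor (fst z) (snd z)) (q0, q1)"
proof -
  let ?W = "points QQ"
  have n0: "smooth_near QQ Q fst (q0, q1)"
    using smooth_near_comp_fst[OF smooth_near_id[OF Q_manifold assms(1)] assms(2)] by (simp add: comp_def)
  have n1: "smooth_near QQ Q snd (q0, q1)"
    using smooth_near_comp_snd[OF smooth_near_id[OF Q_manifold assms(2)] assms(1)] by (simp add: comp_def)
  have "smooth_near QQ B (\<lambda>z. piQ S (snd z)) (q0, q1)"
    using smooth_near_comp[OF n1 near_piQ] assms by (simp add: comp_def)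
  from near_translI[OF near_horI[OF n0 this] n1 mfd_open_points]
  have "smooth_near QQ MG (\<lambda>z. transl (hor (fst z) (piQ S (snd z))) (snd z)) (q0, q1)"
    using assms hor piQ_in_B by (auto simp: points_prod)
  then show ?thesis
    by (rule smooth_near_cong[OF _ mfd_open_points]) (use assms Ad_eq_transl in \<open>auto simp: points_prod\<close>)
qed

section \<open>The conjugate bundle and the fibres of Upsilon\<close>

lemma piQG_conj:
  assumes "g \<in> carrier G" "q \<in> points Q" "w \<in> carrier G"
  shows "piQG S (act S g q, g \<otimes>\<^bsub>G\<^esub> w \<otimes>\<^bsub>G\<^esub> inv\<^bsub>G\<^esub> g) = piQG S (q, w)"
proof -
  interpret G: group G by (rule group_G)
  have c: "conj_act S h (conj_act S k (q, w)) = conj_act S (h \<otimes>\<^bsub>G\<^esub> k) (q, w)"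
    if "h \<in> carrier G" "k \<in> carrier G" for h k
    using that assms by (simp add: conj_act_def act_mult G.inv_mult_group G.m_assoc)
  have eq: "conj_act S h (q, w) = conj_act S (h \<otimes>\<^bsub>G\<^esub> inv\<^bsub>G\<^esub> g) (conj_act S g (q, w))"
    if "h \<in> carrier G" for h
    using that assms c[of "h \<otimes>\<^bsub>G\<^esub> inv\<^bsub>G\<^esub> g" g] by (simp add: G.m_assoc)
  have "piQG S (conj_act S g (q, w)) \<subseteq> piQG S (q, w)"
    using c[OF _ assms(1)] mult_closed[OF _ assms(1)] unfolding piQG_def orbit_def by blast
  moreover have "piQG S (q, w) \<subseteq> piQG S (conj_act S g (q, w))"
    using eq mult_closed[OF _ inv_closed[OF assms(1)]] unfolding piQG_def orbit_def by blast
  ultimately have "piQG S (conj_act S g (q, w)) = piQG S (q, w)" by blast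
  then show ?thesis by (simp add: conj_act_def)
qed

lemma piQG_eqE:
  assumes "piQG S (q, w) = piQG S (q', w')" "q' \<in> points Q" "w' \<in> carrier G"
  obtains g where "g \<in> carrier G" "q' = act S g q" "w' = g \<otimes>\<^bsub>G\<^esub> w \<otimes>\<^bsub>G\<^esub> inv\<^bsub>G\<^esub> g"
proof -
  interpret G: group G by (rule group_G)
  have "conj_act S \<one>\<^bsub>G\<^esub> (q', w') = (q', w')" using assms by (simp add: conj_act_def act_one)
  then have "(q', w') \<in> piQG S (q', w')" unfolding piQG_def orbit_def by force
  then have "(q', w') \<in> piQG S (q, w)" using assms by simp
  then show thesis using that by (auto simp: piQG_def orbit_def conj_act_def)
qed

lemma pQG_piQG:
  assumes "q \<in> points Q"
  shows "pQG S (piQG S (q, w)) = piQ S q"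
proof -
  interpret G: group G by (rule group_G)
  have "(\<lambda>(q, w). piQ S q) ` piQG S (q, w) = {piQ S q}"
    using assms piQ_act G.one_closed
    by (fastforce simp: piQG_def orbit_def conj_act_def image_iff)
  then show ?thesis by (simp add: pQG_def)
qed

lemma Gt_pointsE:
  assumes "v \<in> points Gt"
  obtains q w where "q \<in> points Q" "w \<in> carrier G" "v = piQG S (q, w)"
  using assms quotient_points_subset[of "prod_mfd Q MG" "piQG S"]
  by (force simp: Gtilde_def points_prod MG_points)

lemma Ups_eq: "Ups S Hor (q0, q1) = (piQG S (q0, Ad S Hor q0 q1), piQ S q1)"
  by (simp add: Ups_def)

lemma Ups_act:
  assumes "q0 \<in> points Q" "q1 \<in> points Q" "g \<in> carrier G"
  shows "Ups S Hor (act S g q0, act S g q1) = Ups S Hor (q0, q1)"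
  using assms by (simp add: Ups_eq Ad_act piQG_conj Ad piQ_act)

text \<open>The first component determines \<open>q0\<close> and the value of \<open>Ad\<close> up
  to one common \<open>g\<close>; the second point is then forced, being recovered from the first,
  that value and the class \<open>piQ S q1\<close>. So the fibres of Upsilon are diagonal
  orbits.\<close>

lemma Ups_eqE:
  assumes "Ups S Hor (q0, q1) = Ups S Hor (p0, p1)"
    and "q0 \<in> points Q" "q1 \<in> points Q" "p0 \<in> points Q" "p1 \<in> points Q"
  obtains g where "g \<in> carrier G" "p0 = act S g q0" "p1 = act S g q1"
proof -
  have r: "piQ S q1 = piQ S p1" and "piQG S (q0, Ad S Hor q0 q1) = piQG S (p0, Ad S Hor p0 p1)"
    using assms(1) by (simp_all add: Ups_eq)
  then obtain g where g: "g \<in> carrier G" "p0 = act S g q0"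
    "Ad S Hor p0 p1 = g \<otimes>\<^bsub>G\<^esub> Ad S Hor q0 q1 \<otimes>\<^bsub>G\<^esub> inv\<^bsub>G\<^esub> g"
    using piQG_eqE[OF _ assms(4) Ad(1)[OF assms(4,5)]] by blast
  have "p1 = act S (Ad S Hor p0 p1) (hor p0 (piQ S q1))" using Ad(2)[OF assms(4,5)] r by simp
  also have "\<dots> = act S g (act S (Ad S Hor q0 q1) (hor q0 (piQ S q1)))"
    unfolding g(3) unfolding g(2) using g(1) assms Ad hor piQ_in_B by (simp add: hor_act act_conj)
  finally have "p1 = act S g q1" using Ad(2)[OF assms(2,3)] by simp
  then show thesis using that g by blast
qed

lemma near_Ups1:
  assumes "q0 \<in> points Q" "q1 \<in> points Q" "fst (Ups S Hor (q0, q1)) \<in> points Gt"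
  shows "smooth_near QQ Gt (fst \<circ> Ups S Hor) (q0, q1)"
proof -
  have ok: "atlas_ok (prod_mfd Q MG)" by (simp add: atlas_ok_prod Q_ok MG_ok)
  have "smooth_near QQ Q fst (q0, q1)"
    using smooth_near_comp_fst[OF smooth_near_id[OF Q_manifold assms(1)] assms(2)] by (simp add: comp_def)
  from smooth_near_Pair[OF this near_Ad[OF assms(1,2)]]
  have n: "smooth_near QQ (prod_mfd Q MG) (\<lambda>z. (fst z, Ad S Hor (fst z) (snd z))) (q0, q1)" .
  have "smooth_near (prod_mfd Q MG) Gt (piQG S) (q0, Ad S Hor q0 q1)"
    using smap_imp_near[OF smap_quotient_proj[OF ok, of "piQG S" "base_model S \<times> model MG"]]
      smooth_near_in_points(2)[OF n] assms(3) by (simp add: Gtilde_def Ups_eq)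
  with n have "smooth_near QQ Gt (piQG S \<circ> (\<lambda>z. (fst z, Ad S Hor (fst z) (snd z)))) (q0, q1)"
    by (intro smooth_near_comp) simp_all
  then show ?thesis by (simp add: comp_def Ups_def split_beta')
qed

lemma near_quotient_desc:
  assumes "\<And>q w. q \<in> points Q \<Longrightarrow> w \<in> carrier G \<Longrightarrow> smooth_near (prod_mfd Q MG) N (h \<circ> piQG S) (q, w)"
    and "v \<in> points Gt"
  shows "smooth_near Gt N h v"
proof -
  have "smap (prod_mfd Q MG) (points (prod_mfd Q MG)) N (h \<circ> piQG S)"
    using assms(1) by (intro smap_if_near mfd_open_points) (auto simp: points_prod MG_points)
  from smap_quotient_desc[OF this] show ?thesis
    using assms(2) by (auto simp: Gtilde_def intro: smap_imp_near)
qed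

lemma near_pQG:
  assumes "v \<in> points Gt"
  shows "smooth_near Gt B (pQG S) v"
proof (rule near_quotient_desc[OF _ assms])
  fix q w assume qw: "q \<in> points Q" "w \<in> carrier G"
  have "smooth_near (prod_mfd Q MG) B (\<lambda>z. piQ S (fst z)) (q, w)"
    using smooth_near_comp_fst[OF near_piQ[OF qw(1)], of w MG] qw by (simp add: MG_points)
  then show "smooth_near (prod_mfd Q MG) B (pQG S \<circ> piQG S) (q, w)"
    by (rule smooth_near_cong[OF _ mfd_open_points])
       (use qw pQG_piQG in \<open>auto simp: points_prod MG_points\<close>)
qed

text \<open>For fixed \<open>q\<^sub>2\<close> the point \<open>q\<close> is recovered smoothly from the class of \<open>(q, w)\<close> with
  \<open>w = Ad q q\<^sub>2\<close>: for any representative \<open>(q, w)\<close> the point \<open>w \<cdot> hor q (\<pi> q\<^sub>2)\<close> lies in the orbit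
  of \<open>q\<^sub>2\<close>, and the translation moving it to \<open>q\<^sub>2\<close> corrects the choice of the representative.\<close>

definition retract_rep :: "'q \<Rightarrow> 'q \<times> 'g \<Rightarrow> 'q" where
  "retract_rep q2 = (\<lambda>(q, w). act S (transl (act S w (hor q (piQ S q2))) q2) q)"

definition retract :: "'q \<Rightarrow> ('q \<times> 'g) set \<Rightarrow> 'q" where
  "retract q2 v = retract_rep q2 (SOME z. z \<in> points Q \<times> carrier G \<and> v = piQG S z)"

text \<open>Changing the representative by \<open>g\<close> moves the auxiliary point by
  \<open>g\<close>, so the correcting translation gains the inverse of \<open>g\<close> on the
  right, which cancels against the \<open>g\<close> applied to \<open>q\<close>.\<close>

lemma retract_rep_conj:
  assumes "q2 \<in> points Q" "q \<in> points Q" "w \<in> carrier G" "g \<in> carrier G"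
  shows "retract_rep q2 (act S g q, g \<otimes>\<^bsub>G\<^esub> w \<otimes>\<^bsub>G\<^esub> inv\<^bsub>G\<^esub> g) = retract_rep q2 (q, w)"
proof -
  interpret G: group G by (rule group_G)
  note h = hor[OF assms(2) piQ_in_B[OF assms(1)]]
  let ?x = "act S w (hor q (piQ S q2))"
  have x: "?x \<in> points Q" "piQ S ?x = piQ S q2" using assms h by (simp_all add: act_closed piQ_act)
  note t = transl[OF x(1) assms(1) x(2)]
  have "act S (g \<otimes>\<^bsub>G\<^esub> w \<otimes>\<^bsub>G\<^esub> inv\<^bsub>G\<^esub> g) (hor (act S g q) (piQ S q2)) = act S g ?x"
    using assms h by (simp add: hor_act act_conj piQ_in_B)
  moreover have "transl (act S g ?x) q2 = transl ?x q2 \<otimes>\<^bsub>G\<^esub> inv\<^bsub>G\<^esub> g"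
    using assms x t by (intro transl_eqI) (simp_all add: act_mult act_inv act_closed)
  ultimately show ?thesis
    using assms t by (simp add: retract_rep_def act_mult act_inv act_closed)
qed

lemma retract_piQG:
  assumes "q2 \<in> points Q" "q \<in> points Q" "w \<in> carrier G"
  shows "retract q2 (piQG S (q, w)) = retract_rep q2 (q, w)"
proof -
  define z where "z = (SOME z. z \<in> points Q \<times> carrier G \<and> piQG S (q, w) = piQG S z)"
  have "z \<in> points Q \<times> carrier G \<and> piQG S (q, w) = piQG S z"
    unfolding z_def by (rule someI[of _ "(q, w)"]) (use assms in simp)
  then obtain q' w' where z: "z = (q', w')" "q' \<in> points Q" "w' \<in> carrier G" "piQG S (q, w) = piQG S (q', w')"
    by (cases z) auto
  obtain g where "g \<in> carrier G" "q' = act S g q" "w' = g \<otimes>\<^bsub>G\<^esub> w \<otimes>\<^bsub>G\<^esub> inv\<^bsub>G\<^esub> g"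
    using piQG_eqE[OF z(4,2,3)] .
  then show ?thesis
    using retract_rep_conj[OF assms] z(1) by (simp add: retract_def z_def[symmetric])
qed

text \<open>For the representative with group part \<open>Ad S Hor q1 q2\<close> the auxiliary point
  is \<open>q2\<close> itself, so the correction is the unit.\<close>

lemma retract_Ups:
  assumes "q1 \<in> points Q" "q2 \<in> points Q"
  shows "retract q2 (fst (Ups S Hor (q1, q2))) = q1"
proof -
  interpret G: group G by (rule group_G)
  have "transl q2 q2 = \<one>\<^bsub>G\<^esub>" using assms by (intro transl_eqI) (simp_all add: act_one)
  then show ?thesis
    using assms Ad by (simp add: Ups_eq retract_piQG retract_rep_def act_one)
qed

lemma near_retract:
  assumes q2: "q2 \<in> points Q" and v: "v \<in> points Gt"
  shows "smooth_near Gt Q (retract q2) v"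
proof (rule near_quotient_desc[OF _ v])
  fix q w assume qw: "q \<in> points Q" "w \<in> carrier G"
  let ?M = "prod_mfd Q MG"
  have p: "(q, w) \<in> points ?M" using qw by (simp add: points_prod MG_points)
  have nq: "smooth_near ?M Q fst (q, w)"
    using smooth_near_comp_fst[OF smooth_near_id[OF Q_manifold qw(1)], of w MG] qw
    by (simp add: comp_def MG_points)
  have nw: "smooth_near ?M MG snd (q, w)"
    using smooth_near_comp_snd[OF smooth_near_id[OF MG_manifold] qw(1)] qw by (simp add: comp_def MG_points)
  have "smooth_near ?M Q (\<lambda>z. act S (snd z) (hor (fst z) (piQ S q2))) (q, w)"
    by (intro near_actI[OF nw] near_horI[OF nq] smooth_near_const p piQ_in_B q2)
  then have "smooth_near ?M MG (\<lambda>z. transl (act S (snd z) (hor (fst z) (piQ S q2))) q2) (q, w)"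
    by (rule near_translI[OF _ smooth_near_const[OF p q2] mfd_open_points p])
       (use q2 hor piQ_in_B in \<open>auto simp: points_prod MG_points act_closed piQ_act\<close>)
  from near_actI[OF this nq]
  have "smooth_near ?M Q (retract_rep q2) (q, w)" by (simp add: retract_rep_def split_beta')
  then show "smooth_near ?M Q (retract q2 \<circ> piQG S) (q, w)"
    by (rule smooth_near_cong[OF _ mfd_open_points p])
       (use q2 retract_piQG in \<open>auto simp: points_prod MG_points\<close>)
qed

text \<open>The lift is built step by step. Over the current point \<open>q\<close> the class
  \<open>v k\<close> has a representative \<open>(q, w)\<close>; the next point must be
  \<open>w\<close> applied to the horizontal lift of \<open>r (Suc k)\<close>. The path condition
  puts it over the foot of \<open>v (Suc k)\<close>.\<close>

lemma lifted_path_exists: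
  assumes "discrete_path (associated_dldps S Hor) N v r"
  shows "\<exists>q. lifted_path S Hor N v r q"
proof -
  have v: "v k \<in> points Gt" and r: "r (Suc k) \<in> points B" if "k < N" for k
    using assms that by (auto simp: discrete_path_def associated_dldps_def)
  have glue: "pQG S (v k) = r k" if "1 \<le> k" "k < N" for k
    using assms that by (auto simp: discrete_path_def associated_dldps_def)
  have N: "0 < N" using assms by (simp add: discrete_path_def)
  have step: "\<exists>q'\<in>points Q. edges v r k = Ups S Hor (q, q')"
    if k: "k < N" and q: "q \<in> points Q" "piQ S q = pQG S (v k)" for k q
  proof -
    obtain p w where p: "p \<in> points Q" "w \<in> carrier G" "v k = piQG S (p, w)"
      using Gt_pointsE[OF v[OF k]] .
    then have "piQ S p = piQ S q" using q by (simp add: pQG_piQG)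
    then obtain g where g: "g \<in> carrier G" "q = act S g p" using piQ_eqE q(1) by blast
    let ?w = "g \<otimes>\<^bsub>G\<^esub> w \<otimes>\<^bsub>G\<^esub> inv\<^bsub>G\<^esub> g"
    have w: "?w \<in> carrier G" using g p by (simp add: conj_closed)
    have "v k = piQG S (q, ?w)" using g p by (simp add: piQG_conj)
    then have "edges v r k = Ups S Hor (q, act S ?w (hor q (r (Suc k))))"
      using hor[OF q(1) r[OF k]] q r[OF k] w by (simp add: Ups_eq edges_def Ad_eqI piQ_act)
    then show ?thesis using w hor[OF q(1) r[OF k]] act_closed by blast
  qed
  obtain q0 w0 where q0: "q0 \<in> points Q" "w0 \<in> carrier G" "v 0 = piQG S (q0, w0)"
    using Gt_pointsE[OF v[OF N]] .
  \<comment> \<open>Dependent choice yields an infinite sequence. The fibre condition is dropped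
    from index \<open>N\<close> on, where no \<open>v k\<close> is prescribed, and beyond the path
    any point serves.\<close>
  let ?P = "\<lambda>k q. q \<in> points Q \<and> (k < N \<longrightarrow> piQ S q = pQG S (v k))"
  have "\<exists>q. \<forall>k. ?P k (q k) \<and> (k < N \<longrightarrow> edges v r k = Ups S Hor (q k, q (Suc k)))"
  proof (rule dependent_nat_choice)
    show "\<exists>q. ?P 0 q" using q0 by (auto simp: pQG_piQG)
    fix q k assume q: "?P k q"
    show "\<exists>q'. ?P (Suc k) q' \<and> (k < N \<longrightarrow> edges v r k = Ups S Hor (q, q'))"
    proof (cases "k < N")
      case True
      then obtain q' where q': "q' \<in> points Q" "edges v r k = Ups S Hor (q, q')"
        using step q by blast
      then have "piQ S q' = r (Suc k)" by (simp add: edges_def Ups_eq)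
      then show ?thesis using q' glue[of "Suc k"] by auto
    next
      case False
      then show ?thesis using q0 by auto
    qed
  qed
  then show ?thesis by (auto simp: lifted_path_def)
qed

end

section \<open>Reduced variations\<close>

lemma differential_add: "differential N F p (\<delta> + \<epsilon>) = differential N F p \<delta> + differential N F p \<epsilon>"
  by (auto simp: differential_def)

context connected_system
begin

abbreviation "F1 \<equiv> fst \<circ> Ups S Hor"
abbreviation "D1 \<equiv> partial1 Gt F1"
abbreviation "D2 \<equiv> partial2 Gt F1"

text \<open>Evaluating a local frame at the one point \<open>q\<close> shows that the fibre is a
  span of tangent vectors; this yields its tangency and its zero vector.\<close>

lemma Dnh_frame:
  assumes "q \<in> points Q"
  shows "\<exists>(n::nat) X. (\<forall>i<n. X i \<in> tangent_space Q q) \<and> Dnh S q = {(\<lambda>f. \<Sum>i<n. c i * X i f) | c. True}"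
proof -
  have "subbundle Q (Dnh S)" using nh by (simp add: discrete_nh_system_def)
  from bspec[OF this[unfolded subbundle_def] assms]
  obtain U X and n :: nat where U: "q \<in> U" "\<forall>i<n. smooth_vector_field Q U (X i)"
    "\<forall>x\<in>U. Dnh S x = {(\<lambda>f. \<Sum>i<n. c i * X i x f) | c. True} \<and>
      (\<forall>c. (\<forall>f. (\<Sum>i<n. c i * X i x f) = 0) \<longrightarrow> (\<forall>i<n. c i = 0))"
    by (elim exE conjE) (rule that)
  have "\<forall>i<n. X i q \<in> tangent_space Q q" using U(1,2) by (simp add: smooth_vector_field_def)
  moreover have "Dnh S q = {(\<lambda>f. \<Sum>i<n. c i * X i q f) | c. True}" using bspec[OF U(3,1)] by (rule conjunct1)
  ultimately show ?thesis by (intro exI[of _ n] exI[of _ "\<lambda>i. X i q"] conjI)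
qed

lemma Dnh_tangent:
  assumes "q \<in> points Q" "\<delta> \<in> Dnh S q"
  shows "\<delta> \<in> tangent_space Q q"
proof -
  obtain X and n :: nat where X: "\<forall>i<n. X i \<in> tangent_space Q q"
    "Dnh S q = {(\<lambda>f. \<Sum>i<n. c i * X i f) | c. True}"
    using Dnh_frame[OF assms(1)] by (elim exE conjE) (rule that)
  then obtain c where "\<delta> = (\<lambda>f. \<Sum>i<n. c i * X i f)" using assms(2) by auto
  then show ?thesis using tangent_lincomb[of n X Q q c] X(1) by simp
qed

lemma Dnh_zero:
  assumes "q \<in> points Q"
  shows "0 \<in> Dnh S q"
proof -
  obtain X and n :: nat where X: "Dnh S q = {(\<lambda>f. \<Sum>i<n. c i * X i f) | c. True}"
    using Dnh_frame[OF assms] by (elim exE conjE) (rule that)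
  have "0 = (\<lambda>f. \<Sum>i<n. 0 * X i f)" by (auto simp: fun_eq_iff)
  then show ?thesis unfolding X by (intro CollectI exI[of _ "\<lambda>_. 0"] conjI TrueI)
qed

lemma Dnh_act:
  "g \<in> carrier G \<Longrightarrow> q \<in> points Q \<Longrightarrow> \<delta> \<in> Dnh S q \<Longrightarrow>
    differential Q (act S g) q \<delta> \<in> Dnh S (act S g q)"
  using sym by (simp add: symmetry_group_def)

section \<open>Partial differentials of Upsilon at one pair of points\<close>

context
  fixes q0 q1
  assumes q0: "q0 \<in> points Q" and q1: "q1 \<in> points Q"
    and v: "fst (Ups S Hor (q0, q1)) \<in> points Gt"
begin

lemma near_slice1: "smooth_near Q Gt (\<lambda>a. F1 (a, q1)) q0"
  using smooth_near_comp[OF smooth_near_Pair[OF smooth_near_id[OF Q_manifold q0] smooth_near_const[OF q0 q1]]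
    near_Ups1[OF q0 q1 v]] by (simp add: comp_def)

lemma near_slice2: "smooth_near Q Gt (\<lambda>b. F1 (q0, b)) q1"
  using smooth_near_comp[OF smooth_near_Pair[OF smooth_near_const[OF q1 q0] smooth_near_id[OF Q_manifold q1]]
    near_Ups1[OF q0 q1 v]] by (simp add: comp_def)

lemma D1_tangent: "\<delta> \<in> tangent_space Q q0 \<Longrightarrow> D1 (q0, q1) \<delta> \<in> tangent_space Gt (fst (Ups S Hor (q0, q1)))"
  using differential_tangent[OF Q_ok Gt_ok near_slice1] by (simp add: partial1_def)

lemma D2_tangent: "\<epsilon> \<in> tangent_space Q q1 \<Longrightarrow> D2 (q0, q1) \<epsilon> \<in> tangent_space Gt (fst (Ups S Hor (q0, q1)))"
  using differential_tangent[OF Q_ok Gt_ok near_slice2] by (simp add: partial2_def)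

lemma D1_apply: "f \<in> smooth_at Gt (fst (Ups S Hor (q0, q1))) \<Longrightarrow>
    D1 (q0, q1) \<delta> f = \<delta> (\<lambda>a. f (F1 (a, q1)))"
  "f \<notin> smooth_at Gt (fst (Ups S Hor (q0, q1))) \<Longrightarrow> D1 (q0, q1) \<delta> f = 0"
  by (simp_all add: partial1_def differential_def comp_def)

lemma D2_apply: "f \<in> smooth_at Gt (fst (Ups S Hor (q0, q1))) \<Longrightarrow>
    D2 (q0, q1) \<delta> f = \<delta> (\<lambda>b. f (F1 (q0, b)))"
  "f \<notin> smooth_at Gt (fst (Ups S Hor (q0, q1))) \<Longrightarrow> D2 (q0, q1) \<delta> f = 0"
  by (simp_all add: partial2_def differential_def comp_def)

lemma prod_ok: "atlas_ok (prod_mfd Gt B)"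
  by (simp add: atlas_ok_prod Gt_ok B_ok)

text \<open>The splitting is the definition of \<open>tpair\<close>. What has to be checked is that
  the test function, pulled back to the product and then to Q x Q, is smooth there, since otherwise
  the default value zero would be returned.\<close>

lemma fst_dUps: "fst (dUps S Hor (q0, q1) (\<delta>, \<epsilon>)) = D1 (q0, q1) \<delta> + D2 (q0, q1) \<epsilon>"
proof
  fix f
  let ?v = "fst (Ups S Hor (q0, q1))"
  show "fst (dUps S Hor (q0, q1) (\<delta>, \<epsilon>)) f = (D1 (q0, q1) \<delta> + D2 (q0, q1) \<epsilon>) f"
  proof (cases "f \<in> smooth_at Gt ?v")
    case True
    then have f: "smooth_near Gt real_line f ?v" by (simp add: smooth_at_iff[OF Gt_ok])
    have "f \<circ> fst \<in> smooth_at (prod_mfd Gt B) (Ups S Hor (q0, q1))"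
      using smooth_near_comp_fst[OF f piQ_in_B[OF q1]]
      by (simp add: smooth_at_iff[OF prod_ok] comp_def Ups_eq)
    moreover have "(f \<circ> fst) \<circ> Ups S Hor \<in> smooth_at QQ (q0, q1)"
      using smooth_near_comp[OF near_Ups1[OF q0 q1 v], of real_line f] f
      by (simp add: smooth_at_iff[OF QQ_ok] comp_assoc)
    ultimately show ?thesis
      using True by (simp add: dUps_def tsplit_def differential_apply tpair_def D1_apply D2_apply)
  next
    case False
    then show ?thesis by (simp add: dUps_def tsplit_def differential_apply D1_apply D2_apply)
  qed
qed

text \<open>The second component of Upsilon does not depend on the first point, so the first tangent
  vector is applied to a constant function and contributes nothing.\<close>

lemma snd_dUps:
  assumes \<delta>: "\<delta> \<in> tangent_space Q q0"
  shows "snd (dUps S Hor (q0, q1) (\<delta>, \<epsilon>)) = differential B (piQ S) q1 \<epsilon>"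
proof
  fix f
  show "snd (dUps S Hor (q0, q1) (\<delta>, \<epsilon>)) f = differential B (piQ S) q1 \<epsilon> f"
  proof (cases "f \<in> smooth_at B (piQ S q1)")
    case True
    then have f: "smooth_near B real_line f (piQ S q1)" by (simp add: smooth_at_iff[OF B_ok])
    have 1: "f \<circ> snd \<in> smooth_at (prod_mfd Gt B) (Ups S Hor (q0, q1))"
      using smooth_near_comp_snd[OF f v] by (simp add: smooth_at_iff[OF prod_ok] comp_def Ups_eq)
    have "smooth_near Q real_line (f \<circ> piQ S) q1" by (rule smooth_near_comp[OF near_piQ[OF q1] f])
    from smooth_near_comp_snd[OF this q0]
    have "(f \<circ> snd) \<circ> Ups S Hor \<in> smooth_at QQ (q0, q1)"
      by (simp add: smooth_at_iff[OF QQ_ok] comp_def Ups_def split_beta')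
    then show ?thesis
      using True 1 tangent_const[OF Q_ok \<delta>]
      by (simp add: dUps_def tsplit_def differential_apply tpair_def Ups_eq comp_def)
  next
    case False
    then show ?thesis by (simp add: dUps_def tsplit_def differential_apply Ups_eq)
  qed
qed

text \<open>The function \<open>pQG\<close> after the slice through \<open>q1\<close> is
  \<open>piQ\<close>. The two agree only on points of \<open>Q\<close>, so the equality passes
  through \<open>tangent_cong\<close>.\<close>

lemma dpQG_D1:
  assumes \<delta>: "\<delta> \<in> tangent_space Q q0"
  shows "differential B (pQG S) (fst (Ups S Hor (q0, q1))) (D1 (q0, q1) \<delta>) = differential B (piQ S) q0 \<delta>"
    (is "differential B _ ?v _ = _")
proof
  fix f
  have pv: "pQG S (fst (Ups S Hor (a, q1))) = piQ S a" if "a \<in> points Q" for a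
    using that by (simp add: Ups_eq pQG_piQG)
  show "differential B (pQG S) ?v (D1 (q0, q1) \<delta>) f = differential B (piQ S) q0 \<delta> f"
  proof (cases "f \<in> smooth_at B (piQ S q0)")
    case True
    then have f: "f \<in> smooth_at B (pQG S ?v)" using pv[OF q0] by simp
    have f': "f \<circ> pQG S \<in> smooth_at Gt ?v"
      using smooth_at_pullback[OF Gt_ok B_ok near_pQG[OF v] f] .
    have "(f \<circ> pQG S) \<circ> (\<lambda>a. F1 (a, q1)) \<in> smooth_at Q q0"
      using smooth_at_pullback[OF Q_ok Gt_ok near_slice1] f' by simp
    then have "\<delta> (\<lambda>a. f (pQG S (F1 (a, q1)))) = \<delta> (f \<circ> piQ S)"
      using pv by (intro tangent_cong[OF Q_ok \<delta> _ mfd_open_points q0])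
        (simp_all add: smooth_at_iff[OF Q_ok] comp_def)
    then show ?thesis using f f' True by (simp add: differential_apply D1_apply)
  next
    case False
    then show ?thesis using pv[OF q0] by (simp add: differential_apply)
  qed
qed

text \<open>Moving the second point keeps the class in the same fibre over \<open>piQ S q0\<close>,
  so the tangent vector meets a constant.\<close>

lemma dpQG_D2:
  assumes \<epsilon>: "\<epsilon> \<in> tangent_space Q q1"
  shows "differential B (pQG S) (fst (Ups S Hor (q0, q1))) (D2 (q0, q1) \<epsilon>) = 0"
    (is "differential B _ ?v _ = _")
proof
  fix f
  have pv: "pQG S (fst (Ups S Hor (q0, b))) = piQ S q0" for b
    using q0 by (simp add: Ups_eq pQG_piQG)
  show "differential B (pQG S) ?v (D2 (q0, q1) \<epsilon>) f = 0 f"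
  proof (cases "f \<in> smooth_at B (pQG S ?v)")
    case True
    then have "f \<circ> pQG S \<in> smooth_at Gt ?v"
      using smooth_at_pullback[OF Gt_ok B_ok near_pQG[OF v]] by simp
    then show ?thesis
      using True pv tangent_const[OF Q_ok \<epsilon>] by (simp add: differential_apply D2_apply)
  next
    case False
    then show ?thesis by (simp add: differential_apply)
  qed
qed

text \<open>A test function \<open>f\<close> near \<open>q0\<close> becomes the test function
  \<open>f \<circ> retract q1\<close> near the class, and the value of the image vector on it is the
  value of the original vector on \<open>f\<close>.\<close>

lemma D1_inj:
  assumes \<delta>: "\<delta> \<in> tangent_space Q q0" and \<delta>': "\<delta>' \<in> tangent_space Q q0"
    and eq: "D1 (q0, q1) \<delta> = D1 (q0, q1) \<delta>'"
  shows "\<delta> = \<delta>'"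
proof
  fix f
  let ?v = "fst (Ups S Hor (q0, q1))"
  show "\<delta> f = \<delta>' f"
  proof (cases "f \<in> smooth_at Q q0")
    case True
    let ?h = "f \<circ> retract q1"
    have h: "?h \<in> smooth_at Gt ?v"
      using smooth_at_pullback[OF Gt_ok Q_ok near_retract[OF q1 v]] True retract_Ups[OF q0 q1] by simp
    have "\<epsilon> f = D1 (q0, q1) \<epsilon> ?h" if \<epsilon>: "\<epsilon> \<in> tangent_space Q q0" for \<epsilon>
    proof -
      have "\<epsilon> f = \<epsilon> (\<lambda>a. ?h (F1 (a, q1)))"
        using True by (intro tangent_cong[OF Q_ok \<epsilon> _ mfd_open_points q0])
          (simp_all add: smooth_at_iff[OF Q_ok] retract_Ups q1)
      then show ?thesis using h by (simp add: D1_apply)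
    qed
    then show ?thesis using \<delta> \<delta>' eq by metis
  next
    case False
    then show ?thesis using tangentD(1)[OF \<delta>] tangentD(1)[OF \<delta>'] by simp
  qed
qed

text \<open>Invariance of Upsilon under the diagonal action, differentiated in the first
  point.\<close>

lemma D1_act:
  assumes g: "g \<in> carrier G" and \<delta>: "\<delta> \<in> tangent_space Q q0"
  shows "D1 (act S g q0, act S g q1) (differential Q (act S g) q0 \<delta>) = D1 (q0, q1) \<delta>"
proof
  fix f
  let ?v = "fst (Ups S Hor (q0, q1))" and ?p0 = "act S g q0" and ?p1 = "act S g q1"
  have p: "?p0 \<in> points Q" "?p1 \<in> points Q" using g q0 q1 by (simp_all add: act_closed)
  have vp: "fst (Ups S Hor (?p0, ?p1)) = ?v" using Ups_act[OF q0 q1 g] by simp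
  show "D1 (?p0, ?p1) (differential Q (act S g) q0 \<delta>) f = D1 (q0, q1) \<delta> f"
  proof (cases "f \<in> smooth_at Gt ?v")
    case True
    have n: "smooth_near Q Gt (\<lambda>a. F1 (a, ?p1)) ?p0"
      \<comment> \<open>The slice is needed at the translated pair, not at the pair fixed by the
        context, hence the exported form of the lemma.\<close>
      by (rule connected_system.near_slice1[OF connected_system_axioms p]) (simp add: vp v)
    then have s: "f \<circ> (\<lambda>a. F1 (a, ?p1)) \<in> smooth_at Q ?p0"
      using smooth_at_pullback[OF Q_ok Gt_ok n] True vp by simp
    have "f \<circ> (\<lambda>a. F1 (a, q1)) \<in> smooth_at Q q0"
      using smooth_at_pullback[OF Q_ok Gt_ok near_slice1] True by simp
    then have "\<delta> (f \<circ> (\<lambda>a. F1 (a, q1))) = \<delta> ((f \<circ> (\<lambda>a. F1 (a, ?p1))) \<circ> act S g)"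
      using Ups_act[OF _ q1 g]
      by (intro tangent_cong[OF Q_ok \<delta> _ mfd_open_points q0]) (simp_all add: smooth_at_iff[OF Q_ok])
    then show ?thesis
      using True s vp by (simp add: partial1_def differential_apply)
  next
    case False
    then show ?thesis using vp by (simp add: partial1_def differential_apply)
  qed
qed

lemma D2_act:
  assumes g: "g \<in> carrier G" and \<epsilon>: "\<epsilon> \<in> tangent_space Q q1"
  shows "D2 (act S g q0, act S g q1) (differential Q (act S g) q1 \<epsilon>) = D2 (q0, q1) \<epsilon>"
proof
  fix f
  let ?v = "fst (Ups S Hor (q0, q1))" and ?p0 = "act S g q0" and ?p1 = "act S g q1"
  have p: "?p0 \<in> points Q" "?p1 \<in> points Q" using g q0 q1 by (simp_all add: act_closed)
  have vp: "fst (Ups S Hor (?p0, ?p1)) = ?v" using Ups_act[OF q0 q1 g] by simp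
  show "D2 (?p0, ?p1) (differential Q (act S g) q1 \<epsilon>) f = D2 (q0, q1) \<epsilon> f"
  proof (cases "f \<in> smooth_at Gt ?v")
    case True
    have n: "smooth_near Q Gt (\<lambda>b. F1 (?p0, b)) ?p1"
      by (rule connected_system.near_slice2[OF connected_system_axioms p]) (simp add: vp v)
    then have s: "f \<circ> (\<lambda>b. F1 (?p0, b)) \<in> smooth_at Q ?p1"
      using smooth_at_pullback[OF Q_ok Gt_ok n] True vp by simp
    have "f \<circ> (\<lambda>b. F1 (q0, b)) \<in> smooth_at Q q1"
      using smooth_at_pullback[OF Q_ok Gt_ok near_slice2] True by simp
    then have "\<epsilon> (f \<circ> (\<lambda>b. F1 (q0, b))) = \<epsilon> ((f \<circ> (\<lambda>b. F1 (?p0, b))) \<circ> act S g)"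
      using Ups_act[OF q0 _ g]
      by (intro tangent_cong[OF Q_ok \<epsilon> _ mfd_open_points q1]) (simp_all add: smooth_at_iff[OF Q_ok])
    then show ?thesis
      using True s vp by (simp add: partial2_def differential_apply)
  next
    case False
    then show ?thesis using vp by (simp add: partial2_def differential_apply)
  qed
qed

lemma dUps_vertical:
  assumes "\<delta> \<in> tangent_space Q q0"
  shows "dUps S Hor (q0, q1) (\<delta>, 0) = (D1 (q0, q1) \<delta>, 0)"
proof (rule prod_eqI)
  show "fst (dUps S Hor (q0, q1) (\<delta>, 0)) = fst (D1 (q0, q1) \<delta>, 0)"
    by (simp add: fst_dUps partial2_def differential_zero)
  show "snd (dUps S Hor (q0, q1) (\<delta>, 0)) = snd (D1 (q0, q1) \<delta>, 0)"
    using assms by (simp add: snd_dUps differential_zero)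
qed

text \<open>\<open>D_red\<close> ranges over every pair with the given image. Such a pair is a
  diagonal translate of \<open>(q0, q1)\<close>; invariance of \<open>Dnh\<close> and
  \<open>D1_act\<close> move its vectors to the fixed pair.\<close>

lemma D_red_iff: "(w, 0) \<in> D_red S Hor (Ups S Hor (q0, q1)) \<longleftrightarrow> (\<exists>\<delta>\<in>Dnh S q0. w = D1 (q0, q1) \<delta>)"
proof
  assume "\<exists>\<delta>\<in>Dnh S q0. w = D1 (q0, q1) \<delta>"
  then obtain \<delta> where \<delta>: "\<delta> \<in> Dnh S q0" "w = D1 (q0, q1) \<delta>" by blast
  then have "(w, 0) = dUps S Hor (q0, q1) (\<delta>, 0)"
    using dUps_vertical[OF Dnh_tangent[OF q0]] by simp
  then show "(w, 0) \<in> D_red S Hor (Ups S Hor (q0, q1))"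
    using \<delta>(1) q0 q1 unfolding D_red_def by blast
next
  assume "(w, 0) \<in> D_red S Hor (Ups S Hor (q0, q1))"
  then obtain p0 p1 \<delta> where p: "p0 \<in> points Q" "p1 \<in> points Q" "Ups S Hor (q0, q1) = Ups S Hor (p0, p1)"
    and \<delta>: "\<delta> \<in> Dnh S p0" "(w, 0) = dUps S Hor (p0, p1) (\<delta>, 0)"
    unfolding D_red_def by blast
  have v': "fst (Ups S Hor (p0, p1)) \<in> points Gt" using v p by simp
  note T = Dnh_tangent[OF p(1) \<delta>(1)]
  obtain g where g: "g \<in> carrier G" "q0 = act S g p0" "q1 = act S g p1"
    using Ups_eqE[OF p(3)[symmetric] p(1,2) q0 q1] .
  have "w = D1 (p0, p1) \<delta>"
    using connected_system.dUps_vertical[OF connected_system_axioms p(1,2) v' T] \<delta>(2) by simp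
  also have "\<dots> = D1 (q0, q1) (differential Q (act S g) p0 \<delta>)"
    using connected_system.D1_act[OF connected_system_axioms p(1,2) v' g(1) T] g by simp
  finally show "\<exists>\<delta>\<in>Dnh S q0. w = D1 (q0, q1) \<delta>"
    using Dnh_act[OF g(1) p(1) \<delta>(1)] g(2) by blast
qed

end

text \<open>This is the well-definedness of the chain map: every admissible choice of lift and
  vector is brought to the given one without changing the value.\<close>

lemma P_red_eq:
  assumes q: "q0 \<in> points Q" "q1 \<in> points Q" "q2 \<in> points Q"
    and v0: "fst (Ups S Hor (q0, q1)) \<in> points Gt" and v1: "fst (Ups S Hor (q1, q2)) \<in> points Gt"
    and \<delta>: "\<delta> \<in> Dnh S q1"
  shows "P_red S Hor (Ups S Hor (q0, q1)) (Ups S Hor (q1, q2)) (D1 (q1, q2) \<delta>, 0) = D2 (q0, q1) \<delta>"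
  unfolding P_red_def
proof (rule the_equality)
  show "\<exists>p0 p1 p2 \<delta>1. p0 \<in> points Q \<and> p1 \<in> points Q \<and> p2 \<in> points Q \<and>
     Ups S Hor (q0, q1) = Ups S Hor (p0, p1) \<and> Ups S Hor (q1, q2) = Ups S Hor (p1, p2) \<and>
     \<delta>1 \<in> Dnh S p1 \<and> (D1 (q1, q2) \<delta>, 0 :: 'q set tvec) = (D1 (p1, p2) \<delta>1, 0) \<and>
     D2 (q0, q1) \<delta> = D2 (p0, p1) \<delta>1"
    using q \<delta> by blast
  fix \<epsilon>
  assume "\<exists>p0 p1 p2 \<delta>1. p0 \<in> points Q \<and> p1 \<in> points Q \<and> p2 \<in> points Q \<and>
     Ups S Hor (q0, q1) = Ups S Hor (p0, p1) \<and> Ups S Hor (q1, q2) = Ups S Hor (p1, p2) \<and>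
     \<delta>1 \<in> Dnh S p1 \<and> (D1 (q1, q2) \<delta>, 0 :: 'q set tvec) = (D1 (p1, p2) \<delta>1, 0) \<and>
     \<epsilon> = D2 (p0, p1) \<delta>1"
  then obtain p0 p1 p2 \<delta>1 where p: "p0 \<in> points Q" "p1 \<in> points Q" "p2 \<in> points Q"
    and U: "Ups S Hor (p0, p1) = Ups S Hor (q0, q1)" "Ups S Hor (p1, p2) = Ups S Hor (q1, q2)"
    and \<delta>1: "\<delta>1 \<in> Dnh S p1" "D1 (q1, q2) \<delta> = D1 (p1, p2) \<delta>1" "\<epsilon> = D2 (p0, p1) \<delta>1"
    by (metis prod.inject)
  note T = Dnh_tangent[OF p(2) \<delta>1(1)]
  obtain g where g: "g \<in> carrier G" "q0 = act S g p0" "q1 = act S g p1"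
    using Ups_eqE[OF U(1) p(1,2) q(1,2)] .
  obtain h where h: "h \<in> carrier G" "q1 = act S h p1" "q2 = act S h p2"
    using Ups_eqE[OF U(2) p(2,3) q(2,3)] .
  \<comment> \<open>The two edges yield separate group elements, but both carry \<open>p1\<close> to
    \<open>q1\<close>.\<close>
  have gh: "g = h" using act_free[OF g(1) h(1) p(2)] g h by simp
  let ?\<delta> = "differential Q (act S g) p1 \<delta>1"
  have "D1 (q1, q2) \<delta> = D1 (q1, q2) ?\<delta>"
    using D1_act[OF p(2,3) _ g(1) T] v1 U \<delta>1(2) g h gh by simp
  moreover have "?\<delta> \<in> Dnh S q1" using Dnh_act[OF g(1) p(2) \<delta>1(1)] g by simp
  ultimately have "\<delta> = ?\<delta>"
    using D1_inj[OF q(2,3) v1] Dnh_tangent[OF q(2)] \<delta> by blast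
  then show "\<epsilon> = D2 (q0, q1) \<delta>"
    using D2_act[OF p(1,2) _ g(1) T] v0 U \<delta>1(3) g by simp
qed

lemma nh_variation_iff:
  assumes path: "discrete_path (associated_dldps S Hor) N v r" and lift: "lifted_path S Hor N v r q"
  shows "nh_variation (associated_dldps S Hor) N v r \<delta>v \<delta>r \<longleftrightarrow>
    (\<exists>\<delta>q. (\<forall>k\<le>N. \<delta>q k \<in> Dnh S (q k)) \<and> \<delta>q 0 = 0 \<and> \<delta>q N = 0 \<and>
       (\<forall>k<N. edges \<delta>v \<delta>r k = dUps S Hor (q k, q (Suc k)) (\<delta>q k, \<delta>q (Suc k))))"
    (is "?l \<longleftrightarrow> ?r")
proof -
  have N: "2 \<le> N" using path by (simp add: discrete_path_def)
  have q: "q k \<in> points Q" if "k \<le> N" for k using lift that by (simp add: lifted_path_def)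
  have e: "edges v r k = Ups S Hor (q k, q (Suc k))" if "k < N" for k
    using lift that by (simp add: lifted_path_def)
  have vk: "v k = fst (Ups S Hor (q k, q (Suc k)))" and rk: "r (Suc k) = piQ S (q (Suc k))" if "k < N" for k
    using e[OF that] by (simp_all add: edges_def Ups_eq)
  have vG: "fst (Ups S Hor (q k, q (Suc k))) \<in> points Gt" if "k < N" for k
  proof -
    have "v k \<in> points Gt" using path that by (simp add: discrete_path_def associated_dldps_def)
    then show ?thesis unfolding vk[OF that] .
  qed
  have dU: "dUps S Hor (q k, q (Suc k)) (\<delta>q k, \<delta>q (Suc k)) =
     (D1 (q k, q (Suc k)) (\<delta>q k) + D2 (q k, q (Suc k)) (\<delta>q (Suc k)), differential B (piQ S) (q (Suc k)) (\<delta>q (Suc k)))"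
    if "k < N" "\<forall>k\<le>N. \<delta>q k \<in> Dnh S (q k)" for k \<delta>q
    using that q vG[OF that(1)] Dnh_tangent
    by (intro prod_eqI) (simp_all add: fst_dUps snd_dUps)
  have P: "P_red S Hor (edges v r k) (edges v r (Suc k)) (D1 (q (Suc k), q (Suc (Suc k))) \<delta>, 0)
     = D2 (q k, q (Suc k)) \<delta>" if "Suc k < N" "\<delta> \<in> Dnh S (q (Suc k))" for k \<delta>
    using that q vG e by (simp add: P_red_eq)
  have var: "(w, 0) \<in> D_red S Hor (edges v r k) \<longleftrightarrow> (\<exists>\<delta>\<in>Dnh S (q k). w = D1 (q k, q (Suc k)) \<delta>)"
    if "k < N" for k w
    using that q vG e by (simp add: D_red_iff)
  have zero: "D1 z 0 = 0" "D2 z 0 = 0" for z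
    by (simp_all add: partial1_def partial2_def differential_zero split_beta)
  \<comment> \<open>This settles the gluing condition in both directions: only the vector at
    \<open>q k\<close> is visible in the base.\<close>
  have dp: "differential B (pQG S) (v k) (D1 (q k, q (Suc k)) \<delta> + D2 (q k, q (Suc k)) \<epsilon>)
      = differential B (piQ S) (q k) \<delta>" if "k < N" "\<delta> \<in> Dnh S (q k)" "\<epsilon> \<in> Dnh S (q (Suc k))" for k \<delta> \<epsilon>
    using that q vG[OF that(1)] Dnh_tangent
    by (simp add: vk differential_add dpQG_D1 dpQG_D2)
  show ?thesis
  proof
    assume ?l
    then obtain w where l: "\<forall>k\<in>{1..<N}. \<delta>r k = differential B (pQG S) (v k) (\<delta>v k)"
        "\<forall>k\<in>{1..<N}. (w k, 0) \<in> D_red S Hor (edges v r k)"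
        "\<forall>k\<in>{1..N - 2}. \<delta>v k = w k + P_red S Hor (edges v r k) (edges v r (k + 1)) (w (k + 1), 0)"
      and \<delta>rN: "\<delta>r N = 0" and last: "\<delta>v (N - 1) = w (N - 1)"
      and first: "\<delta>v 0 = P_red S Hor (edges v r 0) (edges v r 1) (w 1, 0)"
      unfolding nh_variation_def associated_dldps_def dldps.simps by blast
    have \<delta>r: "\<delta>r k = differential B (pQG S) (v k) (\<delta>v k)"
      and w: "(w k, 0) \<in> D_red S Hor (edges v r k)" if "1 \<le> k" "k < N" for k
      using l(1,2) that by simp_all
    have mid: "\<delta>v k = w k + P_red S Hor (edges v r k) (edges v r (k + 1)) (w (k + 1), 0)"
      if "1 \<le> k" "k \<le> N - 2" for k
      using l(3) that by simp
    have "\<forall>k. \<exists>\<delta>. 1 \<le> k \<longrightarrow> k < N \<longrightarrow> \<delta> \<in> Dnh S (q k) \<and> w k = D1 (q k, q (Suc k)) \<delta>"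
      using w var by blast
    then obtain d where d: "\<And>k. 1 \<le> k \<Longrightarrow> k < N \<Longrightarrow> d k \<in> Dnh S (q k) \<and> w k = D1 (q k, q (Suc k)) (d k)"
      by metis
    \<comment> \<open>The vectors \<open>d k\<close> are meaningful only at interior indices; the
      zeros at both ends implement the fixed endpoints.\<close>
    define \<delta>q where "\<delta>q k = (if 1 \<le> k \<and> k < N then d k else 0)" for k
    have Dq: "\<forall>k\<le>N. \<delta>q k \<in> Dnh S (q k)" using d q Dnh_zero by (simp add: \<delta>q_def)
    have w\<delta>: "w k = D1 (q k, q (Suc k)) (\<delta>q k)" if "1 \<le> k" "k < N" for k
      using d that by (simp add: \<delta>q_def)
    have ends: "\<delta>q 0 = 0" "\<delta>q N = 0" by (simp_all add: \<delta>q_def)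
    have Pw: "P_red S Hor (edges v r k) (edges v r (Suc k)) (w (Suc k), 0) = D2 (q k, q (Suc k)) (\<delta>q (Suc k))"
      if "Suc k < N" for k
      using P[OF that, of "\<delta>q (Suc k)"] w\<delta>[of "Suc k"] Dq that by simp
    have \<delta>vk: "\<delta>v k = D1 (q k, q (Suc k)) (\<delta>q k) + D2 (q k, q (Suc k)) (\<delta>q (Suc k))" if k: "k < N" for k
    proof -
      \<comment> \<open>At the two extreme edges one summand vanishes because the variation is zero
        at that end, matching the shorter formulas for \<open>\<delta>v 0\<close> and
        \<open>\<delta>v (N - 1)\<close>. For \<open>N = 2\<close> the middle case is empty.\<close>
      consider "k = 0" | "1 \<le> k" "k \<le> N - 2" | "k = N - 1" using k by linarith
      then show ?thesis
      proof cases
        case 1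
        then show ?thesis using first Pw[of 0] N ends zero by simp
      next
        case 2
        then show ?thesis using mid[OF 2] Pw[of k] w\<delta>[of k] N by simp
      next
        case 3
        then show ?thesis using last w\<delta>[of k] N ends zero by simp
      qed
    qed
    have "\<delta>r (Suc k) = differential B (piQ S) (q (Suc k)) (\<delta>q (Suc k))" if k: "k < N" for k
    proof (cases "Suc k = N")
      case True
      then show ?thesis using \<delta>rN ends by (simp add: differential_zero)
    next
      case False
      then have "Suc k < N" using k by simp
      then show ?thesis using \<delta>r[of "Suc k"] \<delta>vk[of "Suc k"] dp[of "Suc k"] Dq by simp
    qed
    then have "\<forall>k<N. edges \<delta>v \<delta>r k = dUps S Hor (q k, q (Suc k)) (\<delta>q k, \<delta>q (Suc k))"
      using \<delta>vk dU[OF _ Dq] by (simp add: edges_def)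
    then show ?r using Dq ends by blast
  next
    assume ?r
    then obtain \<delta>q where Dq: "\<forall>k\<le>N. \<delta>q k \<in> Dnh S (q k)" and ends: "\<delta>q 0 = 0" "\<delta>q N = 0"
      and ed: "\<And>k. k < N \<Longrightarrow> edges \<delta>v \<delta>r k = dUps S Hor (q k, q (Suc k)) (\<delta>q k, \<delta>q (Suc k))" by blast
    have \<delta>vk: "\<delta>v k = D1 (q k, q (Suc k)) (\<delta>q k) + D2 (q k, q (Suc k)) (\<delta>q (Suc k))"
      and \<delta>rk: "\<delta>r (Suc k) = differential B (piQ S) (q (Suc k)) (\<delta>q (Suc k))" if "k < N" for k
      using ed[OF that] dU[OF that Dq] by (simp_all add: edges_def)
    have T: "\<delta>q k \<in> tangent_space Q (q k)" if "k \<le> N" for k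
      using Dnh_tangent[OF q[OF that]] Dq that by blast
    define w where "w k = D1 (q k, q (Suc k)) (\<delta>q k)" for k
    have Pw: "P_red S Hor (edges v r k) (edges v r (Suc k)) (w (Suc k), 0) = D2 (q k, q (Suc k)) (\<delta>q (Suc k))"
      if "Suc k < N" for k
      using P[OF that, of "\<delta>q (Suc k)"] Dq that by (simp add: w_def)
    have tan: "\<delta>v k \<in> tangent_space Gt (v k) \<and> \<delta>r (Suc k) \<in> tangent_space B (r (Suc k))" if k: "k < N" for k
    proof
      show "\<delta>v k \<in> tangent_space Gt (v k)"
        using k q vG[OF k] T unfolding \<delta>vk[OF k] vk[OF k]
        by (intro tangent_add D1_tangent D2_tangent) simp_all
      show "\<delta>r (Suc k) \<in> tangent_space B (r (Suc k))"
        using k q T unfolding \<delta>rk[OF k] rk[OF k]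
        by (intro differential_tangent[OF Q_ok B_ok near_piQ]) simp_all
    qed
    have glue: "\<delta>r k = differential B (pQG S) (v k) (\<delta>v k)" if k: "1 \<le> k" "k < N" for k
    proof -
      \<comment> \<open>The component \<open>\<delta>r k\<close> is stored in edge
        \<open>k - 1\<close> and \<open>\<delta>v k\<close> in edge \<open>k\<close>; both see the
        same vector at \<open>q k\<close>.\<close>
      have "\<delta>r k = differential B (piQ S) (q k) (\<delta>q k)" using \<delta>rk[of "k - 1"] k by simp
      then show ?thesis using dp[OF k(2)] Dq k \<delta>vk[OF k(2)] by simp
    qed
    have end0: "\<delta>r N = 0" using \<delta>rk[of "N - 1"] N ends by (simp add: differential_zero)
    have D: "(w k, 0) \<in> D_red S Hor (edges v r k)" if "k < N" for k
      using var[OF that] Dq that by (auto simp: w_def)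
    have last: "\<delta>v (N - 1) = w (N - 1)"
      using \<delta>vk[of "N - 1"] N ends zero by (simp add: w_def)
    have mid: "\<delta>v k = w k + P_red S Hor (edges v r k) (edges v r (k + 1)) (w (k + 1), 0)"
      if "1 \<le> k" "k \<le> N - 2" for k
      using \<delta>vk[of k] Pw[of k] that N by (simp add: w_def)
    have first: "\<delta>v 0 = P_red S Hor (edges v r 0) (edges v r 1) (w 1, 0)"
      using \<delta>vk[of 0] Pw[of 0] N ends zero by simp
    show ?l
      unfolding nh_variation_def associated_dldps_def dldps.simps
    proof (intro conjI exI[of _ w] allI ballI impI)
      fix k assume "k < N"
      then show "\<delta>v k \<in> tangent_space Gt (v k)" "\<delta>r (Suc k) \<in> tangent_space B (r (Suc k))"
        using conjunct1[OF tan] conjunct2[OF tan] by simp_all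
    next
      fix k assume "k \<in> {1..<N}"
      then show "\<delta>r k = differential B (pQG S) (v k) (\<delta>v k)" "(w k, 0) \<in> D_red S Hor (edges v r k)"
        using glue[of k] D[of k] by simp_all
    next
      fix k assume "k \<in> {1..N - 2}"
      then show "\<delta>v k = w k + P_red S Hor (edges v r k) (edges v r (k + 1)) (w (k + 1), 0)"
        using mid[of k] by simp
    qed (fact end0 last first)+
  qed
qed

text \<open>The kinematic condition is literally the same on both sides, and the same functional is
  evaluated, so it suffices that the two families of tuples coincide on the edges below
  \<open>N\<close>.\<close>

lemma trajectory_iff:
  assumes "discrete_path (associated_dldps S Hor) N v r" "lifted_path S Hor N v r q"
  shows "dldps_trajectory (associated_dldps S Hor) N v r \<longleftrightarrow> reduced_trajectory S Hor N v r q"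
    (is "?l \<longleftrightarrow> ?r")
proof -
  let ?M = "associated_dldps S Hor"
  let ?d = "\<lambda>\<delta>q k. dUps S Hor (q k, q (Suc k)) (\<delta>q k, \<delta>q (Suc k))"
  let ?adm = "\<lambda>\<delta>q. (\<forall>k\<le>N. \<delta>q k \<in> Dnh S (q k)) \<and> \<delta>q 0 = 0 \<and> \<delta>q N = 0"
  have cong: "d_action ?M N (edges v r) \<zeta> = d_action ?M N (edges v r) \<zeta>'"
    if "\<forall>k<N. \<zeta> k = \<zeta>' k" for \<zeta> \<zeta>'
    using that by (simp add: d_action_def)
  have "(\<forall>\<delta>v \<delta>r. nh_variation ?M N v r \<delta>v \<delta>r \<longrightarrow> d_action ?M N (edges v r) (edges \<delta>v \<delta>r) = 0) \<longleftrightarrow>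
    (\<forall>\<delta>q. ?adm \<delta>q \<longrightarrow> d_action ?M N (edges v r) (?d \<delta>q) = 0)" (is "?a \<longleftrightarrow> ?b")
  proof
    assume a: ?a
    show ?b
    proof (intro allI impI)
      fix \<delta>q assume adm: "?adm \<delta>q"
      define \<delta>v where "\<delta>v k = fst (?d \<delta>q k)" for k
      \<comment> \<open>The shift undoes the index convention of \<open>edges\<close>; the value at
        \<open>0\<close> is irrelevant.\<close>
      define \<delta>r where "\<delta>r k = snd (?d \<delta>q (k - 1))" for k
      have ed: "\<forall>k<N. edges \<delta>v \<delta>r k = ?d \<delta>q k" by (simp add: edges_def \<delta>v_def \<delta>r_def)
      then have "nh_variation ?M N v r \<delta>v \<delta>r" using nh_variation_iff[OF assms] adm by blast
      then have "d_action ?M N (edges v r) (edges \<delta>v \<delta>r) = 0" using a by blast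
      then show "d_action ?M N (edges v r) (?d \<delta>q) = 0" unfolding cong[OF ed] .
    qed
  next
    assume b: ?b
    show ?a
    proof (intro allI impI)
      fix \<delta>v \<delta>r assume "nh_variation ?M N v r \<delta>v \<delta>r"
      then obtain \<delta>q where adm: "?adm \<delta>q" and ed: "\<forall>k<N. edges \<delta>v \<delta>r k = ?d \<delta>q k"
        using nh_variation_iff[OF assms] by blast
      show "d_action ?M N (edges v r) (edges \<delta>v \<delta>r) = 0"
        unfolding cong[OF ed] using b adm by blast
    qed
  qed
  moreover have "kin ?M = Dd_red S Hor" by (simp add: associated_dldps_def)
  ultimately show ?thesis by (simp add: dldps_trajectory_def reduced_trajectory_def)
qed

end

text \<open>The existence clause keeps the quantification over lifts from being vacuous; together
  they show that the reduced condition does not depend on the chosen lift.\<close>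

theorem corollary3p16:
  fixes S :: "('q, 'e::euclidean_space, 'g, 'f::euclidean_space, 'b::euclidean_space) sym_system"
    and Hor :: "('q \<times> 'q) set"
    and N :: nat
    and v :: "nat \<Rightarrow> ('q \<times> 'g) set"
    and r :: "nat \<Rightarrow> 'q set"
  assumes "discrete_nh_system S"
    and "symmetry_group S"
    and "discrete_connection S Hor"
    and "connection_domain S Hor = points (config S) \<times> points (config S)"
    and "discrete_path (associated_dldps S Hor) N v r"
  shows "(\<exists>q. lifted_path S Hor N v r q) \<and>
    (\<forall>q. lifted_path S Hor N v r q \<longrightarrow>
       (dldps_trajectory (associated_dldps S Hor) N v r \<longleftrightarrow> reduced_trajectory S Hor N v r q))"
proof -
  interpret connected_system S Hor
    using assms(1-4) by unfold_locales
  show ?thesis using lifted_path_exists[OF assms(5)] trajectory_iff[OF assms(5)] by blast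
qed

end
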